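(* For each $n\in\mathbb{N}$ let $I_n\subset\mathbb{N}^r$ and $\mathbf{X}_{I_n}:=(X_{\mathbf{k}})_{\mathbf{k}\in I_n}$. Suppose that at least one of the following four conditions holds: (1) $I_n=\prod_{j=1}^r[k_j^{[1]},k_j^{[2]}]$ (the set of integer vectors in this box, whose bounds may depend on $n$), where $s_nk_j^{[2]}\to0$ as $n\to\infty$ for some $j$; (2) $I_n=\prod_{j=1}^r[k_j^{[1]},k_j^{[2]}]$ (the set of integer vectors in this box, whose bounds may depend on $n$), where $s_nk_j^{[1]}\to\infty$ as $n\to\infty$ for some $j$; (3) $\sup_{\mathbf{k}\in I_n}a(s_n\mathbf{k})=o(1)$ as $n\to\infty$; (4) $\inf_{\mathbf{k}\in I_n}a(s_n\mathbf{k})\to\infty$ as $n\to\infty$. Then $$\lim_{n\to\infty}d_{\mathrm{TV}}\!\left(Q_{q_n}(\mathbf{X}_{I_n}^{-1}),\,P_n(\mathbf{X}_{I_n}^{-1})\right)=0,$$ where $Q_{q_n}(\mathbf{X}_{I_n}^{-1})$ and $P_n(\mathbf{X}_{I_n}^{-1})$ denote the laws of $\mathbf{X}_{I_n}$ under $Q_{q_n}$ and $P_n$.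
   Context: Throughout $r\ge 2$ is a fixed integer and $\mathbb{N}=\{1,2,\dots\}$, $\mathbb{N}_0=\mathbb{N}\cup\{0\}$. For $\mathbf{y}\in\mathbb{R}^r_{\ge0}$ put $$a(\mathbf{y}):=\frac{1}{c_r}\prod_{1\le\ell\le j\le r}(y_\ell+\dots+y_j),\qquad c_r:=r!\,(r-1)!\cdots1!.$$ Finite-dimensional irreducible representations $\rho_{\mathbf{k}}$ of $\mathfrak{sl}_{r+1}(\mathbb{C})$ are indexed (up to isomorphism) by $\mathbf{k}\in\mathbb{N}^r$, with $\dim\rho_{\mathbf{k}}=a(\mathbf{k})$. A finite-dimensional representation $\rho$ (up to isomorphism, including the zero-dimensional one) is $\rho=\bigoplus_{\mathbf{k}\in\mathbb{N}^r}\rho_{\mathbf{k}}^{X_{\mathbf{k}}(\rho)}$ with multiplicities $X_{\mathbf{k}}(\rho)\in\mathbb{N}_0$, all but finitely many zero, and $\dim\rho=\sum_{\mathbf{k}}a(\mathbf{k})X_{\mathbf{k}}(\rho)$. $P_n$ is the uniform probability measure on the (finite) set of $n$-dimensional representations up to isomorphism. For $q\in(0,1)$, the Boltzmann model is the probability measure on the set of all finite-dimensional representations up to isomorphism $$Q_q(\rho):=q^{\dim(\rho)}\prod_{\mathbf{k}\in\mathbb{N}^r}\left(1-q^{a(\mathbf{k})}\right).$$ For $n\in\mathbb{N}$, $q_n\in(0,1)$ is the unique solution $q$ of $\sum_{\mathbf{k}\in\mathbb{N}^r}\frac{a(\mathbf{k})q^{a(\mathbf{k})}}{1-q^{a(\mathbf{k})}}=n$,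 and $s_n>0$ is defined by $q_n=\exp\big(-s_n^{r(r+1)/2}\big)$. For probability measures $\mu_1,\mu_2$ on $\mathbb{N}_0^d$, $d\in\mathbb{N}\cup\{\infty\}$, with all subsets as events, where $\mathbb{N}_0^\infty$ denotes the set of sequences in $\mathbb{N}_0$ with all but finitely many entries zero, $d_{\mathrm{TV}}(\mu_1,\mu_2):=\sup_{B\subset\mathbb{N}_0^d}|\mu_1(B)-\mu_2(B)|$. *)

theory Defs
  imports "HOL-Probability.Probability"
begin

text \<open>
  Vectors indexed by \<open>1, \<dots>, r\<close> are functions on \<open>nat\<close> of which only the values on \<open>{1..r}\<close>
  matter; index vectors with entries in \<open>{1, 2, \<dots>}\<close> are made unique by extensionality.
\<close>

definition irreps :: "nat \<Rightarrow> (nat \<Rightarrow> nat) set" where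
  "irreps r = ({1..r} \<rightarrow>\<^sub>E {1..})"

text \<open>
  At an index vector, \<open>dim_poly\<close> is the Weyl dimension formula; its value is then a positive
  integer, but it is kept as a real number since it is also evaluated at rescaled vectors.
\<close>

definition dim_poly :: "nat \<Rightarrow> (nat \<Rightarrow> real) \<Rightarrow> real" where
  "dim_poly r y = (\<Prod>j=1..r. \<Prod>l=1..j. \<Sum>i=l..j. y i) / (\<Prod>m=1..r. fact m)"

definition irrep_dim :: "nat \<Rightarrow> (nat \<Rightarrow> nat) \<Rightarrow> real" where
  "irrep_dim r k = dim_poly r (\<lambda>i. real (k i))"

text \<open>
  A finite-dimensional representation of \<open>sl(r+1, C)\<close> up to isomorphism is the finite multiset of
  its irreducible constituents, an irreducible one being given by its index vector.
  The multiplicity of the constituent \<open>k\<close> is \<open>count \<rho> k\<close>; the empty multiset is the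
  zero-dimensional representation.
\<close>

type_synonym rep = "(nat \<Rightarrow> nat) multiset"

definition reps :: "nat \<Rightarrow> rep set" where
  "reps r = {\<rho>. set_mset \<rho> \<subseteq> irreps r}"

definition rep_dim :: "nat \<Rightarrow> rep \<Rightarrow> real" where
  "rep_dim r \<rho> = (\<Sum>k\<in>set_mset \<rho>. irrep_dim r k * real (count \<rho> k))"

definition uniform_rep :: "nat \<Rightarrow> nat \<Rightarrow> rep measure" where
  "uniform_rep r n = uniform_count_measure {\<rho> \<in> reps r. rep_dim r \<rho> = real n}"

text \<open>
  Unordered infinite product, the multiplicative counterpart of \<^const>\<open>infsum\<close>.
\<close>

definition unordered_prod :: "('a \<Rightarrow> real) \<Rightarrow> 'a set \<Rightarrow> real" where
  "unordered_prod f A = Lim (finite_subsets_at_top A) (prod f)"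

definition boltzmann_weight :: "nat \<Rightarrow> real \<Rightarrow> rep \<Rightarrow> real" where
  "boltzmann_weight r q \<rho> =
     q powr rep_dim r \<rho> * unordered_prod (\<lambda>k. 1 - q powr irrep_dim r k) (irreps r)"

definition boltzmann_rep :: "nat \<Rightarrow> real \<Rightarrow> rep measure" where
  "boltzmann_rep r q = point_measure (reps r) (\<lambda>\<rho>. ennreal (boltzmann_weight r q \<rho>))"

text \<open>
  For \<open>n \<ge> 1\<close> the equations below have exactly one solution in the stated range.
\<close>

definition q_param :: "nat \<Rightarrow> nat \<Rightarrow> real" where
  "q_param r n = (THE q. 0 < q \<and> q < 1 \<and>
     ((\<lambda>k. irrep_dim r k * q powr irrep_dim r k / (1 - q powr irrep_dim r k))
        has_sum real n) (irreps r))"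

definition s_param :: "nat \<Rightarrow> nat \<Rightarrow> real" where
  "s_param r n = (THE s. 0 < s \<and> q_param r n = exp (- (s ^ (r * (r + 1) div 2))))"

text \<open>
  Vectors of multiplicities indexed by \<open>I\<close>. For finite \<open>I\<close> the support condition is void; for
  infinite \<open>I\<close> this is the space of finitely supported families.
\<close>

definition mult_vectors :: "(nat \<Rightarrow> nat) set \<Rightarrow> ((nat \<Rightarrow> nat) \<Rightarrow> nat) set" where
  "mult_vectors I = {x \<in> I \<rightarrow>\<^sub>E UNIV. finite {k \<in> I. x k \<noteq> 0}}"

definition mult_law ::
    "(nat \<Rightarrow> nat) set \<Rightarrow> rep measure \<Rightarrow> ((nat \<Rightarrow> nat) \<Rightarrow> nat) measure" where
  "mult_law I M = distr M (count_space (mult_vectors I)) (\<lambda>\<rho>. restrict (count \<rho>) I)"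

definition tv_dist :: "'a measure \<Rightarrow> 'a measure \<Rightarrow> real" where
  "tv_dist M N = (SUP B\<in>sets M. \<bar>measure M B - measure N B\<bar>)"

definition int_box :: "nat \<Rightarrow> (nat \<Rightarrow> real) \<Rightarrow> (nat \<Rightarrow> real) \<Rightarrow> (nat \<Rightarrow> nat) set" where
  "int_box r lo hi = {k \<in> irreps r. \<forall>j\<in>{1..r}. lo j \<le> real (k j) \<and> real (k j) \<le> hi j}"

text \<open>
  \<open>a(s\<^sub>n k)\<close> is nonnegative; taking its values in \<^typ>\<open>ennreal\<close> gives suprema over unbounded
  and infima over empty index sets their usual meaning.
\<close>

definition scaled_dim :: "nat \<Rightarrow> nat \<Rightarrow> (nat \<Rightarrow> nat) \<Rightarrow> ennreal" where
  "scaled_dim r n k = ennreal (dim_poly r (\<lambda>i. s_param r n * real (k i)))"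

end

theory Submission
  imports Defs "Jordan_Normal_Form.Determinant" "HOL-Number_Theory.Cong"
begin

text \<open>
  Let \<open>N\<close> be the dimension of a random representation. Under the Boltzmann measure the
  multiplicities are independent and geometric, and conditioning on \<open>N = n\<close> gives the uniform
  distribution. Split the representation into its constituents in \<open>I\<close> and those in the complement
  \<open>J\<close>, of dimensions \<open>N\<^sub>I\<close> and \<open>N\<^sub>J\<close>. For a configuration \<open>x\<close> of the constituents in \<open>I\<close>, of
  dimension \<open>|x|\<close>, the uniform model has the probability \<open>w(x) P(N\<^sub>J = n - |x|) / P(N = n)\<close>, where
  \<open>w(x)\<close> is its Boltzmann probability. Hence the two laws of the multiplicities in \<open>I\<close> differ by at most
  \<open>\<Sum>\<^sub>x w(x) |P(N = n) - P(N\<^sub>J = n - |x|)| / P(N = n)\<close>. With the characteristic functions \<open>\<phi>\<^sub>I\<close> and \<open>\<phi>\<^sub>J\<close>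
  of \<open>N\<^sub>I\<close> and \<open>N\<^sub>J\<close>, Fourier inversion represents the difference in the numerator as
  \<open>1 / (2 \<pi>)\<close> times the integral of \<open>\<phi>\<^sub>J(t) exp(- i n t) (\<phi>\<^sub>I(t) - exp(i t |x|))\<close>. Since the average over \<open>x\<close> of
  \<open>|\<phi>\<^sub>I(t) - exp(i t |x|)|\<^sup>2\<close> is \<open>1 - |\<phi>\<^sub>I(t)|\<^sup>2 \<le> t\<^sup>2 Var N\<^sub>I\<close>, Cauchy and Schwarz bound the sum by
  \<open>sqrt (Var N\<^sub>I)\<close> times the integral of \<open>|t \<phi>\<^sub>J(t)|\<close> (\<open>event_deviation_le\<close>). If \<open>|\<phi>\<^sub>J|\<close> is at most
  Gaussian of variance comparable to \<open>\<sigma>\<^sup>2 = Var N\<close>, this integral is of order \<open>1 / \<sigma>\<^sup>2\<close>. A local limit estimate at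
  the mean \<open>n\<close> gives \<open>P(N = n) \<ge> const / \<sigma>\<close> (\<open>prob_lower_bound\<close>), so the distance is of order
  \<open>sqrt (Var N\<^sub>I) / \<sigma>\<close>. What remains is about the dimension polynomial \<open>a\<close>, which is homogeneous of degree
  \<open>R = r (r + 1) / 2\<close>, on the scale \<open>s\<close> with \<open>q = exp (- s\<^sup>R)\<close>.

  \<^bold>\<open>Variances.\<close> The constituent \<open>k\<close> contributes \<open>s\<close> to the power \<open>- 2 R\<close> times a function of \<open>a(s k)\<close> that is at most
  a multiple of \<open>min(1, a(s k) powr (- 3))\<close>. Each factor \<open>y\<^sub>l + \<dots> + y\<^sub>j\<close> of \<open>a(y)\<close> is at least
  \<open>max(y\<^sub>l, y\<^sub>j)\<close>, the larger of its end points. On a logarithmic scale the means of the two end points sum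
  up to a multiple of \<open>\<Sum> ln y\<^sub>i\<close>, and the excess of the maximum over the mean measures how far apart the
  coordinates are (\<open>sum_max_roots_bound\<close>). So the weight is dominated by a product of functions
  of one coordinate whose integrals converge at \<open>0\<close> and at \<open>\<infinity>\<close>. Summing coordinate by coordinate gives
  \<open>\<sigma>\<^sup>2\<close> of order \<open>s\<close> to the power \<open>- 2 R - r\<close>, and \<open>Var N\<^sub>I = o(\<sigma>\<^sup>2)\<close> under each of the four conditions.

  \<^bold>\<open>Characteristic function.\<close> Consider the box of index vectors with entries between \<open>M\<close> and \<open>2 M\<close>,
  where \<open>M\<close> is about \<open>1 / s\<close>. By the variance bound, \<open>J\<close> contains almost all of it. Put \<open>\<theta> = t / (2 \<pi>)\<close>. If a positive proportion of
  the box has \<open>a(k) \<theta>\<close> away from the integers, then \<open>|\<phi>\<^sub>J(t)|\<close> is exponentially small in the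
  size of the box. Otherwise \<open>\<theta>\<close> is of order at most \<open>s\<^sup>R\<close> (\<open>far_from_integers\<close>) and the sines in \<open>|\<phi>\<^sub>J(t)|\<close>
  can be linearised, which gives the Gaussian bound. The dichotomy comes from differencing: \<open>R\<close> differences
  of step \<open>h\<close> along the direction \<open>(1, \<dots>, 1)\<close> turn \<open>a\<close> into \<open>R! h\<^sup>R\<close>, so \<open>R! h\<^sup>R \<theta>\<close> is near an
  integer for all \<open>h\<close> up to order \<open>M\<close>. This puts \<open>R! \<theta>\<close> within order \<open>s\<^sup>R\<close> of an integer, and a vector
  \<open>k\<close> of the box with \<open>a(k) \<equiv> 1\<close> modulo \<open>R!\<close> then puts \<open>\<theta>\<close> itself near an integer. Fourier inversion over
  one period needs the integrality of \<open>a(k)\<close>, which is a divisibility property of Vandermonde products.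
\<close>

section \<open>Integrality of the Weyl dimension formula\<close>

text \<open>
  The coefficients of the Newton product \<open>(y - x\<^sub>0) \<dots> (y - x\<^bsub>j-1\<^esub>)\<close> in the basis of binomial
  coefficients \<open>y choose m\<close>; the recursion multiplies by \<open>y - x\<^sub>j\<close>.
\<close>
fun newton_coeff :: "(nat \<Rightarrow> nat) \<Rightarrow> nat \<Rightarrow> nat \<Rightarrow> int" where
  "newton_coeff x 0 m = (if m = 0 then 1 else 0)"
| "newton_coeff x (Suc j) m =
     (if m = 0 then 0 else int m * newton_coeff x j (m - 1)) + (int m - int (x j)) * newton_coeff x j m"

lemma newton_coeff_eq_0: "m > j \<Longrightarrow> newton_coeff x j m = 0"
  by (induction j arbitrary: m) auto

lemma newton_coeff_diag: "newton_coeff x j j = fact j"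
proof (induction j)
  case (Suc j)
  show ?case using Suc newton_coeff_eq_0[of j "Suc j" x] by simp
qed auto

lemma mult_binomial: "int y * int (y choose m) = int (Suc m) * int (y choose Suc m) + int m * int (y choose m)"
proof (cases "m \<le> y")
  case True
  have "Suc m * (y choose Suc m) = (y choose m) * (y - m)"
    using binomial_absorb_comp[of y m] binomial_absorption[of m y]
    by (metis choose_mult_lemma binomial_eq_0 diff_Suc_1 mult.commute binomial_absorption binomial_absorb_comp)
  hence "int (Suc m) * int (y choose Suc m) = int (y choose m) * (int y - int m)"
    using True by (metis of_nat_diff of_nat_mult)
  thus ?thesis by (simp add: algebra_simps)
qed (simp add: binomial_eq_0)

lemma prod_diff_eq_newton:
  "(\<Prod>i<j. int y - int (x i)) = (\<Sum>m\<le>j. newton_coeff x j m * int (y choose m))"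
proof (induction j)
  case (Suc j)
  let ?T = "newton_coeff x j"
  have "(\<Prod>i<Suc j. int y - int (x i)) = (\<Sum>m\<le>j. ?T m * int (y choose m)) * (int y - int (x j))"
    by (simp add: Suc)
  also have "\<dots> = (\<Sum>m\<le>j. ?T m * (int y * int (y choose m)) - int (x j) * ?T m * int (y choose m))"
    unfolding sum_distrib_right by (intro sum.cong refl) (simp add: algebra_simps)
  also have "\<dots> = (\<Sum>m\<le>j. int (Suc m) * ?T m * int (y choose Suc m))
                 + (\<Sum>m\<le>j. (int m - int (x j)) * ?T m * int (y choose m))"
    unfolding mult_binomial by (simp add: sum.distrib[symmetric] algebra_simps)
  also have "(\<Sum>m\<le>j. int (Suc m) * ?T m * int (y choose Suc m))
      = (\<Sum>m\<le>Suc j. (if m = 0 then 0 else int m * ?T (m - 1)) * int (y choose m))"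
    by (subst sum.atMost_Suc_shift) simp
  also have "(\<Sum>m\<le>j. (int m - int (x j)) * ?T m * int (y choose m))
      = (\<Sum>m\<le>Suc j. (int m - int (x j)) * ?T m * int (y choose m))"
    by (simp add: newton_coeff_eq_0)
  finally show ?case by (simp only: sum.distrib[symmetric] newton_coeff.simps distrib_right)
qed auto

text \<open>
  The matrix of Newton products at the points \<open>x\<^sub>i\<close> is triangular, and its determinant is the
  Vandermonde product. It factors into the integer matrix of the binomial coefficients \<open>x\<^sub>i choose m\<close> and the
  triangular matrix of Newton coefficients, whose diagonal consists of the factorials.
\<close>
lemma superfactorial_dvd_vandermonde:
  "(\<Prod>j<n. fact j) dvd (\<Prod>j<n. \<Prod>i<j. int (x j) - int (x i))"
proof -
  define A where "A = mat n n (\<lambda>(i, m). int (x i choose m))"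
  define T where "T = mat n n (\<lambda>(m, j). newton_coeff x j m)"
  define V where "V = mat n n (\<lambda>(i, j). \<Prod>l<j. int (x i) - int (x l))"
  have V: "V = A * T"
  proof (rule eq_matI)
    fix i j assume ij: "i < dim_row (A * T)" "j < dim_col (A * T)"
    hence ij: "i < n" "j < n" by (auto simp: A_def T_def)
    have "(A * T) $$ (i, j) = (\<Sum>m<n. newton_coeff x j m * int (x i choose m))"
      using ij by (simp add: A_def T_def scalar_prod_def atLeast0LessThan mult.commute)
    also have "\<dots> = (\<Sum>m\<le>j. newton_coeff x j m * int (x i choose m))"
      using ij by (intro sum.mono_neutral_right) (auto simp: newton_coeff_eq_0)
    finally show "V $$ (i, j) = (A * T) $$ (i, j)"
      using ij by (simp add: V_def prod_diff_eq_newton)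
  qed (auto simp: A_def T_def V_def)
  have carr: "A \<in> carrier_mat n n" "T \<in> carrier_mat n n" "V \<in> carrier_mat n n"
    by (auto simp: A_def T_def V_def)
  have "det V = prod_list (diag_mat V)"
    by (rule det_lower_triangular[OF _ carr(3)]) (auto simp: V_def)
  also have "\<dots> = (\<Prod>j<n. \<Prod>i<j. int (x j) - int (x i))"
    by (simp add: diag_mat_def V_def prod.list_conv_set_nth atLeast0LessThan)
  finally have 1: "det V = (\<Prod>j<n. \<Prod>i<j. int (x j) - int (x i))" .
  have "det T = prod_list (diag_mat T)"
    by (rule det_upper_triangular[OF _ carr(2)])
       (auto simp: T_def newton_coeff_eq_0 intro!: upper_triangularI)
  also have "\<dots> = (\<Prod>j<n. fact j)"
    by (simp add: diag_mat_def T_def prod.list_conv_set_nth atLeast0LessThan newton_coeff_diag)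
  finally have 2: "det T = (\<Prod>j<n. fact j)" .
  have "det V = det A * det T"
    unfolding V by (rule det_mult[OF carr(1,2)])
  thus ?thesis using 1 2 by simp
qed

definition superfact :: "nat \<Rightarrow> nat" where
  "superfact r = (\<Prod>m=1..r. fact m)"

lemma superfact_pos: "superfact r > 0"
  by (simp add: superfact_def)

text \<open>
  The pair \<open>(j, l)\<close> stands for the positive root \<open>\<alpha>\<^sub>l + \<dots> + \<alpha>\<^sub>j\<close> of \<open>sl(r + 1)\<close>, so that
  the dimension polynomial is a product over this set.
\<close>
definition roots :: "nat \<Rightarrow> (nat \<times> nat) set" where
  "roots r = (SIGMA j:{1..r}. {1..j})"

definition num_roots :: "nat \<Rightarrow> nat" where
  "num_roots r = r * (r + 1) div 2"

lemma finite_roots [simp]: "finite (roots r)"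
  by (simp add: roots_def)

lemma card_roots: "card (roots r) = num_roots r"
proof -
  have "card (roots r) = (\<Sum>j=1..r. j)"
    by (simp add: roots_def)
  also have "\<dots> = num_roots r"
    unfolding num_roots_def
  proof (induction r)
    case (Suc n)
    have "(\<Sum>j=1..Suc n. j) = n * (n + 1) div 2 + Suc n" using Suc by simp
    also have "\<dots> = Suc n * (Suc n + 1) div 2"
    proof -
      have "Suc n * (Suc n + 1) = n * (n + 1) + Suc n * 2" by simp
      thus ?thesis by presburger
    qed
    finally show ?case .
  qed auto
  finally show ?thesis .
qed

lemma num_roots_ge: "r \<le> num_roots r"
proof -
  have "r * 2 \<le> r * (r + 1)" by (cases r) auto
  thus ?thesis unfolding num_roots_def by linarith
qed

lemma dim_poly_roots:
  "dim_poly r y = (\<Prod>(j, l)\<in>roots r. \<Sum>i=l..j. y i) / real (superfact r)"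
  by (simp add: dim_poly_def roots_def superfact_def prod.Sigma)

lemma prod_root_heights: "(\<Prod>(j, l)\<in>roots r. Suc j - l) = superfact r"
proof -
  have *: "(\<Prod>l=Suc 0..j. Suc j - l) = fact j" for j
  proof -
    have "(\<Prod>l=Suc 0..j. Suc j - l) = (\<Prod>i<j. j - i)"
      by (rule prod.reindex_bij_witness[of _ Suc "\<lambda>l. l - 1"]) auto
    thus ?thesis using fact_prod_rev[of j, where 'a=nat] by (simp add: atLeast0LessThan)
  qed
  show ?thesis
    unfolding roots_def superfact_def using * by (simp add: prod.Sigma[symmetric])
qed

definition root_prod :: "nat \<Rightarrow> (nat \<Rightarrow> nat) \<Rightarrow> nat" where
  "root_prod r k = (\<Prod>(j, l)\<in>roots r. \<Sum>i=l..j. k i)"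

lemma irrep_dim_root_prod: "irrep_dim r k = real (root_prod r k) / real (superfact r)"
  by (simp add: irrep_dim_def dim_poly_roots root_prod_def case_prod_unfold)

text \<open>
  In terms of the partial sums of \<open>k\<close> the product over the roots is a Vandermonde product.
\<close>
lemma superfact_dvd_root_prod: "superfact r dvd root_prod r k"
proof -
  define x where "x j = (\<Sum>i=1..j. k i)" for j
  have "(\<Prod>j<Suc r. \<Prod>i<j. int (x j) - int (x i)) = (\<Prod>j=1..r. \<Prod>i<j. int (x j) - int (x i))"
    by (subst prod.lessThan_Suc_shift) (simp add: prod.atLeast1_atMost_eq)
  also have "\<dots> = (\<Prod>j=1..r. \<Prod>l=1..j. \<Sum>i=l..j. int (k i))"
  proof (rule prod.cong[OF refl])
    fix j
    have "int (x j) - int (x i) = (\<Sum>m=Suc i..j. int (k m))" if "i < j" for i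
    proof -
      have "x j = x i + (\<Sum>m=Suc i..j. k m)"
        unfolding x_def using that by (metis Suc_eq_plus1 add.commute le_add1 less_imp_le sum.ub_add_nat le_add_diff_inverse)
      thus ?thesis by simp
    qed
    thus "(\<Prod>i<j. int (x j) - int (x i)) = (\<Prod>l=1..j. \<Sum>i=l..j. int (k i))"
      by (simp add: prod.atLeast1_atMost_eq)
  qed
  also have "\<dots> = int (root_prod r k)"
    by (simp add: root_prod_def roots_def prod.Sigma case_prod_unfold)
  finally have "(\<Prod>j<Suc r. fact j) dvd int (root_prod r k)"
    using superfactorial_dvd_vandermonde[where n="Suc r" and x=x] by simp
  moreover have "(\<Prod>j<Suc r. fact j) = int (superfact r)"
    unfolding superfact_def of_nat_prod of_nat_fact
    by (subst prod.lessThan_Suc_shift) (simp only: prod.atLeast1_atMost_eq One_nat_def fact_0 mult_1)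
  ultimately show ?thesis by (simp only: int_dvd_int_iff)
qed

definition nat_dim :: "nat \<Rightarrow> (nat \<Rightarrow> nat) \<Rightarrow> nat" where
  "nat_dim r k = root_prod r k div superfact r"

lemma irrep_dim_nat: "irrep_dim r k = real (nat_dim r k)"
  using superfact_dvd_root_prod[of r k]
  by (simp add: irrep_dim_root_prod nat_dim_def real_of_nat_div)

lemma root_prod_mono:
  assumes "\<And>i. i \<in> {1..r} \<Longrightarrow> k i \<le> k' i"
  shows "root_prod r k \<le> root_prod r k'"
  unfolding root_prod_def
  by (intro prod_mono) (auto simp: roots_def intro!: sum_mono assms)

lemma root_prod_const: "root_prod r (\<lambda>_. m) = superfact r * m ^ num_roots r"
proof -
  have "root_prod r (\<lambda>_. m) = (\<Prod>p\<in>roots r. (case p of (j, l) \<Rightarrow> Suc j - l) * m)"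
    by (simp add: root_prod_def case_prod_unfold)
  also have "\<dots> = superfact r * m ^ num_roots r"
    by (subst prod.distrib) (simp add: prod_root_heights card_roots)
  finally show ?thesis .
qed

lemma irrep_dim_le:
  assumes "\<And>i. i \<in> {1..r} \<Longrightarrow> k i \<le> m"
  shows "irrep_dim r k \<le> real m ^ num_roots r"
proof -
  have "real (root_prod r k) \<le> real (superfact r) * real m ^ num_roots r"
    using root_prod_mono[of r k "\<lambda>_. m"] assms unfolding root_prod_const
    by (metis of_nat_le_iff of_nat_mult of_nat_power)
  thus ?thesis using superfact_pos[of r]
    by (simp add: irrep_dim_root_prod divide_le_eq mult.commute)
qed

lemma irrep_dim_ge:
  assumes "\<And>i. i \<in> {1..r} \<Longrightarrow> m \<le> k i"
  shows "irrep_dim r k \<ge> real m ^ num_roots r"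
proof -
  have "real (root_prod r k) \<ge> real (superfact r) * real m ^ num_roots r"
    using root_prod_mono[of r "\<lambda>_. m" k] assms unfolding root_prod_const
    by (metis of_nat_le_iff of_nat_mult of_nat_power)
  thus ?thesis using superfact_pos[of r]
    by (simp add: irrep_dim_root_prod le_divide_eq mult.commute)
qed

lemma nat_dim_ge_1:
  assumes "k \<in> irreps r"
  shows "nat_dim r k \<ge> 1"
proof -
  have "irrep_dim r k \<ge> 1 ^ num_roots r"
    using irrep_dim_ge[of r 1 k] assms by (auto simp: irreps_def PiE_def Pi_def)
  thus ?thesis by (simp add: irrep_dim_nat)
qed

section \<open>Finite differences\<close>

text \<open>
  The \<open>n\<close>-th forward difference with step \<open>h\<close>.
\<close>
definition fdiff :: "nat \<Rightarrow> real \<Rightarrow> (real \<Rightarrow> real) \<Rightarrow> real \<Rightarrow> real" where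
  "fdiff n h f x = (\<Sum>i\<le>n. (-1) ^ (n - i) * real (n choose i) * f (x + real i * h))"

lemma fdiff_Suc: "fdiff (Suc n) h f x = fdiff n h (\<lambda>x. f (x + h) - f x) x"
proof -
  let ?g = "\<lambda>i. f (x + real i * h)"
  have "fdiff (Suc n) h f x
    = (-1) ^ Suc n * ?g 0 + (\<Sum>i\<le>n. (-1) ^ (n - i) * real (Suc n choose Suc i) * ?g (Suc i))"
    unfolding fdiff_def by (subst sum.atMost_Suc_shift) simp
  also have "(\<Sum>i\<le>n. (-1) ^ (n - i) * real (Suc n choose Suc i) * ?g (Suc i))
    = (\<Sum>i\<le>n. (-1) ^ (n - i) * real (n choose i) * ?g (Suc i))
      + (\<Sum>i\<le>n. (-1) ^ (n - i) * real (n choose Suc i) * ?g (Suc i))"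
    by (simp add: sum.distrib[symmetric] algebra_simps)
  also have "(-1) ^ Suc n * ?g 0 + \<dots> = (\<Sum>i\<le>n. (-1) ^ (n - i) * real (n choose i) * ?g (Suc i))
      + (\<Sum>i\<le>Suc n. (-1) ^ (Suc n - i) * real (n choose i) * ?g i)"
    by (simp add: sum.atMost_Suc_shift[of "\<lambda>i. (-1) ^ (Suc n - i) * real (n choose i) * ?g i" n]
             del: sum.atMost_Suc)
  also have "(\<Sum>i\<le>Suc n. (-1) ^ (Suc n - i) * real (n choose i) * ?g i)
      = - (\<Sum>i\<le>n. (-1) ^ (n - i) * real (n choose i) * ?g i)"
    by (simp add: binomial_eq_0 Suc_diff_le sum_negf[symmetric])
  finally show ?thesis
    unfolding fdiff_def by (simp add: algebra_simps sum_subtractf)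
qed

lemma poly_shift_diff:
  fixes p :: "real poly"
  assumes "degree p \<le> Suc n"
  shows "degree (pcompose p [:h, 1:] - p) \<le> n \<and>
         coeff (pcompose p [:h, 1:] - p) n = real (Suc n) * h * coeff p (Suc n)"
  using assms
proof (induction n arbitrary: p)
  case 0
  obtain a b where p: "p = [:a, b:]"
  proof -
    obtain a p' where 1: "p = pCons a p'" by (cases p)
    with 0 have "degree p' = 0" by (auto split: if_splits)
    then obtain b where "p' = [:b:]" using degree_eq_zeroE by blast
    with 1 that show ?thesis by blast
  qed
  have "pcompose p [:h, 1:] - p = [:h * b:]"
    by (simp add: p pcompose_pCons)
  thus ?case by (simp add: p)
next
  case (Suc n)
  obtain a p' where p: "p = pCons a p'" by (cases p)
  define q where "q = pcompose p' [:h, 1:] - p'"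
  have *: "pcompose p [:h, 1:] - p = pCons 0 q + Polynomial.smult h (q + p')"
    by (simp add: p q_def pcompose_pCons algebra_simps)
  have d: "degree p' \<le> Suc n" using Suc.prems by (auto simp: p split: if_splits)
  have q: "degree q \<le> n" "coeff q n = real (Suc n) * h * coeff p' (Suc n)"
    using Suc.IH[OF d] by (auto simp: q_def)
  have "degree (pCons 0 q) \<le> Suc n" "degree (Polynomial.smult h (q + p')) \<le> Suc n"
    using q(1) d by (auto intro!: degree_add_le degree_smult_le[THEN order_trans])
  hence "degree (pcompose p [:h, 1:] - p) \<le> Suc n"
    unfolding * by (rule degree_add_le)
  moreover have "coeff q (Suc n) = 0" using q(1) by (intro coeff_eq_0) auto
  hence "coeff (pcompose p [:h, 1:] - p) (Suc n) = real (Suc (Suc n)) * h * coeff p (Suc (Suc n))"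
    unfolding * using q(2) by (simp add: p algebra_simps)
  ultimately show ?case by blast
qed

text \<open>
  One difference lowers the degree by one and multiplies the leading coefficient by \<open>h\<close> and
  the degree.
\<close>
lemma fdiff_poly:
  assumes "degree p \<le> n"
  shows "fdiff n h (poly p) x = fact n * h ^ n * coeff p n"
  using assms
proof (induction n arbitrary: p)
  case 0
  then obtain a where "p = [:a:]" using degree_eq_zeroE by blast
  thus ?case by (simp add: fdiff_def)
next
  case (Suc n)
  have "fdiff (Suc n) h (poly p) x = fdiff n h (poly (pcompose p [:h, 1:] - p)) x"
    unfolding fdiff_Suc by (rule arg_cong[where f="\<lambda>f. fdiff n h f x"]) (auto simp: poly_pcompose add.commute)
  also have "\<dots> = fact n * h ^ n * (real (Suc n) * h * coeff p (Suc n))"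
    unfolding Suc.IH[OF poly_shift_diff[OF Suc.prems, THEN conjunct1]] poly_shift_diff[OF Suc.prems, THEN conjunct2] ..
  finally show ?case by simp
qed

text \<open>
  The dimension polynomial along the line through \<open>k\<close> in the direction \<open>(1, \<dots>, 1)\<close>. It is
  monic, because the dimension polynomial is homogeneous and has the value \<open>1\<close> at \<open>(1, \<dots>, 1)\<close>.
\<close>
definition line_poly :: "nat \<Rightarrow> (nat \<Rightarrow> nat) \<Rightarrow> real poly" where
  "line_poly r k = Polynomial.smult (1 / real (superfact r))
     (\<Prod>(j, l)\<in>roots r. [:real (\<Sum>i=l..j. k i), real (Suc j - l):])"

lemma poly_line_poly: "poly (line_poly r k) (real m) = irrep_dim r (\<lambda>i. k i + m)"
proof -
  have "(\<Prod>p\<in>roots r. poly (case p of (j, l) \<Rightarrow> [:real (\<Sum>i=l..j. k i), real (Suc j - l):]) (real m))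
      = (\<Prod>p\<in>roots r. real (case p of (j, l) \<Rightarrow> \<Sum>i=l..j. k i + m))"
    by (intro prod.cong refl) (auto simp: sum.distrib of_nat_mult[symmetric] simp del: of_nat_mult)
  thus ?thesis
    unfolding line_poly_def irrep_dim_root_prod root_prod_def poly_smult poly_prod by simp
qed

lemma line_poly_degree: "degree (line_poly r k) = num_roots r"
  and line_poly_coeff: "coeff (line_poly r k) (num_roots r) = 1"
proof -
  let ?f = "\<lambda>p. case p of (j, l) \<Rightarrow> [:real (\<Sum>i=l..j. k i), real (Suc j - l):]"
  have deg: "degree (?f p) = 1" and lc: "lead_coeff (?f p) = real (case p of (j, l) \<Rightarrow> Suc j - l)"
    if "p \<in> roots r" for p
    using that by (auto simp: roots_def)
  have "degree (prod ?f (roots r)) = (\<Sum>p\<in>roots r. degree (?f p))"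
    by (rule degree_prod_eq_sum_degree) (use deg in fastforce)
  also have "\<dots> = num_roots r" using deg by (simp add: card_roots)
  finally have 1: "degree (prod ?f (roots r)) = num_roots r" .
  thus "degree (line_poly r k) = num_roots r"
    using superfact_pos[of r] by (simp add: line_poly_def)
  have "lead_coeff (prod ?f (roots r)) = (\<Prod>p\<in>roots r. real (case p of (j, l) \<Rightarrow> Suc j - l))"
    unfolding lead_coeff_prod by (intro prod.cong refl lc)
  also have "\<dots> = real (superfact r)"
    by (simp add: prod_root_heights[symmetric])
  finally have "coeff (prod ?f (roots r)) (num_roots r) = real (superfact r)"
    unfolding 1 .
  thus "coeff (line_poly r k) (num_roots r) = 1"
    using superfact_pos[of r] by (simp add: line_poly_def)
qed

section \<open>Simultaneous approximation\<close>

definition near :: "real \<Rightarrow> real \<Rightarrow> bool" where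
  "near \<delta> x \<longleftrightarrow> (\<exists>z::int. \<bar>x - of_int z\<bar> \<le> \<delta>)"

lemma near_sum:
  assumes "finite A" "\<And>i. i \<in> A \<Longrightarrow> near \<delta> (x i)"
  shows "near ((\<Sum>i\<in>A. \<bar>real_of_int (c i)\<bar>) * \<delta>) (\<Sum>i\<in>A. real_of_int (c i) * x i)"
proof -
  from assms(2) obtain z where z: "\<And>i. i \<in> A \<Longrightarrow> \<bar>x i - real_of_int (z i)\<bar> \<le> \<delta>"
    unfolding near_def by metis
  have "\<bar>(\<Sum>i\<in>A. real_of_int (c i) * x i) - of_int (\<Sum>i\<in>A. c i * z i)\<bar>
      = \<bar>\<Sum>i\<in>A. real_of_int (c i) * (x i - z i)\<bar>"
    by (simp add: sum_subtractf algebra_simps)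
  also have "\<dots> \<le> (\<Sum>i\<in>A. \<bar>real_of_int (c i)\<bar> * \<bar>x i - z i\<bar>)"
    unfolding abs_mult[symmetric] by (rule sum_abs)
  also have "\<dots> \<le> (\<Sum>i\<in>A. \<bar>real_of_int (c i)\<bar> * \<delta>)"
    by (intro sum_mono mult_left_mono z) auto
  finally show ?thesis unfolding near_def sum_distrib_right by blast
qed

text \<open>
  Let \<open>\<beta>\<close> be the distance of \<open>x\<close> from a nearest integer. If \<open>h\<^sup>R \<beta>\<close> is at most \<open>\<delta>\<close>, then \<open>(h + 1)\<^sup>R \<beta>\<close>
  is larger by a factor of at most \<open>2\<^sup>R\<close>, hence still below one half. The integer near it can only be \<open>0\<close>,
  so it is at most \<open>\<delta>\<close> again. Thus \<open>\<beta>\<close> has the order \<open>\<delta> / H\<^sup>R\<close>, much smaller than \<open>\<delta>\<close>.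
\<close>
lemma near_powers:
  assumes near: "\<And>h. 1 \<le> h \<Longrightarrow> h \<le> H \<Longrightarrow> near \<delta> (real h ^ R * x)"
    and "1 \<le> H" and \<delta>: "2 ^ R * \<delta> < 1 / 2"
  obtains b :: int where "\<bar>x - of_int b\<bar> * real H ^ R \<le> \<delta>"
proof -
  obtain b :: int where b: "\<bar>x - of_int b\<bar> \<le> \<delta>"
    using near[of 1] assms(2) by (auto simp: near_def)
  have \<delta>0: "0 \<le> \<delta>" using b by linarith
  have \<delta>': "\<delta> \<le> 2 ^ R * \<delta>" using \<delta>0 by (simp add: mult_le_cancel_right1)
  define \<beta> where "\<beta> = x - of_int b"
  have "\<bar>\<beta>\<bar> * real h ^ R \<le> \<delta>" if "1 \<le> h" "h \<le> H" for h
    using that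
  proof (induction h rule: dec_induct)
    case base
    show ?case using b by (simp add: \<beta>_def)
  next
    case (step h)
    have "real (Suc h) ^ R \<le> (2 * real h) ^ R"
      using step.hyps by (intro power_mono) auto
    hence "\<bar>\<beta>\<bar> * real (Suc h) ^ R \<le> \<bar>\<beta>\<bar> * (2 * real h) ^ R"
      by (intro mult_left_mono) auto
    also have "\<dots> = 2 ^ R * (\<bar>\<beta>\<bar> * real h ^ R)" by (simp add: power_mult_distrib)
    also have "\<dots> \<le> 2 ^ R * \<delta>" using step by (intro mult_left_mono) auto
    finally have 1: "\<bar>\<beta>\<bar> * real (Suc h) ^ R < 1 / 2" using \<delta> by linarith
    obtain z :: int where z: "\<bar>real (Suc h) ^ R * x - of_int z\<bar> \<le> \<delta>"
      using near[of "Suc h"] step by (auto simp: near_def)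
    define w where "w = z - int (Suc h) ^ R * b"
    have 2: "\<bar>real (Suc h) ^ R * \<beta> - of_int w\<bar> \<le> \<delta>"
      using z by (simp add: \<beta>_def w_def algebra_simps)
    have "\<bar>real (Suc h) ^ R * \<beta>\<bar> < 1 / 2" using 1 by (simp add: abs_mult mult.commute)
    hence "\<bar>real_of_int w\<bar> < 1" using 2 \<delta> \<delta>' by linarith
    hence "w = 0" by linarith
    thus ?case using 2 by (simp add: abs_mult mult.commute)
  qed
  from this[of H] assms(2) show ?thesis by (intro that[of b]) (auto simp: \<beta>_def)
qed

definition index_box :: "nat \<Rightarrow> nat \<Rightarrow> (nat \<Rightarrow> nat) set" where
  "index_box r M = ({1..r} \<rightarrow>\<^sub>E {M..<2 * M})"

lemma finite_index_box [simp]: "finite (index_box r M)"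
  by (simp add: index_box_def finite_PiE)

lemma card_index_box: "card (index_box r M) = M ^ r"
  by (simp add: index_box_def card_PiE)

lemma index_box_subset_irreps: "M \<ge> 1 \<Longrightarrow> index_box r M \<subseteq> irreps r"
  by (auto simp: index_box_def irreps_def PiE_def Pi_def)

definition bad_indices :: "nat \<Rightarrow> nat \<Rightarrow> real \<Rightarrow> real \<Rightarrow> (nat \<Rightarrow> nat) set" where
  "bad_indices r M \<eta> \<theta> = {k \<in> index_box r M. \<not> near \<eta> (irrep_dim r k * \<theta>)}"

lemma irrep_dim_cong: "(\<And>i. i \<in> {1..r} \<Longrightarrow> k i = k' i) \<Longrightarrow> irrep_dim r k = irrep_dim r k'"
  unfolding irrep_dim_root_prod root_prod_def
  by (intro arg_cong2[where f="(/)"] arg_cong[where f=real] prod.cong refl) (auto simp: roots_def intro!: sum.cong)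

text \<open>
  Each of the shifts by \<open>0, h, \<dots>, R h\<close> maps a corner of the box injectively into the box. If
  there are few bad vectors, the shifted copies of the bad set cannot cover the corner.
\<close>
lemma good_progression:
  assumes step: "num_roots r * h \<le> M div 2"
    and few: "(real (num_roots r) + 1) * real (card (bad_indices r M \<eta> \<theta>)) < (real M / 2) ^ r"
  obtains k where "\<And>i. i \<le> num_roots r \<Longrightarrow> near \<eta> (irrep_dim r (\<lambda>j. k j + i * h) * \<theta>)"
proof (rule ccontr)
  assume "\<not> thesis"
  with that have none: "\<exists>i\<le>num_roots r. \<not> near \<eta> (irrep_dim r (\<lambda>j. k j + i * h) * \<theta>)" for k
    by blast
  define S where "S = ({1..r} \<rightarrow>\<^sub>E {M..<M + (M - M div 2)})"
  define sh where "sh i k = restrict (\<lambda>j. k j + i * h) {1..r}" for i :: nat and k :: "nat \<Rightarrow> nat"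
  have ih: "i * h \<le> M div 2" if "i \<le> num_roots r" for i
    using mult_le_mono1[OF that, of h] step by linarith
  have "S \<subseteq> (\<Union>i\<in>{..num_roots r}. {k \<in> S. sh i k \<in> bad_indices r M \<eta> \<theta>})"
  proof
    fix k assume k: "k \<in> S"
    obtain i where i: "i \<le> num_roots r" "\<not> near \<eta> (irrep_dim r (\<lambda>j. k j + i * h) * \<theta>)"
      using none by blast
    have "irrep_dim r (sh i k) = irrep_dim r (\<lambda>j. k j + i * h)"
      by (rule irrep_dim_cong) (auto simp: sh_def)
    moreover have "sh i k \<in> index_box r M"
      using k ih[OF i(1)] by (fastforce simp: sh_def index_box_def S_def PiE_def Pi_def extensional_def)
    ultimately show "k \<in> (\<Union>i\<in>{..num_roots r}. {k \<in> S. sh i k \<in> bad_indices r M \<eta> \<theta>})"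
      using i k by (auto simp: bad_indices_def)
  qed
  hence "card S \<le> card (\<Union>i\<in>{..num_roots r}. {k \<in> S. sh i k \<in> bad_indices r M \<eta> \<theta>})"
    by (intro card_mono) (auto simp: S_def intro!: finite_PiE)
  also have "\<dots> \<le> (\<Sum>i\<le>num_roots r. card {k \<in> S. sh i k \<in> bad_indices r M \<eta> \<theta>})"
    by (rule card_UN_le) auto
  also have "\<dots> \<le> (\<Sum>i\<le>num_roots r. card (bad_indices r M \<eta> \<theta>))"
  proof (intro sum_mono card_inj_on_le)
    fix i
    show "inj_on (sh i) {k \<in> S. sh i k \<in> bad_indices r M \<eta> \<theta>}"
    proof (rule inj_onI)
      fix k k' assume *: "k \<in> {k \<in> S. sh i k \<in> bad_indices r M \<eta> \<theta>}"
         "k' \<in> {k \<in> S. sh i k \<in> bad_indices r M \<eta> \<theta>}" "sh i k = sh i k'"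
      have "k j = k' j" if "j \<in> {1..r}" for j
        using fun_cong[OF *(3), of j] that by (auto simp: sh_def)
      thus "k = k'" using * by (intro PiE_ext[of k _ _ k']) (auto simp: S_def)
    qed
  qed (auto simp: bad_indices_def)
  also have "\<dots> = (num_roots r + 1) * card (bad_indices r M \<eta> \<theta>)" by simp
  finally have "real (card S) \<le> (real (num_roots r) + 1) * real (card (bad_indices r M \<eta> \<theta>))"
    by (metis of_nat_le_iff of_nat_mult of_nat_add of_nat_1)
  moreover have "real (card S) \<ge> (real M / 2) ^ r"
  proof -
    have "card S = (M - M div 2) ^ r" by (simp add: S_def card_PiE)
    moreover have "real M / 2 \<le> real (M - M div 2)" by linarith
    ultimately show ?thesis by (simp add: power_mono)
  qed
  ultimately show False using few by linarith
qed

text \<open>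
  The vectors with all entries congruent to \<open>1\<close> modulo \<open>L\<close> are a positive proportion of the box,
  so not all of them are bad.
\<close>
lemma good_congruent:
  assumes L: "L \<ge> 2" and M: "M \<ge> 4 * L"
    and few: "real (card (bad_indices r M \<eta> \<theta>)) < (real M / (2 * real L)) ^ r"
  obtains k where "k \<in> index_box r M" "near \<eta> (irrep_dim r k * \<theta>)" "\<And>i. i \<in> {1..r} \<Longrightarrow> k i mod L = 1"
proof -
  define A where "A = (\<lambda>m. 1 + L * m) ` {M div L + 1..<2 * (M div L)}"
  define S where "S = ({1..r} \<rightarrow>\<^sub>E A)"
  have divL: "M div L * L \<le> M" "M < (M div L + 1) * L"
    using L dividend_less_times_div[of L M] by (simp_all add: mult.commute)
  have A: "A \<subseteq> {M..<2 * M}"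
  proof
    fix a assume "a \<in> A"
    then obtain m where m: "a = 1 + L * m" "M div L + 1 \<le> m" "m + 1 \<le> 2 * (M div L)"
      unfolding A_def by fastforce
    have "L * (M div L + 1) \<le> L * m" using m by (intro mult_left_mono) auto
    moreover have "L * (m + 1) \<le> L * (2 * (M div L))" using m by (intro mult_left_mono) auto
    moreover have "L * (2 * (M div L)) \<le> 2 * M" using mult_le_mono2[OF divL(1), of 2] by (simp add: mult_ac)
    moreover have "L * (M div L + 1) > M" using divL(2) by (simp add: mult.commute)
    moreover have "L * (m + 1) = L * m + L" by simp
    ultimately have "M \<le> a" "a < 2 * M" using L m(1) by linarith+
    thus "a \<in> {M..<2 * M}" by simp
  qed
  have "card A = 2 * (M div L) - (M div L + 1)"
    unfolding A_def by (subst card_image) (use L in \<open>auto simp: inj_on_def\<close>)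
  moreover have "real M / (2 * real L) \<le> real (2 * (M div L) - (M div L + 1))"
  proof -
    have "4 \<le> M div L" using M L by (metis div_le_mono nonzero_mult_div_cancel_right not_numeral_le_zero)
    moreover have "real M < (real (M div L) + 1) * real L"
      using divL(2) by (metis of_nat_less_iff of_nat_mult of_nat_add of_nat_1)
    hence "real M / real L < real (M div L) + 1" using L by (simp add: divide_less_eq)
    moreover have "real (2 * (M div L) - (M div L + 1)) = real (M div L) - 1"
      using \<open>4 \<le> M div L\<close> by (simp add: of_nat_diff)
    ultimately show ?thesis by simp
  qed
  ultimately have cA: "real M / (2 * real L) \<le> real (card A)" by simp
  have "(real M / (2 * real L)) ^ r \<le> real (card S)"
    using power_mono[OF cA, of r] by (simp add: S_def card_PiE)
  hence "card (bad_indices r M \<eta> \<theta>) < card S" using few by linarith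
  hence "\<not> S \<subseteq> bad_indices r M \<eta> \<theta>"
    using card_mono[of "bad_indices r M \<eta> \<theta>" S] by (auto simp: bad_indices_def)
  moreover have "S \<subseteq> index_box r M"
    unfolding S_def index_box_def by (intro PiE_mono) (use A in auto)
  ultimately obtain k where k: "k \<in> S" "k \<in> index_box r M" "near \<eta> (irrep_dim r k * \<theta>)"
    by (auto simp: bad_indices_def)
  have "k i mod L = 1" if "i \<in> {1..r}" for i
  proof -
    have "k i \<in> A" using k(1) that by (auto simp: S_def)
    then obtain m where "k i = 1 + L * m" by (auto simp: A_def)
    thus ?thesis using L mod_mult_self2[of 1 L m] by simp
  qed
  thus ?thesis using that k by blast
qed

lemma nat_dim_congruent:
  assumes "\<And>i. i \<in> {1..r} \<Longrightarrow> k i mod (superfact r * m) = 1"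
  obtains z :: int where "irrep_dim r k = 1 + real m * of_int z"
proof -
  let ?L = "superfact r * m"
  have "[root_prod r k = root_prod r (\<lambda>_. 1)] (mod ?L)"
    unfolding root_prod_def case_prod_unfold
  proof (intro cong_prod cong_sum)
    fix p i assume "p \<in> roots r" "i \<in> {snd p..fst p}"
    hence "i \<in> {1..r}" by (auto simp: roots_def)
    from assms[OF this] show "[k i = 1] (mod ?L)"
      by (metis cong_def mod_mod_trivial)
  qed
  hence "[int (superfact r * nat_dim r k) = int (superfact r * 1)] (mod int ?L)"
    using superfact_dvd_root_prod[of r k]
    by (simp add: cong_int_iff nat_dim_def root_prod_const del: of_nat_mult)
  hence "int ?L dvd int (superfact r) * (int (nat_dim r k) - 1)"
    by (simp add: cong_iff_dvd_diff algebra_simps)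
  hence "int m dvd int (nat_dim r k) - 1"
    using superfact_pos[of r] by simp
  then obtain z where "int (nat_dim r k) - 1 = int m * z" by blast
  hence "real_of_int (int (nat_dim r k)) = real_of_int (1 + int m * z)" by linarith
  thus ?thesis by (intro that[of z]) (simp add: irrep_dim_nat)
qed

text \<open>
  A positive proportion of a large box has \<open>dim * \<theta>\<close> far from the integers, unless \<open>\<theta>\<close> is so
  small that \<open>dim * \<theta>\<close> stays below one half in absolute value on the whole box. Let \<open>R\<close> be the number of positive roots.
  If few vectors are bad, every step \<open>h\<close> admits a progression of good ones, and
  differencing along it shows that \<open>R! h\<^sup>R \<theta>\<close> is near an integer. The step \<open>h\<close> may be as large as the box
  permits, so \<open>R! \<theta>\<close> has a distance from the integers comparable to the reciprocal of the largest dimension in the box.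
  A rational number with denominator \<open>R!\<close> in place of \<open>\<theta>\<close> is excluded by a good vector whose dimension is \<open>1\<close> modulo \<open>R!\<close>.
\<close>
lemma far_from_integers:
  assumes r: "r \<ge> 2"
  obtains \<kappa> \<eta> :: real and M0 :: nat where "\<kappa> > 0" "\<eta> > 0"
    "\<And>M \<theta>. M \<ge> M0 \<Longrightarrow> \<bar>\<theta>\<bar> \<le> 1 / 2 \<Longrightarrow> real (card (bad_indices r M \<eta> \<theta>)) < \<kappa> * real M ^ r
        \<Longrightarrow> \<bar>\<theta>\<bar> * (2 * real M) ^ num_roots r \<le> 1 / 2"
proof -
  define R where "R = num_roots r"
  have R2: "R \<ge> 2" using r num_roots_ge[of r] by (simp add: R_def)
  define F :: nat where "F = fact R"
  have F1: "F \<ge> 1" by (simp add: F_def)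
  have F2: "F \<ge> 2" using R2 fact_mono[of 2 R, where 'a=nat] by (simp add: F_def)
  define L where "L = superfact r * F"
  have L2: "L \<ge> 2" using mult_le_mono[of 1 "superfact r" 2 F] F2 superfact_pos[of r] by (simp add: L_def)
  \<comment> \<open>an \<open>R\<close>-th difference multiplies the error by \<open>2 ^ R\<close>, and the largest dimension in the box is at most \<open>(8 * R) ^ R\<close> times the \<open>R\<close>-th power of the largest step\<close>
  define \<eta> :: real where "\<eta> = 1 / (4 * real F * (16 * real R) ^ R)"
  \<comment> \<open>the first bound leaves good progressions of \<open>R + 1\<close> vectors, the second good vectors congruent to \<open>1\<close> modulo \<open>L\<close>\<close>
  define \<kappa> :: real where "\<kappa> = min (1 / ((real R + 1) * 2 ^ r)) ((1 / (2 * real L)) ^ r)"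
  have pos: "\<eta> > 0" "\<kappa> > 0" using F1 R2 L2 by (auto simp: \<eta>_def \<kappa>_def)
  show ?thesis
  proof (rule that[OF pos(2,1), of "max (4 * L) (2 * R)"])
    fix M :: nat and \<theta> :: real
    assume M: "max (4 * L) (2 * R) \<le> M" and \<theta>: "\<bar>\<theta>\<bar> \<le> 1 / 2"
      and few: "real (card (bad_indices r M \<eta> \<theta>)) < \<kappa> * real M ^ r"
    have M4: "M \<ge> 4 * L" "M \<ge> 2 * R" using M by auto
    have M0: "real M > 0" using M4 L2 by linarith
    define H where "H = M div (2 * R)"
    have H1: "1 \<le> H" using M4(2) R2 by (simp add: H_def Suc_le_eq div_greater_zero_iff)
    have HR: "R * h \<le> M div 2" if "h \<le> H" for h
    proof -
      have "R * h * 2 \<le> (2 * R) * H" using that by (simp add: mult.commute)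
      also have "\<dots> \<le> M" unfolding H_def by simp
      finally show ?thesis by linarith
    qed
    have few1: "(real R + 1) * real (card (bad_indices r M \<eta> \<theta>)) < (real M / 2) ^ r"
    proof -
      have "(real R + 1) * real (card (bad_indices r M \<eta> \<theta>)) < (real R + 1) * (\<kappa> * real M ^ r)"
        using few by (intro mult_strict_left_mono) auto
      also have "\<dots> \<le> (real R + 1) * (1 / ((real R + 1) * 2 ^ r) * real M ^ r)"
        by (intro mult_left_mono mult_right_mono) (auto simp: \<kappa>_def)
      also have "\<dots> = (real M / 2) ^ r" by (simp add: power_divide)
      finally show ?thesis .
    qed
    have few2: "real (card (bad_indices r M \<eta> \<theta>)) < (real M / (2 * real L)) ^ r"
    proof -
      have "\<kappa> * real M ^ r \<le> (1 / (2 * real L)) ^ r * real M ^ r"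
        by (intro mult_right_mono) (auto simp: \<kappa>_def)
      also have "\<dots> = (real M / (2 * real L)) ^ r" by (simp add: power_mult_distrib[symmetric])
      finally show ?thesis using few by linarith
    qed
    have near1: "near (2 ^ R * \<eta>) (real h ^ R * (real F * \<theta>))" if h: "1 \<le> h" "h \<le> H" for h
    proof -
      obtain k where k: "\<And>i. i \<le> R \<Longrightarrow> near \<eta> (irrep_dim r (\<lambda>j. k j + i * h) * \<theta>)"
        using good_progression[of r h M \<eta> \<theta>] HR[OF h(2)] few1 unfolding R_def by blast
      have "near ((\<Sum>i\<le>R. \<bar>real_of_int ((-1) ^ (R - i) * int (R choose i))\<bar>) * \<eta>)
              (\<Sum>i\<le>R. real_of_int ((-1) ^ (R - i) * int (R choose i)) * (irrep_dim r (\<lambda>j. k j + i * h) * \<theta>))"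
        by (intro near_sum k) auto
      moreover have "(\<Sum>i\<le>R. \<bar>real_of_int ((-1) ^ (R - i) * int (R choose i))\<bar>) = 2 ^ R"
      proof -
        have "(\<Sum>i\<le>R. \<bar>real_of_int ((-1) ^ (R - i) * int (R choose i))\<bar>) = real (\<Sum>i\<le>R. R choose i)"
          by (simp add: abs_mult)
        thus ?thesis by (simp add: choose_row_sum)
      qed
      moreover have "(\<Sum>i\<le>R. real_of_int ((-1) ^ (R - i) * int (R choose i)) * (irrep_dim r (\<lambda>j. k j + i * h) * \<theta>))
         = fdiff R (real h) (poly (line_poly r k)) 0 * \<theta>"
        unfolding fdiff_def sum_distrib_right
        by (intro sum.cong refl) (simp add: poly_line_poly[symmetric])
      moreover have "fdiff R (real h) (poly (line_poly r k)) 0 = real F * real h ^ R"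
        unfolding F_def of_nat_fact
        by (subst fdiff_poly) (auto simp: R_def line_poly_degree line_poly_coeff)
      ultimately show ?thesis by (simp add: mult_ac)
    qed
    have *: "2 ^ R * (2 ^ R * \<eta>) < 1 / 2"
    proof -
      have "2 ^ R * (2 ^ R * \<eta>) = (2 * 2) ^ R * \<eta>"
        unfolding power_mult_distrib by (simp only: mult.assoc)
      also have "\<dots> = (4 / (16 * real R)) ^ R / (4 * real F)"
        unfolding \<eta>_def power_divide by simp
      also have "\<dots> \<le> 1 / (4 * 1)"
        using F1 R2 by (intro frac_le power_le_one) auto
      finally show ?thesis by simp
    qed
    obtain b :: int where b: "\<bar>real F * \<theta> - of_int b\<bar> * real H ^ R \<le> 2 ^ R * \<eta>"
      using near_powers[OF near1 H1 *] by blast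
    define \<beta> where "\<beta> = real F * \<theta> - of_int b"
    have \<beta>: "\<bar>\<beta>\<bar> * (2 * real M) ^ R \<le> 1 / (4 * real F)"
    proof -
      have "M < 2 * R * (H + 1)"
        using dividend_less_times_div[of "2 * R" M] R2 by (simp add: H_def)
      also have "\<dots> \<le> 4 * R * H" using H1 by simp
      finally have "real M < real (4 * R * H)" by (simp only: of_nat_less_iff)
      hence "2 * real M \<le> 8 * real R * real H" by (simp add: mult_ac)
      hence "(2 * real M) ^ R \<le> (8 * real R * real H) ^ R" by (rule power_mono) simp
      hence "\<bar>\<beta>\<bar> * (2 * real M) ^ R \<le> \<bar>\<beta>\<bar> * (8 * real R * real H) ^ R"
        by (intro mult_left_mono) auto
      also have "\<dots> = (8 * real R) ^ R * (\<bar>\<beta>\<bar> * real H ^ R)" by (simp add: power_mult_distrib)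
      also have "\<dots> \<le> (8 * real R) ^ R * (2 ^ R * \<eta>)"
        using b by (intro mult_left_mono) (auto simp: \<beta>_def)
      also have "\<dots> = (8 * real R * 2) ^ R * \<eta>"
        unfolding power_mult_distrib by (simp only: mult.assoc)
      also have "\<dots> = (16 * real R) ^ R * \<eta>" by (simp add: mult.commute)
      also have "\<dots> = 1 / (4 * real F)" using R2 by (simp add: \<eta>_def)
      finally show ?thesis .
    qed
    have M1: "1 \<le> (2 * real M) ^ R" using M0 by (intro one_le_power) simp
    hence \<beta>': "\<bar>\<beta>\<bar> \<le> 1 / (4 * real F)"
      using \<beta> mult_left_mono[OF M1, of "\<bar>\<beta>\<bar>"] by simp
    \<comment> \<open>a good index vector of dimension \<open>1\<close> modulo \<open>R!\<close> shows that \<open>\<theta>\<close> itself is near an integer\<close>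
    obtain k where k: "k \<in> index_box r M" "near \<eta> (irrep_dim r k * \<theta>)" "\<And>i. i \<in> {1..r} \<Longrightarrow> k i mod L = 1"
      using good_congruent[OF L2 M4(1) few2] by blast
    obtain z where z: "irrep_dim r k = 1 + real F * of_int z"
      using nat_dim_congruent[of r k F] k(3) by (auto simp: L_def)
    obtain y :: int where y: "\<bar>irrep_dim r k * \<theta> - of_int y\<bar> \<le> \<eta>"
      using k(2) by (auto simp: near_def)
    have dim: "irrep_dim r k \<le> (2 * real M) ^ R"
      using irrep_dim_le[of r k "2 * M"] k(1) by (fastforce simp: R_def index_box_def PiE_def Pi_def)
    have dim0: "irrep_dim r k \<ge> 0" by (simp add: irrep_dim_nat)
    have "real F * \<bar>real_of_int z\<bar> \<le> (2 * real M) ^ R"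
    proof -
      have "real F * \<bar>real_of_int z\<bar> = \<bar>irrep_dim r k - 1\<bar>" by (simp add: z abs_mult)
      thus ?thesis using dim dim0 M1 by linarith
    qed
    moreover have "1 * \<bar>real_of_int z\<bar> \<le> real F * \<bar>real_of_int z\<bar>"
      using F1 by (intro mult_right_mono) auto
    ultimately have "\<bar>real_of_int z\<bar> \<le> (2 * real M) ^ R" by linarith
    hence z\<beta>: "\<bar>of_int z * \<beta>\<bar> \<le> 1 / (4 * real F)"
      using \<beta> mult_right_mono[of "\<bar>real_of_int z\<bar>" "(2 * real M) ^ R" "\<bar>\<beta>\<bar>"]
      by (simp add: abs_mult mult.commute)
    have "\<eta> \<le> 1 / (4 * real F)"
    proof -
      have "1 \<le> (16 * real R) ^ R" using R2 by (intro one_le_power) simp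
      thus ?thesis using F1 unfolding \<eta>_def by (intro frac_le) auto
    qed
    define w where "w = y - z * b"
    have "irrep_dim r k * \<theta> = \<theta> + of_int z * (\<beta> + of_int b)"
      unfolding z \<beta>_def by (simp add: algebra_simps)
    hence "\<theta> - of_int w = (irrep_dim r k * \<theta> - of_int y) - of_int z * \<beta>"
      by (simp add: w_def algebra_simps)
    hence w: "\<bar>\<theta> - of_int w\<bar> \<le> 1 / (2 * real F)"
      using y z\<beta> \<open>\<eta> \<le> 1 / (4 * real F)\<close> by (simp add: field_simps)
    have "1 / (2 * real F) \<le> 1 / 4" "1 / (4 * real F) \<le> 1 / 8" using F2 by (auto simp: field_simps)
    hence "\<bar>real_of_int w\<bar> < 1" using w \<theta> by linarith
    hence w0: "w = 0" by linarith
    have "real F * \<bar>\<theta>\<bar> \<le> 1 / 2" using w F1 by (simp add: w0 field_simps)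
    hence "\<bar>real F * \<theta>\<bar> \<le> 1 / 2" by (simp add: abs_mult)
    hence "\<bar>real_of_int b\<bar> < 1" using \<beta>' \<open>1 / (4 * real F) \<le> 1 / 8\<close> unfolding \<beta>_def by linarith
    hence "b = 0" by linarith
    hence "\<bar>\<beta>\<bar> = real F * \<bar>\<theta>\<bar>" by (simp add: \<beta>_def abs_mult)
    hence "\<bar>\<theta>\<bar> \<le> \<bar>\<beta>\<bar>" using mult_right_mono[of 1 "real F" "\<bar>\<theta>\<bar>"] F1 by simp
    hence "\<bar>\<theta>\<bar> * (2 * real M) ^ R \<le> \<bar>\<beta>\<bar> * (2 * real M) ^ R" by (intro mult_right_mono) auto
    thus "\<bar>\<theta>\<bar> * (2 * real M) ^ num_roots r \<le> 1 / 2"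
      using \<beta> \<open>1 / (4 * real F) \<le> 1 / 8\<close> unfolding R_def[symmetric] by linarith
  qed
qed

section \<open>Sums over the weight lattice\<close>

text \<open>
  Every index \<open>i\<close> is the left end of \<open>r + 1 - i\<close> and the right end of \<open>i\<close> intervals in \<open>{1..r}\<close>.
\<close>
lemma sum_roots_endpoints:
  fixes z :: "nat \<Rightarrow> real"
  shows "(\<Sum>(j, l)\<in>roots r. z l + z j) = (real r + 1) * (\<Sum>i=1..r. z i)"
proof -
  have "(\<Sum>(j, l)\<in>roots r. z l + z j) = (\<Sum>j=1..r. \<Sum>l=1..j. z l + z j)"
    by (simp add: roots_def sum.Sigma)
  also have "\<dots> = (real r + 1) * (\<Sum>i=1..r. z i)"
    by (induction r) (simp_all add: sum.distrib algebra_simps)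
  finally show ?thesis .
qed

lemma sum_roots_symmetric:
  fixes f :: "nat \<Rightarrow> nat \<Rightarrow> real"
  assumes "\<And>i j. f i j = f j i" "\<And>i. f i i = 0"
  shows "(\<Sum>i=1..r. \<Sum>j=1..r. f i j) = 2 * (\<Sum>(j, l)\<in>roots r. f l j)"
proof -
  have "(\<Sum>i=1..r. \<Sum>j=1..r. f i j) = 2 * (\<Sum>j=1..r. \<Sum>l=1..j. f l j)"
  proof (induction r)
    case (Suc r)
    have "(\<Sum>l=1..r. f (Suc r) l) = (\<Sum>l=1..r. f l (Suc r))"
      by (intro sum.cong refl assms(1))
    thus ?case using Suc by (simp add: sum.distrib assms(2))
  qed auto
  thus ?thesis by (simp add: roots_def sum.Sigma)
qed

text \<open>
  Here \<open>z\<^sub>i = ln y\<^sub>i\<close>, and \<open>A\<close> is the logarithm of a lower bound for the dimension polynomial, up to a constant.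
  Replacing each maximum by the mean of its arguments turns \<open>A\<close> into \<open>(r + 1) / 2\<close> times the sum of
  the \<open>z\<^sub>i\<close>. The error \<open>\<delta>\<close> is half the sum of the \<open>|z\<^sub>l - z\<^sub>j|\<close>, and \<open>|A| + \<delta>\<close> controls every \<open>|z\<^sub>i|\<close>. This leaves
  room for the term with the absolute values on the right-hand side, which makes the sums over the single coordinates converge.
\<close>
lemma sum_max_roots_bound:
  fixes z :: "nat \<Rightarrow> real"
  assumes r: "r \<ge> 2"
  defines "A \<equiv> (\<Sum>(j, l)\<in>roots r. max (z l) (z j))"
  shows "- (2 / (real r + 1)) * A - 1 / (real r + 1) * \<bar>A\<bar>
           \<le> (\<Sum>i=1..r. - z i - 1 / (3 * (real r + 1)) * \<bar>z i\<bar>)"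
proof -
  define \<delta> where "\<delta> = (\<Sum>(j, l)\<in>roots r. \<bar>z l - z j\<bar>) / 2"
  define Z where "Z = (\<Sum>i=1..r. z i)"
  have \<delta>0: "\<delta> \<ge> 0" unfolding \<delta>_def by (intro divide_nonneg_pos sum_nonneg) auto
  have "A = (\<Sum>(j, l)\<in>roots r. (z l + z j) / 2 + \<bar>z l - z j\<bar> / 2)"
    unfolding A_def by (intro sum.cong refl) (auto simp: max_def field_simps)
  also have "\<dots> = (real r + 1) / 2 * Z + \<delta>"
    using sum_roots_endpoints[of z r]
    by (simp add: case_prod_unfold sum.distrib \<delta>_def Z_def flip: sum_divide_distrib)
  finally have A: "A = (real r + 1) / 2 * Z + \<delta>" .
  have Z: "2 / (real r + 1) * (A - \<delta>) = Z"
    using r by (simp add: A field_simps)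
  have 1: "real r * \<bar>z i\<bar> \<le> \<bar>Z\<bar> + (\<Sum>j=1..r. \<bar>z i - z j\<bar>)" for i
  proof -
    have "real r * z i = Z + (\<Sum>j=1..r. z i - z j)"
      by (simp add: Z_def sum_subtractf)
    hence "\<bar>real r * z i\<bar> \<le> \<bar>Z\<bar> + \<bar>\<Sum>j=1..r. z i - z j\<bar>" by linarith
    moreover have "\<bar>\<Sum>j=1..r. z i - z j\<bar> \<le> (\<Sum>j=1..r. \<bar>z i - z j\<bar>)" by (rule sum_abs)
    ultimately have "\<bar>real r * z i\<bar> \<le> \<bar>Z\<bar> + (\<Sum>j=1..r. \<bar>z i - z j\<bar>)" by linarith
    thus ?thesis by (simp add: abs_mult)
  qed
  have "real r * (\<Sum>i=1..r. \<bar>z i\<bar>) \<le> (\<Sum>i=1..r. \<bar>Z\<bar> + (\<Sum>j=1..r. \<bar>z i - z j\<bar>))"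
    unfolding sum_distrib_left by (intro sum_mono 1)
  also have "\<dots> = real r * \<bar>Z\<bar> + (\<Sum>i=1..r. \<Sum>j=1..r. \<bar>z i - z j\<bar>)"
    by (simp add: sum.distrib)
  also have "(\<Sum>i=1..r. \<Sum>j=1..r. \<bar>z i - z j\<bar>) = 4 * \<delta>"
    unfolding \<delta>_def by (subst sum_roots_symmetric) (auto simp: abs_minus_commute)
  also have "4 * \<delta> \<le> real r * (2 * \<delta>)"
    using r \<delta>0 mult_right_mono[of 2 "real r" "2 * \<delta>"] by simp
  finally have "real r * (\<Sum>i=1..r. \<bar>z i\<bar>) \<le> real r * (\<bar>Z\<bar> + 2 * \<delta>)"
    by (simp add: algebra_simps)
  hence 2: "(\<Sum>i=1..r. \<bar>z i\<bar>) \<le> \<bar>Z\<bar> + 2 * \<delta>" using r by simp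
  have "\<bar>Z\<bar> = \<bar>2 / (real r + 1)\<bar> * \<bar>A - \<delta>\<bar>" unfolding Z[symmetric] by (rule abs_mult)
  also have "\<dots> = 2 / (real r + 1) * \<bar>A - \<delta>\<bar>" by simp
  also have "\<dots> \<le> 1 * \<bar>A - \<delta>\<bar>" using r by (intro mult_right_mono) auto
  finally have "\<bar>Z\<bar> \<le> \<bar>A - \<delta>\<bar>" by simp
  hence "\<bar>Z\<bar> \<le> \<bar>A\<bar> + \<delta>" using \<delta>0 by linarith
  with 2 have 3: "(\<Sum>i=1..r. \<bar>z i\<bar>) \<le> 3 * (\<bar>A\<bar> + \<delta>)" using \<delta>0 abs_ge_zero[of A] by argo
  have "1 / (3 * (real r + 1)) * (\<Sum>i=1..r. \<bar>z i\<bar>) \<le> 1 / (3 * (real r + 1)) * (3 * (\<bar>A\<bar> + \<delta>))"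
    by (intro mult_left_mono 3) auto
  also have "\<dots> = 1 / (real r + 1) * (\<bar>A\<bar> + \<delta>)"
  proof -
    have "1 / (3 * n) * (3 * X) = 1 / n * X" for n X :: real by simp
    thus ?thesis .
  qed
  finally have 4: "1 / (3 * (real r + 1)) * (\<Sum>i=1..r. \<bar>z i\<bar>) \<le> 1 / (real r + 1) * (\<bar>A\<bar> + \<delta>)" .
  have "2 / (real r + 1) * A = Z + 2 * (1 / (real r + 1) * \<delta>)"
    unfolding Z[symmetric] by (simp add: right_diff_distrib diff_divide_distrib)
  moreover have "(\<Sum>i=1..r. - z i - 1 / (3 * (real r + 1)) * \<bar>z i\<bar>) = - Z - 1 / (3 * (real r + 1)) * (\<Sum>i=1..r. \<bar>z i\<bar>)"
    by (simp add: sum_subtractf sum_negf Z_def flip: sum_distrib_left sum_divide_distrib)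
  moreover have "1 / (real r + 1) * (\<bar>A\<bar> + \<delta>) = 1 / (real r + 1) * \<bar>A\<bar> + 1 / (real r + 1) * \<delta>"
    by (simp add: distrib_left add_divide_distrib)
  moreover have "1 / (real r + 1) * \<delta> \<ge> 0" using \<delta>0 by simp
  ultimately show ?thesis using 4 by linarith
qed

text \<open>
  The one-dimensional weight below is the smaller of \<open>y powr (e - 1)\<close> and \<open>y powr (- e - 1)\<close>, where
  \<open>e\<close> is this exponent.
\<close>
definition tail_exp :: "nat \<Rightarrow> real" where
  "tail_exp r = 1 / (3 * (real r + 1))"

definition line_weight :: "nat \<Rightarrow> real \<Rightarrow> real" where
  "line_weight r y = exp (- ln y - tail_exp r * \<bar>ln y\<bar>)"

text \<open>
  An increasing function with values in \<open>[0, 1]\<close> whose derivative is comparable to the weight; its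
  increments bound sums of the weight over arithmetic progressions.
\<close>
definition tail_cdf :: "nat \<Rightarrow> real \<Rightarrow> real" where
  "tail_cdf r y = 1 - 1 / (1 + y powr tail_exp r)"

lemma tail_exp: "tail_exp r > 0" "tail_exp r \<le> 1"
  by (auto simp: tail_exp_def)

lemma tail_cdf_bounds: "y \<ge> 0 \<Longrightarrow> 0 \<le> tail_cdf r y" "tail_cdf r y \<le> 1" "tail_cdf r y \<le> y powr tail_exp r"
proof -
  show "tail_cdf r y \<le> y powr tail_exp r"
  proof -
    let ?p = "y powr tail_exp r"
    have "(1 - ?p) * (1 + ?p) \<le> 1" by (simp add: algebra_simps)
    hence "1 - ?p \<le> 1 / (1 + ?p)" using powr_ge_zero[of y "tail_exp r"]
      by (subst pos_le_divide_eq) (simp_all add: add_pos_nonneg)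
    thus ?thesis by (simp add: tail_cdf_def)
  qed
qed (auto simp: tail_cdf_def field_simps add_nonneg_eq_0_iff add_pos_nonneg intro: add_pos_nonneg)

lemma tail_cdf_mono: "0 \<le> x \<Longrightarrow> x \<le> y \<Longrightarrow> tail_cdf r x \<le> tail_cdf r y"
  using tail_exp[of r] powr_mono2[of "tail_exp r" x y]
  by (auto simp: tail_cdf_def intro!: divide_left_mono mult_pos_pos add_pos_nonneg)

lemma powr_concave_bound:
  fixes e t :: real
  assumes "0 < e" "e \<le> 1" "0 \<le> t"
  shows "t powr e \<le> 1 - e * (1 - t)"
proof (cases "t = 0")
  case False
  have "exp ((1 - e) *\<^sub>R 0 + e *\<^sub>R ln t) \<le> (1 - e) * exp 0 + e * exp (ln t)"
    using convex_onD[OF exp_convex, of e 0 "ln t"] assms by simp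
  thus ?thesis using False assms by (simp add: powr_def algebra_simps)
qed (use assms in auto)

text \<open>
  The power \<open>e \<le> 1\<close> is concave, which bounds the increment of \<open>y powr e\<close> from below by its derivative at
  the right end point.
\<close>
lemma line_weight_le_cdf_diff:
  assumes "0 \<le> x" "x < y"
  shows "(y - x) * line_weight r y \<le> 4 / tail_exp r * (tail_cdf r y - tail_cdf r x)"
proof -
  define e where "e = tail_exp r"
  have e: "0 < e" "e \<le> 1" using tail_exp by (auto simp: e_def)
  have y: "y > 0" using assms by simp
  define u w where "u = x powr e" and "w = y powr e"
  have w: "w > 0" using y by (simp add: w_def)
  have u: "0 \<le> u" "u \<le> w" using assms e by (auto simp: u_def w_def intro!: powr_mono2)
  have "u / w = (x / y) powr e" using assms y by (simp add: u_def w_def powr_divide)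
  also have "\<dots> \<le> 1 - e * (1 - x / y)" using e assms by (intro powr_concave_bound) auto
  finally have "u \<le> w - e * w * (y - x) / y" using w y by (simp add: field_simps)
  hence uw: "e * w * (y - x) / y \<le> w - u" by linarith
  have lw: "line_weight r y * (1 + w)\<^sup>2 \<le> 4 * w / y"
  proof (cases "y \<ge> 1")
    case True
    have w1: "w \<ge> 1" using True e by (simp add: w_def ge_one_powr_ge_zero)
    have "line_weight r y = 1 / (y * w)"
      using True y by (simp add: line_weight_def e_def w_def powr_def exp_minus exp_diff exp_add field_simps)
    hence "line_weight r y * (1 + w)\<^sup>2 = (1 + w)\<^sup>2 / (y * w)" by simp
    also have "\<dots> \<le> (2 * w)\<^sup>2 / (y * w)"
      using w1 y by (intro divide_right_mono power_mono) auto
    also have "\<dots> = 4 * w / y" using w1 by (simp add: power2_eq_square)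
    finally show ?thesis .
  next
    case False
    have w1: "w \<le> 1" using False y e by (simp add: w_def powr_le1)
    have "line_weight r y = w / y"
      using False y by (simp add: line_weight_def e_def w_def powr_def exp_minus exp_diff exp_add field_simps)
    hence "line_weight r y * (1 + w)\<^sup>2 = (1 + w)\<^sup>2 * (w / y)" by simp
    also have "\<dots> \<le> 2\<^sup>2 * (w / y)"
      using w1 y w by (intro mult_right_mono power_mono) auto
    finally show ?thesis by simp
  qed
  have pos: "(1 + w)\<^sup>2 > 0" using w by simp
  have "(y - x) * line_weight r y \<le> (y - x) * (4 * w / y / (1 + w)\<^sup>2)"
    using lw pos assms by (intro mult_left_mono, subst pos_le_divide_eq) auto
  also have "\<dots> = 4 / e * ((e * w * (y - x) / y) / (1 + w)\<^sup>2)"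
    using e by simp
  also have "\<dots> \<le> 4 / e * ((w - u) / (1 + w)\<^sup>2)"
    using e pos uw by (intro mult_left_mono divide_right_mono) auto
  also have "\<dots> \<le> 4 / e * ((w - u) / ((1 + w) * (1 + u)))"
    using e u w unfolding power2_eq_square
    by (intro mult_left_mono divide_left_mono) (auto intro!: mult_pos_pos)
  also have "(w - u) / ((1 + w) * (1 + u)) = tail_cdf r y - tail_cdf r x"
    using u w by (simp add: tail_cdf_def u_def[symmetric] w_def[symmetric] e_def[symmetric] field_simps)
  finally show ?thesis by (simp add: e_def)
qed

lemma sum_line_weight:
  assumes "s > 0" "m \<le> n"
  shows "(\<Sum>k\<in>{m<..n}. s * line_weight r (s * real k)) \<le> 4 / tail_exp r * (tail_cdf r (s * real n) - tail_cdf r (s * real m))"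
  using assms(2)
proof (induction n rule: dec_induct)
  case (step n)
  have "{m<..Suc n} = insert (Suc n) {m<..n}" using step by auto
  hence "(\<Sum>k\<in>{m<..Suc n}. s * line_weight r (s * real k))
      = s * line_weight r (s * real (Suc n)) + (\<Sum>k\<in>{m<..n}. s * line_weight r (s * real k))"
    by simp
  moreover have "s * line_weight r (s * real (Suc n))
      \<le> 4 / tail_exp r * (tail_cdf r (s * real (Suc n)) - tail_cdf r (s * real n))"
    using line_weight_le_cdf_diff[of "s * real n" "s * real (Suc n)" r] assms(1)
    by (simp add: algebra_simps)
  ultimately show ?case using step.IH by (simp add: algebra_simps)
qed auto

lemma line_weight_pos: "line_weight r y > 0"
  by (simp add: line_weight_def)

lemma sum_line_weight_general:
  assumes "s > 0" "finite B" "0 \<le> \<alpha>" "\<alpha> \<le> \<beta>" "\<And>k. k \<in> B \<Longrightarrow> \<alpha> + s \<le> s * real k \<and> s * real k \<le> \<beta>"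
  shows "(\<Sum>k\<in>B. s * line_weight r (s * real k)) \<le> 4 / tail_exp r * (tail_cdf r \<beta> - tail_cdf r \<alpha>)"
proof (cases "B = {}")
  case True
  thus ?thesis using assms tail_exp[of r] tail_cdf_mono[of \<alpha> \<beta> r] by simp
next
  case False
  define m where "m = Min B - 1"
  have Min: "Min B \<in> B" "Max B \<in> B" using False assms by auto
  have "s * 1 \<le> s * real (Min B)" using assms(5)[OF Min(1)] assms(3) by linarith
  hence "1 \<le> Min B" using assms(1) by simp
  hence m: "real m = real (Min B) - 1" by (simp add: m_def of_nat_diff)
  have "B \<subseteq> {m<..Max B}"
  proof
    fix k assume "k \<in> B"
    hence "Min B \<le> k" "k \<le> Max B" using assms(2) by auto
    thus "k \<in> {m<..Max B}" using \<open>1 \<le> Min B\<close> by (simp add: m_def)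
  qed
  hence "(\<Sum>k\<in>B. s * line_weight r (s * real k)) \<le> (\<Sum>k\<in>{m<..Max B}. s * line_weight r (s * real k))"
    using assms(1) line_weight_pos[of r] by (intro sum_mono2) (auto intro: less_imp_le)
  also have "\<dots> \<le> 4 / tail_exp r * (tail_cdf r (s * real (Max B)) - tail_cdf r (s * real m))"
  proof (rule sum_line_weight[OF assms(1)])
    have "Min B \<le> Max B" using Min assms(2) by simp
    thus "m \<le> Max B" by (simp add: m_def)
  qed
  also have "\<dots> \<le> 4 / tail_exp r * (tail_cdf r \<beta> - tail_cdf r \<alpha>)"
    using assms(1,3) assms(5)[OF Min(1)] assms(5)[OF Min(2)] tail_exp[of r]
    by (intro mult_left_mono diff_mono tail_cdf_mono) (auto simp: m algebra_simps)
  finally show ?thesis .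
qed

definition box_weight :: "nat \<Rightarrow> real \<Rightarrow> (nat \<Rightarrow> nat) \<Rightarrow> real" where
  "box_weight r s k = (\<Prod>i=1..r. s * line_weight r (s * real (k i)))"

text \<open>
  The sum over \<open>F\<close> is at most the sum over the product of its projections, which factors. Only the
  factor of the distinguished coordinate \<open>j\<close> uses the restriction on \<open>F\<close>.
\<close>
lemma sum_box_weight:
  assumes s: "s > 0" and F: "finite F" "F \<subseteq> irreps r" and j: "j \<in> {1..r}"
    and \<alpha>: "0 \<le> \<alpha>" "\<alpha> \<le> \<beta>" "\<And>k. k \<in> F \<Longrightarrow> \<alpha> + s \<le> s * real (k j) \<and> s * real (k j) \<le> \<beta>"
  shows "(\<Sum>k\<in>F. box_weight r s k) \<le> (4 / tail_exp r) ^ r * (tail_cdf r \<beta> - tail_cdf r \<alpha>)"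
proof -
  define B where "B i = (\<lambda>k. k i) ` F" for i
  let ?w = "\<lambda>m. s * line_weight r (s * real m)"
  have B: "finite (B i)" for i using F by (simp add: B_def)
  have w: "?w m \<ge> 0" for m using s line_weight_pos[of r] by (simp add: less_imp_le)
  have "F \<subseteq> (\<Pi>\<^sub>E i\<in>{1..r}. B i)"
    using F(2) by (auto simp: B_def irreps_def PiE_def)
  hence "(\<Sum>k\<in>F. box_weight r s k) \<le> (\<Sum>k\<in>(\<Pi>\<^sub>E i\<in>{1..r}. B i). box_weight r s k)"
    using B w by (intro sum_mono2) (auto simp: box_weight_def intro!: finite_PiE prod_nonneg)
  also have "\<dots> = (\<Prod>i=1..r. \<Sum>m\<in>B i. ?w m)"
    unfolding box_weight_def using B by (simp add: prod_sum_PiE)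
  also have "\<dots> = (\<Sum>m\<in>B j. ?w m) * (\<Prod>i\<in>{1..r} - {j}. \<Sum>m\<in>B i. ?w m)"
    using j by (subst prod.remove[of _ j]) auto
  also have "\<dots> \<le> (4 / tail_exp r * (tail_cdf r \<beta> - tail_cdf r \<alpha>)) * (\<Prod>i\<in>{1..r} - {j}. 4 / tail_exp r)"
  proof (intro mult_mono prod_mono conjI)
    show "(\<Sum>m\<in>B j. ?w m) \<le> 4 / tail_exp r * (tail_cdf r \<beta> - tail_cdf r \<alpha>)"
      using \<alpha> B s by (intro sum_line_weight_general) (auto simp: B_def)
    show "(\<Sum>m\<in>B i. ?w m) \<le> 4 / tail_exp r" if "i \<in> {1..r} - {j}" for i
    proof (cases "F = {}")
      case False
      define \<gamma> where "\<gamma> = s * real (Max (B i))"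
      have ne: "B i \<noteq> {}" using False by (simp add: B_def)
      have "(\<Sum>m\<in>B i. ?w m) \<le> 4 / tail_exp r * (tail_cdf r \<gamma> - tail_cdf r 0)"
      proof (intro sum_line_weight_general s B)
        show "0 \<le> \<gamma>" using s by (simp add: \<gamma>_def)
        fix m assume m: "m \<in> B i"
        hence "m \<ge> 1" using F(2) that by (auto simp: B_def irreps_def PiE_def Pi_def)
        moreover have "m \<le> Max (B i)" using m B by simp
        ultimately show "0 + s \<le> s * real m \<and> s * real m \<le> \<gamma>"
          using s by (simp add: \<gamma>_def)
      qed auto
      also have "\<dots> \<le> 4 / tail_exp r * 1"
        using tail_cdf_bounds(2)[of r \<gamma>] tail_cdf_bounds(1)[of 0 r] tail_exp[of r] by (intro mult_left_mono) auto
      finally show ?thesis by simp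
    qed (use tail_exp[of r] in \<open>simp add: B_def\<close>)
    show "0 \<le> (\<Sum>m\<in>B i. ?w m)" for i by (intro sum_nonneg w)
    show "0 \<le> 4 / tail_exp r * (tail_cdf r \<beta> - tail_cdf r \<alpha>)"
      using tail_exp[of r] tail_cdf_mono[of \<alpha> \<beta> r] \<alpha>(1,2) by (intro mult_nonneg_nonneg) auto
    show "0 \<le> (\<Prod>i\<in>{1..r} - {j}. \<Sum>m\<in>B i. ?w m)"
      by (intro prod_nonneg ballI sum_nonneg w)
  qed
  also have "(\<Prod>i\<in>{1..r} - {j}. 4 / tail_exp r) = (4 / tail_exp r) ^ (r - 1)" using j by simp
  also have "4 / tail_exp r * (tail_cdf r \<beta> - tail_cdf r \<alpha>) * (4 / tail_exp r) ^ (r - 1)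
     = (4 / tail_exp r) ^ Suc (r - 1) * (tail_cdf r \<beta> - tail_cdf r \<alpha>)"
    by simp
  also have "Suc (r - 1) = r" using j by simp
  finally show ?thesis .
qed

text \<open>
  The lower bound for the dimension polynomial, up to the factor \<open>superfact r\<close>, in which every sum over an interval is
  replaced by the larger of its two end points.
\<close>
definition crude_dim :: "nat \<Rightarrow> (nat \<Rightarrow> real) \<Rightarrow> real" where
  "crude_dim r y = (\<Prod>(j, l)\<in>roots r. max (y l) (y j))"

lemma crude_dim_le:
  assumes "\<And>i. i \<in> {1..r} \<Longrightarrow> y i \<ge> 0"
  shows "crude_dim r y \<le> real (superfact r) * dim_poly r y"
proof -
  have "crude_dim r y \<le> (\<Prod>(j, l)\<in>roots r. \<Sum>i=l..j. y i)"
    unfolding crude_dim_def case_prod_unfold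
  proof (intro prod_mono conjI)
    fix p assume p: "p \<in> roots r"
    have in_range: "fst p \<in> {1..r}" "snd p \<in> {1..r}" using p by (auto simp: roots_def)
    thus "0 \<le> max (y (snd p)) (y (fst p))" using assms by (auto simp: max_def)
    have "y i \<le> (\<Sum>i=snd p..fst p. y i)" if "i \<in> {snd p..fst p}" for i
      using that p by (intro member_le_sum assms) (auto simp: roots_def)
    thus "max (y (snd p)) (y (fst p)) \<le> (\<Sum>i=snd p..fst p. y i)"
      using p by (auto simp: roots_def)
  qed
  also have "\<dots> = real (superfact r) * dim_poly r y"
    using superfact_pos[of r] by (simp add: dim_poly_roots)
  finally show ?thesis .
qed

lemma dim_poly_scale: "dim_poly r (\<lambda>i. s * y i) = s ^ num_roots r * dim_poly r y"
proof -
  have "(\<Prod>p\<in>roots r. \<Sum>i=snd p..fst p. s * y i) = s ^ num_roots r * (\<Prod>p\<in>roots r. \<Sum>i=snd p..fst p. y i)"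
    by (simp add: prod.distrib card_roots flip: sum_distrib_left)
  thus ?thesis by (simp add: dim_poly_roots case_prod_unfold)
qed

definition cutoff :: "real \<Rightarrow> real" where
  "cutoff x = 1 / max 1 (x ^ 3)"

lemma cutoff_le_1: "cutoff x \<le> 1"
  by (simp add: cutoff_def)

text \<open>
  The exponential on the left is the smaller of the powers of the crude dimension with the exponents
  \<open>- 1 / (r + 1)\<close> and \<open>- 3 / (r + 1)\<close>. So it decays slower than \<open>min(1, 1 / x\<^sup>2)\<close>, and it even blows up at \<open>0\<close>.
\<close>
lemma crude_dim_box_weight:
  assumes r: "r \<ge> 2" and s: "s > 0" and k: "k \<in> irreps r"
  defines "A \<equiv> ln (crude_dim r (\<lambda>i. s * real (k i)))"
  shows "s ^ r * exp (- (2 / (real r + 1)) * A - 1 / (real r + 1) * \<bar>A\<bar>) \<le> box_weight r s k"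
    and "crude_dim r (\<lambda>i. s * real (k i)) > 0"
proof -
  define z where "z i = ln (s * real (k i))" for i
  have pos: "s * real (k i) > 0" if "i \<in> {1..r}" for i
  proof -
    have "k i \<ge> 1" using k that by (auto simp: irreps_def PiE_def Pi_def)
    thus ?thesis using s by simp
  qed
  have in_range: "fst p \<in> {1..r}" "snd p \<in> {1..r}" if "p \<in> roots r" for p
    using that by (auto simp: roots_def)
  have pos': "max (s * real (k (snd p))) (s * real (k (fst p))) > 0" if "p \<in> roots r" for p
    using pos[OF in_range(1)[OF that]] by simp
  show "crude_dim r (\<lambda>i. s * real (k i)) > 0"
    unfolding crude_dim_def case_prod_unfold by (intro prod_pos ballI pos')
  have "A = (\<Sum>p\<in>roots r. ln (max (s * real (k (snd p))) (s * real (k (fst p)))))"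
    unfolding A_def crude_dim_def case_prod_unfold by (intro ln_prod finite_roots) (use pos' in force)
  also have "\<dots> = (\<Sum>(j, l)\<in>roots r. max (z l) (z j))"
  proof -
    have "ln (max (s * real (k (snd p))) (s * real (k (fst p)))) = max (z (snd p)) (z (fst p))"
      if "p \<in> roots r" for p
      using pos[OF in_range(1)[OF that]] pos[OF in_range(2)[OF that]]
      by (simp add: z_def max_def)
    thus ?thesis by (simp add: case_prod_unfold)
  qed
  finally have "- (2 / (real r + 1)) * A - 1 / (real r + 1) * \<bar>A\<bar>
           \<le> (\<Sum>i=1..r. - z i - 1 / (3 * (real r + 1)) * \<bar>z i\<bar>)"
    using sum_max_roots_bound[OF r, of z] by simp
  hence "exp (- (2 / (real r + 1)) * A - 1 / (real r + 1) * \<bar>A\<bar>)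
     \<le> exp (\<Sum>i=1..r. - z i - 1 / (3 * (real r + 1)) * \<bar>z i\<bar>)"
    by (simp only: exp_le_cancel_iff)
  also have "\<dots> = (\<Prod>i=1..r. exp (- z i - 1 / (3 * (real r + 1)) * \<bar>z i\<bar>))"
    by (rule exp_sum) simp
  also have "\<dots> = (\<Prod>i=1..r. line_weight r (s * real (k i)))"
    by (simp add: line_weight_def z_def tail_exp_def)
  finally have "s ^ r * exp (- (2 / (real r + 1)) * A - 1 / (real r + 1) * \<bar>A\<bar>)
      \<le> s ^ r * (\<Prod>i=1..r. line_weight r (s * real (k i)))"
    using s by (intro mult_left_mono) auto
  thus "s ^ r * exp (- (2 / (real r + 1)) * A - 1 / (real r + 1) * \<bar>A\<bar>) \<le> box_weight r s k"
    by (simp add: box_weight_def prod.distrib)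
qed

context
  fixes r :: nat and s :: real and k :: "nat \<Rightarrow> nat"
  assumes r: "r \<ge> 2" and s: "s > 0" and k: "k \<in> irreps r"
begin

private definition "x = s ^ num_roots r * irrep_dim r k"
private definition "b = crude_dim r (\<lambda>i. s * real (k i))"
private definition "c = real (superfact r)"

lemma scaled_facts: "b > 0" "b \<le> c * x" "c \<ge> 1" "x > 0"
proof -
  show "b > 0" unfolding b_def by (rule crude_dim_box_weight(2)[OF r s k])
  show "b \<le> c * x"
    using crude_dim_le[of r "\<lambda>i. s * real (k i)"] s
    by (simp add: b_def c_def x_def dim_poly_scale irrep_dim_def)
  show "c \<ge> 1" using superfact_pos[of r] by (simp add: c_def)
  have "0 < c * x" using \<open>b > 0\<close> \<open>b \<le> c * x\<close> by linarith
  thus "x > 0" using \<open>c \<ge> 1\<close> by (simp add: zero_less_mult_iff)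
qed

lemma min_square_le_box_weight:
  "s ^ r * min 1 (1 / x\<^sup>2) \<le> c\<^sup>2 * box_weight r s k"
proof -
  note facts = scaled_facts
  let ?\<Phi> = "exp (- (2 / (real r + 1)) * ln b - 1 / (real r + 1) * \<bar>ln b\<bar>)"
  have 1: "min 1 (1 / x\<^sup>2) \<le> c\<^sup>2 * min 1 (1 / b\<^sup>2)"
  proof -
    have "1 \<le> c\<^sup>2" using facts(3) by simp
    have "b\<^sup>2 \<le> (c * x)\<^sup>2" using facts by (intro power_mono) auto
    hence "1 / x\<^sup>2 \<le> c\<^sup>2 * (1 / b\<^sup>2)" using facts by (simp add: field_simps power_mult_distrib)
    thus ?thesis using \<open>1 \<le> c\<^sup>2\<close> by (auto simp: min_def)
  qed
  have 2: "min 1 (1 / b\<^sup>2) \<le> ?\<Phi>"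
  proof (cases "b \<ge> 1")
    case True
    hence "ln b \<ge> 0" by simp
    have "3 / (real r + 1) \<le> 2" using r by (simp add: divide_le_eq)
    hence "3 / (real r + 1) * ln b \<le> 2 * ln b" using \<open>ln b \<ge> 0\<close> by (intro mult_right_mono)
    moreover have "3 / (real r + 1) * ln b = 2 / (real r + 1) * ln b + 1 / (real r + 1) * ln b"
      by (simp add: add_divide_distrib[symmetric])
    ultimately have "- (2 * ln b) \<le> - (2 / (real r + 1)) * ln b - 1 / (real r + 1) * \<bar>ln b\<bar>"
      using \<open>ln b \<ge> 0\<close> by simp
    hence "exp (- (2 * ln b)) \<le> ?\<Phi>" by (simp only: exp_le_cancel_iff)
    also have "exp (- (2 * ln b)) = 1 / b\<^sup>2"
      using True by (simp add: exp_minus exp_double field_simps)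
    finally show ?thesis by simp
  next
    case False
    hence "ln b \<le> 0" using facts(1) by simp
    hence "1 / (real r + 1) * ln b \<le> 0" by (simp add: divide_le_0_iff)
    moreover have "2 / (real r + 1) * ln b = 2 * (1 / (real r + 1) * ln b)" by simp
    ultimately have "0 \<le> - (2 / (real r + 1)) * ln b - 1 / (real r + 1) * \<bar>ln b\<bar>"
      using \<open>ln b \<le> 0\<close> by simp
    thus ?thesis by (simp add: min_le_iff_disj)
  qed
  have "min 1 (1 / x\<^sup>2) \<le> c\<^sup>2 * ?\<Phi>"
    using 1 mult_left_mono[OF 2, of "c\<^sup>2"] by (meson order_trans zero_le_power2)
  hence "s ^ r * min 1 (1 / x\<^sup>2) \<le> s ^ r * (c\<^sup>2 * ?\<Phi>)"
    using s by (intro mult_left_mono) auto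
  also have "\<dots> = c\<^sup>2 * (s ^ r * ?\<Phi>)" by simp
  also have "\<dots> \<le> c\<^sup>2 * box_weight r s k"
    using crude_dim_box_weight(1)[OF r s k] by (intro mult_left_mono) (auto simp: b_def)
  finally show ?thesis .
qed

lemma cutoff_le_box_weight: "s ^ r * cutoff x \<le> c\<^sup>2 * box_weight r s k"
proof -
  have "cutoff x \<le> min 1 (1 / x\<^sup>2)"
  proof (cases "x \<ge> 1")
    case True
    hence "1 \<le> x ^ 2" "x ^ 2 \<le> x ^ 3" by (auto intro: one_le_power power_increasing)
    hence "cutoff x = 1 / x ^ 3" "1 / x ^ 3 \<le> 1 / x ^ 2"
      unfolding cutoff_def using \<open>x \<ge> 1\<close> by (auto intro!: divide_left_mono)
    thus ?thesis using cutoff_le_1[of x] by simp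
  next
    case False
    hence "x ^ 2 \<le> 1" using scaled_facts(4) by (simp add: power_le_one)
    hence "1 \<le> 1 / x\<^sup>2" using scaled_facts(4) by simp
    thus ?thesis using cutoff_le_1[of x] by simp
  qed
  hence "s ^ r * cutoff x \<le> s ^ r * min 1 (1 / x\<^sup>2)" using s by (intro mult_left_mono) auto
  thus ?thesis using min_square_le_box_weight by linarith
qed

text \<open>
  The cutoff decays by one power faster than needed for summability, which gives the factor \<open>1 / T\<close>.
\<close>
lemma cutoff_le_box_weight_large:
  assumes T: "T \<ge> 1" "x \<ge> T"
  shows "s ^ r * cutoff x \<le> 1 / T * (c\<^sup>2 * box_weight r s k)"
proof -
  have "x \<ge> 1" using T by linarith
  have "cutoff x = 1 / x * (1 / x\<^sup>2)" using one_le_power[OF \<open>x \<ge> 1\<close>, of 3]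
    by (simp add: cutoff_def max_def power2_eq_square power3_eq_cube)
  also have "\<dots> \<le> 1 / T * (1 / x\<^sup>2)" using T by (intro mult_right_mono divide_left_mono) auto
  also have "1 / x\<^sup>2 = min 1 (1 / x\<^sup>2)" using one_le_power[OF \<open>x \<ge> 1\<close>, of 2]
    by (intro min_absorb2[symmetric]) (auto simp: divide_le_eq_1)
  finally have "s ^ r * cutoff x \<le> s ^ r * (1 / T * min 1 (1 / x\<^sup>2))" using s by (intro mult_left_mono) auto
  also have "\<dots> = 1 / T * (s ^ r * min 1 (1 / x\<^sup>2))" by simp
  also have "\<dots> \<le> 1 / T * (c\<^sup>2 * box_weight r s k)"
    using T by (intro mult_left_mono min_square_le_box_weight) auto
  finally show ?thesis .
qed

text \<open>
  The dominating weight is unbounded where the dimension is small, so the bounded cutoff is much smaller there.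
\<close>
lemma cutoff_le_box_weight_small:
  assumes \<eta>: "c * \<eta> \<le> 1" "x \<le> \<eta>"
  shows "s ^ r * cutoff x \<le> (c * \<eta>) powr (1 / (real r + 1)) * box_weight r s k"
proof -
  note facts = scaled_facts
  have b\<eta>: "b \<le> c * \<eta>" using facts mult_left_mono[OF \<eta>(2), of c] by linarith
  have "ln b \<le> 0" using b\<eta> \<eta> facts by simp
  let ?\<Phi> = "exp (- (2 / (real r + 1)) * ln b - 1 / (real r + 1) * \<bar>ln b\<bar>)"
  have "?\<Phi> = exp (- (1 / (real r + 1) * ln b))"
  proof -
    have "2 / (real r + 1) * ln b = 2 * (1 / (real r + 1) * ln b)" by simp
    thus ?thesis using \<open>ln b \<le> 0\<close> by simp
  qed
  also have "\<dots> = 1 / b powr (1 / (real r + 1))"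
    using facts(1) by (simp add: powr_def exp_minus field_simps)
  finally have \<Phi>: "?\<Phi> = 1 / b powr (1 / (real r + 1))" .
  have "1 = b powr (1 / (real r + 1)) * ?\<Phi>" unfolding \<Phi> using facts(1) by simp
  also have "\<dots> \<le> (c * \<eta>) powr (1 / (real r + 1)) * ?\<Phi>"
    using facts(1) b\<eta> by (intro mult_right_mono powr_mono2) auto
  finally have "cutoff x \<le> (c * \<eta>) powr (1 / (real r + 1)) * ?\<Phi>"
    using cutoff_le_1[of x] by linarith
  hence "s ^ r * cutoff x \<le> s ^ r * ((c * \<eta>) powr (1 / (real r + 1)) * ?\<Phi>)"
    using s by (intro mult_left_mono) auto
  also have "\<dots> = (c * \<eta>) powr (1 / (real r + 1)) * (s ^ r * ?\<Phi>)" by simp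
  also have "\<dots> \<le> (c * \<eta>) powr (1 / (real r + 1)) * box_weight r s k"
    using crude_dim_box_weight(1)[OF r s k] by (intro mult_left_mono) (auto simp: b_def)
  finally show ?thesis .
qed

lemmas cutoff_bounds = cutoff_le_box_weight[unfolded x_def c_def]
  cutoff_le_box_weight_small[unfolded x_def c_def]
  cutoff_le_box_weight_large[unfolded x_def c_def]

end

definition lattice_const :: "nat \<Rightarrow> real" where
  "lattice_const r = (real (superfact r))\<^sup>2 * (4 / tail_exp r) ^ r"

lemma lattice_const_pos: "lattice_const r > 0"
  using superfact_pos[of r] tail_exp[of r] by (simp add: lattice_const_def)

text \<open>
  Up to a constant, a bound for the contribution of the index vectors in \<open>F\<close> to the variance of the
  dimension, relative to its order of magnitude \<open>s\<close> to the power \<open>- 2 R - r\<close>, where \<open>R = num_roots r\<close>.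
\<close>
definition lattice_sum :: "nat \<Rightarrow> real \<Rightarrow> (nat \<Rightarrow> nat) set \<Rightarrow> real" where
  "lattice_sum r s F = (\<Sum>k\<in>F. s ^ r * cutoff (s ^ num_roots r * irrep_dim r k))"

context
  fixes r :: nat and s :: real and F :: "(nat \<Rightarrow> nat) set"
  assumes r: "r \<ge> 2" and s: "s > 0" and F: "finite F" "F \<subseteq> irreps r"
begin

lemma coord_bounds:
  assumes "j \<in> {1..r}" "k \<in> F"
  shows "s \<le> s * real (k j)" "s * real (k j) \<le> s * real (\<Sum>k\<in>F. k j)"
proof -
  have "k j \<ge> 1" using assms F by (auto simp: irreps_def PiE_def Pi_def)
  thus "s \<le> s * real (k j)" using s by simp
  have "k j \<le> (\<Sum>k\<in>F. k j)" using assms F by (intro member_le_sum) auto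
  thus "s * real (k j) \<le> s * real (\<Sum>k\<in>F. k j)"
    using s by (intro mult_left_mono of_nat_mono) auto
qed

lemma sum_box_weight_le: "(\<Sum>k\<in>F. box_weight r s k) \<le> (4 / tail_exp r) ^ r"
proof -
  let ?\<beta> = "s * real (\<Sum>k\<in>F. k 1)"
  have j: "1 \<in> {1..r}" using r by auto
  have "(\<Sum>k\<in>F. box_weight r s k) \<le> (4 / tail_exp r) ^ r * (tail_cdf r ?\<beta> - tail_cdf r 0)"
  proof (rule sum_box_weight[OF s F j])
    show "0 \<le> ?\<beta>" using s by (intro mult_nonneg_nonneg) (auto intro: sum_nonneg)
  qed (use coord_bounds[OF j] in auto)
  also have "\<dots> \<le> (4 / tail_exp r) ^ r * 1"
    using tail_cdf_bounds(2)[of r ?\<beta>] tail_cdf_bounds(1)[of 0 r] tail_exp[of r] by (intro mult_left_mono) auto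
  finally show ?thesis by simp
qed

lemma lattice_sum_le_box_weights:
  assumes "\<And>k. k \<in> F \<Longrightarrow> s ^ r * cutoff (s ^ num_roots r * irrep_dim r k) \<le> D * box_weight r s k" "D \<ge> 0"
    "(\<Sum>k\<in>F. box_weight r s k) \<le> (4 / tail_exp r) ^ r * E"
  shows "lattice_sum r s F \<le> D * (4 / tail_exp r) ^ r * E"
proof -
  have "lattice_sum r s F \<le> (\<Sum>k\<in>F. D * box_weight r s k)"
    unfolding lattice_sum_def by (intro sum_mono assms)
  also have "\<dots> = D * (\<Sum>k\<in>F. box_weight r s k)" by (simp add: sum_distrib_left)
  also have "\<dots> \<le> D * ((4 / tail_exp r) ^ r * E)" by (intro mult_left_mono assms)
  finally show ?thesis by (simp add: mult_ac)
qed

lemma lattice_sum_bounded: "lattice_sum r s F \<le> lattice_const r"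
  using lattice_sum_le_box_weights[OF cutoff_bounds(1)[OF r s], of 1] sum_box_weight_le F
  by (auto simp: lattice_const_def)

lemma lattice_sum_small_coord:
  assumes j: "j \<in> {1..r}" and \<eta>: "\<eta> \<ge> 0" "\<And>k. k \<in> F \<Longrightarrow> s * real (k j) \<le> \<eta>"
  shows "lattice_sum r s F \<le> lattice_const r * \<eta> powr tail_exp r"
proof -
  have "(\<Sum>k\<in>F. box_weight r s k) \<le> (4 / tail_exp r) ^ r * (tail_cdf r \<eta> - tail_cdf r 0)"
    using coord_bounds[OF j] \<eta> by (intro sum_box_weight[OF s F j]) auto
  also have "\<dots> \<le> (4 / tail_exp r) ^ r * \<eta> powr tail_exp r"
    using tail_cdf_bounds(3)[of r \<eta>] tail_cdf_bounds(1)[of 0 r] tail_exp[of r] by (intro mult_left_mono) auto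
  finally show ?thesis
    using lattice_sum_le_box_weights[OF cutoff_bounds(1)[OF r s]] F by (auto simp: lattice_const_def)
qed

lemma lattice_sum_large_coord:
  assumes j: "j \<in> {1..r}" and T: "T \<ge> s" "\<And>k. k \<in> F \<Longrightarrow> T \<le> s * real (k j)"
  shows "lattice_sum r s F \<le> lattice_const r * (1 / (1 + (T - s) powr tail_exp r))"
proof -
  let ?\<beta> = "max T (s * real (\<Sum>k\<in>F. k j))"
  have "(\<Sum>k\<in>F. box_weight r s k) \<le> (4 / tail_exp r) ^ r * (tail_cdf r ?\<beta> - tail_cdf r (T - s))"
    using coord_bounds[OF j] T s by (intro sum_box_weight[OF s F j]) (auto simp: le_max_iff_disj)
  also have "\<dots> \<le> (4 / tail_exp r) ^ r * (1 - tail_cdf r (T - s))"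
    using tail_cdf_bounds(2)[of r ?\<beta>] tail_exp[of r] by (intro mult_left_mono) auto
  also have "1 - tail_cdf r (T - s) = 1 / (1 + (T - s) powr tail_exp r)" by (simp add: tail_cdf_def)
  finally have 1: "(\<Sum>k\<in>F. box_weight r s k) \<le> (4 / tail_exp r) ^ r * (1 / (1 + (T - s) powr tail_exp r))" .
  show ?thesis unfolding lattice_const_def
    by (rule lattice_sum_le_box_weights[OF cutoff_bounds(1)[OF r s] _ 1]) (use F in auto)
qed

lemma lattice_sum_small_dim:
  assumes \<eta>: "real (superfact r) * \<eta> \<le> 1" "\<And>k. k \<in> F \<Longrightarrow> s ^ num_roots r * irrep_dim r k \<le> \<eta>"
  shows "lattice_sum r s F \<le> lattice_const r * (real (superfact r) * \<eta>) powr (1 / (real r + 1))"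
proof -
  let ?D = "(real (superfact r) * \<eta>) powr (1 / (real r + 1))"
  have "lattice_sum r s F \<le> ?D * (4 / tail_exp r) ^ r * 1"
    by (rule lattice_sum_le_box_weights[OF cutoff_bounds(2)[OF r s _ \<eta>(1)]])
       (use F \<eta> sum_box_weight_le in auto)
  also have "\<dots> \<le> (real (superfact r))\<^sup>2 * (?D * (4 / tail_exp r) ^ r * 1)"
  proof -
    have "1 \<le> (real (superfact r))\<^sup>2" using superfact_pos[of r] by simp
    moreover have "0 \<le> ?D * (4 / tail_exp r) ^ r * 1" using tail_exp[of r] by simp
    ultimately show ?thesis using mult_right_mono[of 1 "(real (superfact r))\<^sup>2"] by fastforce
  qed
  finally show ?thesis by (simp add: lattice_const_def mult_ac)
qed

lemma lattice_sum_large_dim: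
  assumes T: "T \<ge> 1" "\<And>k. k \<in> F \<Longrightarrow> T \<le> s ^ num_roots r * irrep_dim r k"
  shows "lattice_sum r s F \<le> lattice_const r * (1 / T)"
proof -
  let ?D = "1 / T * (real (superfact r))\<^sup>2"
  have "lattice_sum r s F \<le> ?D * (4 / tail_exp r) ^ r * 1"
  proof (rule lattice_sum_le_box_weights)
    show "s ^ r * cutoff (s ^ num_roots r * irrep_dim r k) \<le> ?D * box_weight r s k" if "k \<in> F" for k
      using cutoff_bounds(3)[OF r s _ T(1) T(2)[OF that]] F that by (auto simp: mult.assoc)
  qed (use T sum_box_weight_le in auto)
  thus ?thesis by (simp add: lattice_const_def mult_ac)
qed

end

lemma power_le_fact_exp:
  fixes x :: real
  assumes "x \<ge> 0"
  shows "x ^ n \<le> fact n * exp x"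
proof -
  have "(\<Sum>i\<in>{n}. x ^ i /\<^sub>R fact i) \<le> (\<Sum>i. x ^ i /\<^sub>R fact i)"
    using assms by (intro sum_le_suminf summable_exp_generic) auto
  hence "x ^ n / fact n \<le> exp x" by (simp add: exp_def field_simps)
  thus ?thesis by (simp add: divide_le_eq mult.commute)
qed

text \<open>
  With \<open>y = x / (1 - exp (- x))\<close> the three expressions are \<open>y\<^sup>j exp (- x)\<close>, and \<open>1 \<le> y \<le> 1 + x\<close>.
\<close>
lemma cumulant_le_cutoff:
  fixes x :: real
  assumes x: "x > 0"
  shows "x ^ 3 * exp (- x) / (1 - exp (- x)) ^ 3 \<le> 720 * exp 1 * cutoff x"
    and "x\<^sup>2 * exp (- x) / (1 - exp (- x))\<^sup>2 \<le> x ^ 3 * exp (- x) / (1 - exp (- x)) ^ 3"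
    and "x * exp (- x) / (1 - exp (- x)) \<le> x\<^sup>2 * exp (- x) / (1 - exp (- x))\<^sup>2"
proof -
  define y where "y = x / (1 - exp (- x))"
  have pos: "1 - exp (- x) > 0" using x by simp
  have "1 - x \<le> exp (- x)" using exp_ge_add_one_self[of "- x"] by simp
  hence y1: "1 \<le> y" using pos by (simp add: y_def le_divide_eq)
  have "(1 + x) * exp (- x) \<le> exp x * exp (- x)"
    using exp_ge_add_one_self[of x] by (intro mult_right_mono) auto
  hence "(1 + x) * exp (- x) \<le> 1" by (simp flip: exp_add)
  hence y2: "y \<le> 1 + x" using pos by (simp add: y_def divide_le_eq algebra_simps)
  have e: "x ^ n * exp (- x) / (1 - exp (- x)) ^ n = y ^ n * exp (- x)" for n
    by (simp add: y_def power_divide)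
  show "x\<^sup>2 * exp (- x) / (1 - exp (- x))\<^sup>2 \<le> x ^ 3 * exp (- x) / (1 - exp (- x)) ^ 3"
    unfolding e using y1 by (intro mult_right_mono power_increasing) auto
  show "x * exp (- x) / (1 - exp (- x)) \<le> x\<^sup>2 * exp (- x) / (1 - exp (- x))\<^sup>2"
  proof -
    have "x * exp (- x) / (1 - exp (- x)) = y ^ 1 * exp (- x)" using e[of 1] by simp
    also have "\<dots> \<le> y\<^sup>2 * exp (- x)" using y1 by (intro mult_right_mono power_increasing) auto
    finally show ?thesis unfolding e .
  qed
  \<comment> \<open>three factors \<open>1 + x\<close> bound \<open>y ^ 3\<close>, three more the cutoff, and \<open>(1 + x) ^ 6 \<le> 6! * exp (1 + x)\<close>\<close>
  have "max 1 (x ^ 3) \<le> (1 + x) ^ 3"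
    using x power_mono[of 1 "1 + x" 3] power_mono[of x "1 + x" 3] by auto
  hence "y ^ 3 * exp (- x) * max 1 (x ^ 3) \<le> ((1 + x) ^ 3 * exp (- x)) * (1 + x) ^ 3"
    using y1 y2 x by (intro mult_mono power_mono) auto
  also have "\<dots> = (1 + x) ^ 6 * exp (- x)"
    by (simp add: mult_ac flip: power_add)
  also have "\<dots> \<le> (720 * exp (1 + x)) * exp (- x)"
  proof (intro mult_right_mono)
    show "(1 + x) ^ 6 \<le> 720 * exp (1 + x)"
      using power_le_fact_exp[of "1 + x" 6] x by (simp add: fact_numeral)
  qed auto
  also have "\<dots> = 720 * exp 1" by (simp add: exp_add exp_minus)
  finally show "x ^ 3 * exp (- x) / (1 - exp (- x)) ^ 3 \<le> 720 * exp 1 * cutoff x"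
    unfolding e cutoff_def by (simp add: pos_le_divide_eq less_max_iff_disj)
qed

section \<open>Random multisets with geometric multiplicities\<close>

text \<open>
  The representations with constituents in \<open>J\<close>, for an arbitrary type of indices.
\<close>
definition msets :: "'k set \<Rightarrow> 'k multiset set" where
  "msets J = {\<rho>. set_mset \<rho> \<subseteq> J}"

lemma msets_mono: "J \<subseteq> J' \<Longrightarrow> msets J \<subseteq> msets J'"
  by (auto simp: msets_def)

lemma has_sum_geometric:
  fixes z :: complex
  assumes "norm z < 1"
  shows "((\<lambda>n. z ^ n) has_sum (1 / (1 - z))) (UNIV :: nat set)"
proof (rule norm_summable_imp_has_sum)
  show "summable (\<lambda>n. norm (z ^ n))"
    using assms by (simp add: norm_power summable_geometric)
  show "(\<lambda>n. z ^ n) sums (1 / (1 - z))" using geometric_sums[OF assms] .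
qed

lemma bij_betw_msets_insert:
  assumes "k \<notin> F"
  shows "bij_betw (\<lambda>(n, \<rho>). replicate_mset n k + \<rho>) (UNIV \<times> msets F) (msets (insert k F))"
proof (rule bij_betw_byWitness[where f' = "\<lambda>\<rho>. (count \<rho> k, filter_mset (\<lambda>x. x \<noteq> k) \<rho>)"])
  show "\<forall>a\<in>UNIV \<times> msets F. (count (case a of (n, \<rho>) \<Rightarrow> replicate_mset n k + \<rho>) k,
      filter_mset (\<lambda>x. x \<noteq> k) (case a of (n, \<rho>) \<Rightarrow> replicate_mset n k + \<rho>)) = a"
  proof
    fix p :: "nat \<times> 'a multiset" assume "p \<in> UNIV \<times> msets F"
    then obtain n \<rho> where p: "p = (n, \<rho>)" and "\<rho> \<in> msets F" by auto
    hence k: "k \<notin># \<rho>" using assms by (auto simp: msets_def)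
    have "filter_mset (\<lambda>x. x \<noteq> k) (replicate_mset n k + \<rho>) = \<rho>"
      using k by (intro multiset_eqI) (auto simp: not_in_iff)
    thus "(count (case p of (n, \<rho>) \<Rightarrow> replicate_mset n k + \<rho>) k,
      filter_mset (\<lambda>x. x \<noteq> k) (case p of (n, \<rho>) \<Rightarrow> replicate_mset n k + \<rho>)) = p"
      using k by (simp add: not_in_iff p)
  qed
  show "\<forall>a'\<in>msets (insert k F). (case (count a' k, filter_mset (\<lambda>x. x \<noteq> k) a') of
        (n, \<rho>) \<Rightarrow> replicate_mset n k + \<rho>) = a'"
    by (auto intro!: multiset_eqI)
qed (auto simp: msets_def split: if_splits)

text \<open>
  Random multisets over \<open>U\<close> in which the multiplicities of the elements \<open>k\<close> are independent and geometric
  with parameters \<open>q ^ d k\<close>. They are described by their generating functions: the sum of \<open>z ^ mdim \<rho>\<close>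
  over the multisets \<open>\<rho>\<close> over \<open>J\<close> is the product of \<open>1 / (1 - z ^ d k)\<close> over \<open>k \<in> J\<close>.
\<close>
locale boltzmann_gas =
  fixes U :: "'k set" and d :: "'k \<Rightarrow> nat" and q :: real
  assumes d_pos: "k \<in> U \<Longrightarrow> d k \<ge> 1"
    and q: "0 < q" "q < 1"
    and summable: "(\<lambda>k. q ^ d k) summable_on U"
begin

definition mdim :: "'k multiset \<Rightarrow> nat" where
  "mdim \<rho> = (\<Sum>k\<in>#\<rho>. d k)"

lemma mdim_plus [simp]: "mdim (\<rho> + \<rho>') = mdim \<rho> + mdim \<rho>'"
  and mdim_empty [simp]: "mdim {#} = 0"
  by (auto simp: mdim_def)

lemma mdim_replicate [simp]: "mdim (replicate_mset n k) = n * d k"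
  by (induction n) (auto simp: mdim_def)

lemma summable_subset: "J \<subseteq> U \<Longrightarrow> (\<lambda>k. q ^ d k) summable_on J"
  using summable summable_on_subset_banach by blast

lemma norm_power_le:
  fixes z :: complex
  assumes "norm z \<le> q" "k \<in> U"
  shows "norm (z ^ d k) \<le> q ^ d k" "q ^ d k \<le> q" "norm (z ^ d k) < 1"
proof -
  show 1: "norm (z ^ d k) \<le> q ^ d k"
    using assms by (simp add: norm_power power_mono)
  show 2: "q ^ d k \<le> q"
    using power_decreasing[of 1 "d k" q] d_pos[OF assms(2)] q by simp
  show "norm (z ^ d k) < 1" using 1 2 q by linarith
qed

lemma has_sum_power_mdim_finite:
  fixes z :: complex
  assumes "finite F" "F \<subseteq> U" "norm z \<le> q"
  shows "(\<lambda>\<rho>. norm z ^ mdim \<rho>) summable_on msets F \<and>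
         ((\<lambda>\<rho>. z ^ mdim \<rho>) has_sum (\<Prod>k\<in>F. 1 / (1 - z ^ d k))) (msets F)"
  using assms
proof (induction F rule: finite_induct)
  case empty
  have "msets ({} :: 'k set) = {{#}}" by (auto simp: msets_def)
  thus ?case by (simp add: has_sum_finite_iff)
next
  case (insert k F)
  let ?h = "\<lambda>(n, \<rho>). replicate_mset n k + \<rho>"
  note bij = bij_betw_msets_insert[OF insert.hyps(2)]
  have k: "norm (z ^ d k) < 1"
    using norm_power_le(3)[of z k] insert.prems by auto
  have IH: "(\<lambda>\<rho>. norm z ^ mdim \<rho>) summable_on msets F"
      "((\<lambda>\<rho>. z ^ mdim \<rho>) has_sum (\<Prod>k\<in>F. 1 / (1 - z ^ d k))) (msets F)"
    using insert by auto
  have geo: "((\<lambda>n. (z ^ d k) ^ n) has_sum (1 / (1 - z ^ d k))) UNIV"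
    by (rule has_sum_geometric[OF k])
  have geo': "(\<lambda>n. (norm z ^ d k) ^ n) summable_on (UNIV :: nat set)"
    using k by (intro summable_nonneg_imp_summable_on summable_geometric) (auto simp: norm_power)
  have summ: "(\<lambda>(n, \<rho>). (norm z ^ d k) ^ n * norm z ^ mdim \<rho>) summable_on UNIV \<times> msets F"
  proof (rule summable_on_SigmaI)
    fix n :: nat
    show "((\<lambda>\<rho>. case (n, \<rho>) of (n, \<rho>) \<Rightarrow> (norm z ^ d k) ^ n * norm z ^ mdim \<rho>)
        has_sum (norm z ^ d k) ^ n * infsum (\<lambda>\<rho>. norm z ^ mdim \<rho>) (msets F)) (msets F)"
      using has_sum_cmult_right[OF has_sum_infsum[OF IH(1)]] by simp
    show "(\<lambda>n. (norm z ^ d k) ^ n * infsum (\<lambda>\<rho>. norm z ^ mdim \<rho>) (msets F)) summable_on UNIV"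
      by (rule summable_on_cmult_left[OF geo'])
  qed auto
  have eq: "z ^ mdim (?h p) = (case p of (n, \<rho>) \<Rightarrow> (z ^ d k) ^ n * z ^ mdim \<rho>)"
           "norm z ^ mdim (?h p) = (case p of (n, \<rho>) \<Rightarrow> (norm z ^ d k) ^ n * norm z ^ mdim \<rho>)" for p
    by (auto simp: power_add power_mult mult.commute[of _ "d k"] split: prod.splits)
  have "(\<lambda>p. norm z ^ mdim (?h p)) summable_on (UNIV \<times> msets F)"
    using summ by (simp add: eq)
  hence 1: "(\<lambda>\<rho>. norm z ^ mdim \<rho>) summable_on msets (insert k F)"
    using summable_on_reindex_bij_betw[OF bij, of "\<lambda>\<rho>. norm z ^ mdim \<rho>"] by simp
  have "((\<lambda>p. z ^ mdim (?h p)) has_sum (1 / (1 - z ^ d k) * (\<Prod>k\<in>F. 1 / (1 - z ^ d k)))) (UNIV \<times> msets F)"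
  proof (rule has_sum_SigmaI)
    fix n :: nat
    show "((\<lambda>\<rho>. z ^ mdim (?h (n, \<rho>))) has_sum (z ^ d k) ^ n * (\<Prod>k\<in>F. 1 / (1 - z ^ d k))) (msets F)"
      unfolding eq using has_sum_cmult_right[OF IH(2)] by simp
    show "((\<lambda>n. (z ^ d k) ^ n * (\<Prod>k\<in>F. 1 / (1 - z ^ d k))) has_sum
          1 / (1 - z ^ d k) * (\<Prod>k\<in>F. 1 / (1 - z ^ d k))) UNIV"
      by (rule has_sum_cmult_left[OF geo])
    show "(\<lambda>p. z ^ mdim (?h p)) summable_on UNIV \<times> msets F"
    proof (rule abs_summable_summable)
      show "(\<lambda>p. norm (z ^ mdim (?h p))) summable_on UNIV \<times> msets F"
        using summ by (simp only: norm_power eq(2))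
    qed
  qed
  hence "((\<lambda>\<rho>. z ^ mdim \<rho>) has_sum (1 / (1 - z ^ d k) * (\<Prod>k\<in>F. 1 / (1 - z ^ d k)))) (msets (insert k F))"
    using has_sum_reindex_bij_betw[OF bij, of "\<lambda>\<rho>. z ^ mdim \<rho>"] by simp
  thus ?case using 1 insert.hyps by simp
qed

lemma norm_Ln_one_minus_le:
  fixes w :: complex
  assumes "norm w \<le> q"
  shows "norm (Ln (1 - w)) \<le> 1 / (1 - q) * norm w"
proof -
  have "norm (Ln (1 - w) - Ln (1 - 0)) \<le> 1 / (1 - q) * norm (w - 0)"
  proof (rule field_differentiable_bound)
    fix z :: complex assume z: "z \<in> cball 0 q"
    hence "Re z < 1" using complex_Re_le_cmod[of z] q by simp
    hence nz: "1 - z \<notin> \<real>\<^sub>\<le>\<^sub>0" by (auto simp: complex_nonpos_Reals_iff)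
    show "((\<lambda>z. Ln (1 - z)) has_field_derivative (- (1 / (1 - z)))) (at z within cball 0 q)"
      using nz by (auto intro!: derivative_eq_intros simp: inverse_eq_divide)
    have "1 - q \<le> norm (1 - z)" using norm_triangle_ineq2[of 1 z] z by simp
    thus "norm (- (1 / (1 - z))) \<le> 1 / (1 - q)"
      using q by (auto simp: norm_divide intro!: divide_left_mono mult_pos_pos)
  qed (use assms q in auto)
  thus ?thesis by simp
qed

lemma norm_Ln_summand_le:
  fixes z :: complex
  assumes z: "norm z \<le> q" and k: "k \<in> U"
  shows "norm (- Ln (1 - z ^ d k)) \<le> 1 / (1 - q) * q ^ d k"
proof -
  note b = norm_power_le[OF z k]
  have "norm (- Ln (1 - z ^ d k)) \<le> 1 / (1 - q) * norm (z ^ d k)"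
    using norm_Ln_one_minus_le[of "z ^ d k"] b by simp
  also have "\<dots> \<le> 1 / (1 - q) * q ^ d k" using b q by (intro mult_left_mono) auto
  finally show ?thesis .
qed

lemma summable_Ln:
  fixes z :: complex
  assumes "J \<subseteq> U" "norm z \<le> q"
  shows "(\<lambda>k. - Ln (1 - z ^ d k)) summable_on J"
proof (rule abs_summable_summable, rule Infinite_Sum.abs_summable_on_comparison_test')
  show "(\<lambda>k. 1 / (1 - q) * q ^ d k) summable_on J"
    by (intro summable_on_cmult_right summable_subset assms)
  fix k assume "k \<in> J"
  thus "norm (- Ln (1 - z ^ d k)) \<le> 1 / (1 - q) * q ^ d k"
    using assms by (intro norm_Ln_summand_le) auto
qed

text \<open>
  The logarithm of the generating function; unlike the infinite product, it is an absolutely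
  convergent sum.
\<close>
definition log_Z :: "'k set \<Rightarrow> complex \<Rightarrow> complex" where
  "log_Z J z = (\<Sum>\<^sub>\<infinity>k\<in>J. - Ln (1 - z ^ d k))"

lemma prod_eq_exp_Ln:
  fixes z :: complex
  assumes "F \<subseteq> U" "norm z \<le> q" "finite F"
  shows "(\<Prod>k\<in>F. 1 / (1 - z ^ d k)) = exp (\<Sum>k\<in>F. - Ln (1 - z ^ d k))"
proof -
  have "1 / (1 - z ^ d k) = exp (- Ln (1 - z ^ d k))" if "k \<in> F" for k
  proof -
    have "1 - z ^ d k \<noteq> 0" using norm_power_le(3)[OF assms(2), of k] that assms(1) by auto
    thus ?thesis by (simp add: exp_minus field_simps)
  qed
  thus ?thesis using assms(3) by (simp add: exp_sum)
qed

text \<open>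
  Every finite set of multisets over \<open>J\<close> lives on a finite subset of \<open>J\<close>.
\<close>
lemma tendsto_infsum_msets:
  fixes f :: "'k multiset \<Rightarrow> complex"
  assumes "f summable_on msets J"
  shows "((\<lambda>F. infsum f (msets F)) \<longlongrightarrow> infsum f (msets J)) (finite_subsets_at_top J)"
  unfolding tendsto_iff
proof safe
  fix e :: real assume e: "e > 0"
  let ?S = "infsum f (msets J)"
  have "eventually (\<lambda>X. dist (sum f X) ?S < e / 2) (finite_subsets_at_top (msets J))"
    using has_sum_infsum[OF assms] half_gt_zero[OF e] unfolding has_sum_def tendsto_iff by blast
  then obtain X0 where X0: "finite X0" "X0 \<subseteq> msets J"
    "\<forall>X. finite X \<and> X0 \<subseteq> X \<and> X \<subseteq> msets J \<longrightarrow> dist (sum f X) ?S < e / 2"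
    unfolding eventually_finite_subsets_at_top by (elim exE conjE)
  define F0 where "F0 = (\<Union>\<rho>\<in>X0. set_mset \<rho>)"
  have F0: "finite F0" "F0 \<subseteq> J" using X0 by (auto simp: F0_def msets_def)
  have "dist (infsum f (msets F)) ?S < e" if F: "finite F" "F0 \<subseteq> F" "F \<subseteq> J" for F
  proof -
    have sub: "msets F \<subseteq> msets J" by (rule msets_mono[OF F(3)])
    have X0F: "X0 \<subseteq> msets F" using F(2) by (auto simp: msets_def F0_def)
    have summ: "f summable_on msets F" using assms sub summable_on_subset_banach by blast
    have "((\<lambda>X. dist (sum f X) ?S) \<longlongrightarrow> dist (infsum f (msets F)) ?S) (finite_subsets_at_top (msets F))"
      using has_sum_infsum[OF summ] unfolding has_sum_def by (intro tendsto_intros)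
    moreover have "eventually (\<lambda>X. dist (sum f X) ?S \<le> e / 2) (finite_subsets_at_top (msets F))"
      unfolding eventually_finite_subsets_at_top
    proof (intro exI[of _ X0] conjI allI impI X0F X0(1))
      fix X assume "finite X \<and> X0 \<subseteq> X \<and> X \<subseteq> msets F"
      hence "finite X \<and> X0 \<subseteq> X \<and> X \<subseteq> msets J" using sub by blast
      from X0(3)[rule_format, OF this] show "dist (sum f X) ?S \<le> e / 2" by (rule less_imp_le)
    qed
    ultimately have "dist (infsum f (msets F)) ?S \<le> e / 2"
      by (intro tendsto_upperbound) auto
    thus ?thesis using e by linarith
  qed
  thus "eventually (\<lambda>F. dist (infsum f (msets F)) ?S < e) (finite_subsets_at_top J)"
    unfolding eventually_finite_subsets_at_top by (intro exI[of _ F0]) (simp add: F0)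
qed

lemma sum_power_mdim_le:
  assumes "J \<subseteq> U" "finite X" "X \<subseteq> msets J"
  shows "(\<Sum>\<rho>\<in>X. q ^ mdim \<rho>) \<le> exp (1 / (1 - q) * (\<Sum>\<^sub>\<infinity>k\<in>J. q ^ d k))"
proof -
  define F where "F = (\<Union>\<rho>\<in>X. set_mset \<rho>)"
  have F: "finite F" "F \<subseteq> J" "X \<subseteq> msets F" using assms by (auto simp: F_def msets_def)
  define z where "z = complex_of_real q"
  have z: "norm z \<le> q" "norm z = q" using q by (auto simp: z_def)
  have *: "(\<lambda>\<rho>. q ^ mdim \<rho>) summable_on msets F"
    "((\<lambda>\<rho>. z ^ mdim \<rho>) has_sum (\<Prod>k\<in>F. 1 / (1 - z ^ d k))) (msets F)"
    using has_sum_power_mdim_finite[of F z] F assms(1) z by auto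
  have le: "(\<Sum>\<rho>\<in>X. q ^ mdim \<rho>) \<le> (\<Sum>\<^sub>\<infinity>\<rho>\<in>msets F. q ^ mdim \<rho>)"
    using q by (intro finite_sum_le_infsum * F assms) auto
  have "((\<lambda>\<rho>. complex_of_real (q ^ mdim \<rho>)) has_sum complex_of_real (\<Sum>\<^sub>\<infinity>\<rho>\<in>msets F. q ^ mdim \<rho>)) (msets F)"
    by (intro has_sum_of_real has_sum_infsum *)
  hence "complex_of_real (\<Sum>\<^sub>\<infinity>\<rho>\<in>msets F. q ^ mdim \<rho>) = (\<Prod>k\<in>F. 1 / (1 - z ^ d k))"
    using *(2) by (simp add: z_def has_sum_unique)
  also have "\<dots> = exp (\<Sum>k\<in>F. - Ln (1 - z ^ d k))"
    using F assms(1) z by (intro prod_eq_exp_Ln) auto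
  finally have eq: "norm (complex_of_real (\<Sum>\<^sub>\<infinity>\<rho>\<in>msets F. q ^ mdim \<rho>)) = exp (Re (\<Sum>k\<in>F. - Ln (1 - z ^ d k)))"
    by simp
  have "(\<Sum>\<rho>\<in>X. q ^ mdim \<rho>) \<le> exp (Re (\<Sum>k\<in>F. - Ln (1 - z ^ d k)))"
    using eq le unfolding norm_of_real by linarith
  also have "\<dots> \<le> exp (1 / (1 - q) * (\<Sum>\<^sub>\<infinity>k\<in>J. q ^ d k))"
    unfolding exp_le_cancel_iff
  proof -
    have "Re (\<Sum>k\<in>F. - Ln (1 - z ^ d k)) \<le> norm (\<Sum>k\<in>F. - Ln (1 - z ^ d k))"
      by (rule complex_Re_le_cmod)
    also have "\<dots> \<le> (\<Sum>k\<in>F. 1 / (1 - q) * q ^ d k)"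
      using F assms(1) z by (intro sum_norm_le norm_Ln_summand_le) auto
    also have "\<dots> = 1 / (1 - q) * (\<Sum>k\<in>F. q ^ d k)" by (simp add: sum_distrib_left)
    also have "\<dots> \<le> 1 / (1 - q) * (\<Sum>\<^sub>\<infinity>k\<in>J. q ^ d k)"
      using q F assms(1) by (intro mult_left_mono finite_sum_le_infsum summable_subset) auto
    finally show "Re (\<Sum>k\<in>F. - Ln (1 - z ^ d k)) \<le> 1 / (1 - q) * (\<Sum>\<^sub>\<infinity>k\<in>J. q ^ d k)" .
  qed
  finally show ?thesis .
qed

lemma summable_power_mdim:
  assumes "J \<subseteq> U"
  shows "(\<lambda>\<rho>. q ^ mdim \<rho>) summable_on msets J"
proof (rule nonneg_bdd_above_summable_on)
  show "bdd_above (sum (\<lambda>\<rho>. q ^ mdim \<rho>) ` {F. F \<subseteq> msets J \<and> finite F})"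
    unfolding bdd_above_def using sum_power_mdim_le[OF assms] by blast
qed (use q in auto)

text \<open>
  For finite \<open>J\<close> the multiplicities can be summed one after the other; the general case is the limit over the
  finite subsets.
\<close>
lemma has_sum_power_mdim:
  fixes z :: complex
  assumes J: "J \<subseteq> U" and z: "norm z \<le> q"
  shows "((\<lambda>\<rho>. z ^ mdim \<rho>) has_sum exp (log_Z J z)) (msets J)"
proof -
  have summ: "(\<lambda>\<rho>. z ^ mdim \<rho>) summable_on msets J"
  proof (rule abs_summable_summable, rule Infinite_Sum.abs_summable_on_comparison_test')
    show "norm (z ^ mdim \<rho>) \<le> q ^ mdim \<rho>" for \<rho>
      using z by (simp add: norm_power power_mono)
  qed (rule summable_power_mdim[OF J])
  have "((\<lambda>F. \<Sum>k\<in>F. - Ln (1 - z ^ d k)) \<longlongrightarrow> log_Z J z) (finite_subsets_at_top J)"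
    using has_sum_infsum[OF summable_Ln[OF assms]] by (simp add: has_sum_def log_Z_def)
  hence "((\<lambda>F. exp (\<Sum>k\<in>F. - Ln (1 - z ^ d k))) \<longlongrightarrow> exp (log_Z J z)) (finite_subsets_at_top J)"
    by (rule tendsto_exp)
  moreover have "eventually (\<lambda>F. exp (\<Sum>k\<in>F. - Ln (1 - z ^ d k)) = infsum (\<lambda>\<rho>. z ^ mdim \<rho>) (msets F)) (finite_subsets_at_top J)"
  proof (rule eventually_finite_subsets_at_top_weakI)
    fix F assume F: "finite F" "F \<subseteq> J"
    have "infsum (\<lambda>\<rho>. z ^ mdim \<rho>) (msets F) = (\<Prod>k\<in>F. 1 / (1 - z ^ d k))"
      using has_sum_power_mdim_finite[of F z] F J z by (intro infsumI) auto
    thus "exp (\<Sum>k\<in>F. - Ln (1 - z ^ d k)) = infsum (\<lambda>\<rho>. z ^ mdim \<rho>) (msets F)"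
      using prod_eq_exp_Ln[of F z] F J z by simp
  qed
  ultimately have "((\<lambda>F. infsum (\<lambda>\<rho>. z ^ mdim \<rho>) (msets F)) \<longlongrightarrow> exp (log_Z J z)) (finite_subsets_at_top J)"
    by (rule Lim_transform_eventually)
  hence "infsum (\<lambda>\<rho>. z ^ mdim \<rho>) (msets J) = exp (log_Z J z)"
    using tendsto_unique[OF _ tendsto_infsum_msets[OF summ]] by (simp add: finite_subsets_at_top_neq_bot)
  thus ?thesis using has_sum_infsum[OF summ] by simp
qed

end

section \<open>Characteristic functions and the total variation bound\<close>

lemma norm_le_of_finite_sums:
  fixes f :: "'a \<Rightarrow> real"
  assumes "(f has_sum S) A" "\<And>X. finite X \<Longrightarrow> X \<subseteq> A \<Longrightarrow> (\<Sum>x\<in>X. \<bar>f x\<bar>) \<le> K"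
  shows "\<bar>S\<bar> \<le> K"
proof -
  have "((\<lambda>X. \<bar>sum f X\<bar>) \<longlongrightarrow> \<bar>S\<bar>) (finite_subsets_at_top A)"
    using assms(1) unfolding has_sum_def by (intro tendsto_intros)
  moreover have "eventually (\<lambda>X. \<bar>sum f X\<bar> \<le> K) (finite_subsets_at_top A)"
    by (rule eventually_finite_subsets_at_top_weakI) (rule order_trans[OF sum_abs assms(2)])
  ultimately show ?thesis by (intro tendsto_upperbound) auto
qed

lemma integral_cis:
  fixes j :: int
  shows "((\<lambda>t. cis (of_int j * t)) has_integral (if j = 0 then of_real (2 * pi) else 0)) {-pi..pi}"
proof (cases "j = 0")
  case True
  have "((\<lambda>t::real. 1::complex) has_integral (pi - (-pi)) *\<^sub>R 1) {-pi..pi}"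
    using has_integral_const_real[of "1::complex" "-pi" pi] by simp
  thus ?thesis using True by (simp add: scaleR_conv_of_real)
next
  case False
  let ?F = "\<lambda>t. cis (of_int j * t) / (\<i> * of_int j)"
  have "((\<lambda>t. cis (of_int j * t)) has_integral (?F pi - ?F (-pi))) {-pi..pi}"
  proof (rule fundamental_theorem_of_calculus)
    fix t :: real
    have "((\<lambda>z. exp (\<i> * of_int j * z) / (\<i> * of_int j)) has_field_derivative
            exp (\<i> * of_int j * of_real t)) (at (of_real t))"
      using False by (auto intro!: derivative_eq_intros)
    from has_vector_derivative_real_field[OF this, of "{-pi..pi}"]
    show "(?F has_vector_derivative cis (of_int j * t)) (at t within {-pi..pi})"
      by (simp add: cis_conv_exp mult_ac)
  qed simp
  moreover have "cis (of_int j * pi) = cis (of_int j * - pi)"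
  proof -
    have "sin (of_int j * pi) = 0" using sin_zero_iff_int2[of "of_int j * pi"] by auto
    thus ?thesis by (auto simp: complex_eq_iff)
  qed
  ultimately show ?thesis using False by simp
qed

context boltzmann_gas
begin

definition Z :: "'k set \<Rightarrow> real" where
  "Z J = exp (\<Sum>\<^sub>\<infinity>k\<in>J. - ln (1 - q ^ d k))"

definition weight :: "'k set \<Rightarrow> 'k multiset \<Rightarrow> real" where
  "weight J \<rho> = q ^ mdim \<rho> / Z J"

text \<open>
  The characteristic function of the dimension of a multiset over \<open>J\<close>.
\<close>
definition char :: "'k set \<Rightarrow> real \<Rightarrow> complex" where
  "char J t = exp (log_Z J (of_real q * cis t) - log_Z J (of_real q))"

text \<open>
  The argument ranges over the integers, since it is the difference of the prescribed dimension and that of a part.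
\<close>
definition prob :: "'k set \<Rightarrow> int \<Rightarrow> real" where
  "prob J m = (\<Sum>\<^sub>\<infinity>\<rho>\<in>msets J. if int (mdim \<rho>) = m then weight J \<rho> else 0)"

lemma norm_q_cis: "norm (of_real q * cis t) \<le> q" "norm (complex_of_real q) \<le> q"
  using q by (auto simp: norm_mult)

lemma power_bounds:
  assumes "k \<in> U"
  shows "0 < q ^ d k" "q ^ d k < 1"
  using norm_power_le(2)[OF norm_q_cis(2) assms] q by auto

lemma log_summand_real:
  assumes "k \<in> U"
  shows "- Ln (1 - complex_of_real q ^ d k) = of_real (- ln (1 - q ^ d k))"
proof -
  have "1 - complex_of_real q ^ d k = of_real (1 - q ^ d k)" by simp
  thus ?thesis using power_bounds[OF assms] by (simp only: Ln_of_real of_real_minus)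
qed

lemma summable_log:
  assumes "J \<subseteq> U"
  shows "(\<lambda>k. - ln (1 - q ^ d k)) summable_on J"
proof -
  have "(\<lambda>k. Re (- Ln (1 - complex_of_real q ^ d k))) summable_on J"
    by (intro summable_on_Re summable_Ln assms norm_q_cis)
  also have "?this \<longleftrightarrow> ?thesis"
    using assms by (intro summable_on_cong) (subst log_summand_real, auto)
  finally show ?thesis .
qed

lemma exp_log_Z_q:
  assumes "J \<subseteq> U"
  shows "exp (log_Z J (of_real q)) = of_real (Z J)"
proof -
  have "log_Z J (of_real q) = (\<Sum>\<^sub>\<infinity>k\<in>J. complex_of_real (- ln (1 - q ^ d k)))"
    unfolding log_Z_def using assms by (intro infsum_cong log_summand_real) auto
  also have "\<dots> = of_real (\<Sum>\<^sub>\<infinity>k\<in>J. - ln (1 - q ^ d k))"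
    using has_sum_of_real[OF has_sum_infsum[OF summable_log[OF assms]]] by (rule infsumI)
  finally show ?thesis by (simp add: Z_def exp_of_real)
qed

lemma Z_pos: "Z J > 0" by (simp add: Z_def)

lemma weight_nonneg: "weight J \<rho> \<ge> 0"
  using q Z_pos[of J] by (simp add: weight_def)

lemma has_sum_char:
  assumes "J \<subseteq> U"
  shows "((\<lambda>\<rho>. of_real (weight J \<rho>) * cis (real (mdim \<rho>) * t)) has_sum char J t) (msets J)"
proof -
  have "((\<lambda>\<rho>. (of_real q * cis t) ^ mdim \<rho> * (1 / of_real (Z J))) has_sum
          exp (log_Z J (of_real q * cis t)) * (1 / of_real (Z J))) (msets J)"
    by (intro has_sum_cmult_left has_sum_power_mdim assms norm_q_cis)
  thus ?thesis
    by (simp add: char_def exp_diff exp_log_Z_q[OF assms] weight_def power_mult_distrib Complex.DeMoivre)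
qed

lemma has_sum_weight:
  assumes "J \<subseteq> U"
  shows "(weight J has_sum 1) (msets J)"
proof -
  have "((\<lambda>\<rho>. Re (of_real (weight J \<rho>) * cis (real (mdim \<rho>) * 0))) has_sum Re (char J 0)) (msets J)"
    by (intro has_sum_Re has_sum_char assms)
  thus ?thesis by (simp add: char_def)
qed

lemma summable_weight: "J \<subseteq> U \<Longrightarrow> weight J summable_on msets J"
  using has_sum_weight has_sum_imp_summable by blast

lemma uniform_limit_char:
  assumes "J \<subseteq> U"
  shows "uniform_limit UNIV (\<lambda>X t. \<Sum>\<rho>\<in>X. of_real (weight J \<rho>) * cis (real (mdim \<rho>) * t)) (char J)
           (finite_subsets_at_top (msets J))"
  by (rule Weierstrass_m_test_general'[OF _ has_sum_char[OF assms] summable_weight[OF assms]])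
     (simp add: norm_mult weight_nonneg)

lemma continuous_char:
  assumes "J \<subseteq> U"
  shows "continuous_on A (char J)"
proof -
  have "continuous_on UNIV (char J)"
    by (rule uniform_limit_theorem[OF _ uniform_limit_char[OF assms]])
       (auto intro!: always_eventually continuous_intros)
  thus ?thesis using continuous_on_subset by blast
qed

lemma summable_prob:
  assumes "J \<subseteq> U"
  shows "(\<lambda>\<rho>. if int (mdim \<rho>) = m then weight J \<rho> else 0) summable_on msets J"
  by (rule summable_on_comparison_test[OF summable_weight[OF assms]]) (auto simp: weight_nonneg)

text \<open>
  Fourier inversion: the series of the characteristic function converges uniformly, and the
  dimension takes integer values.
\<close>
lemma integral_char:
  assumes "J \<subseteq> U"
  shows "((\<lambda>t. char J t * cis (- (of_int m * t))) has_integral of_real (2 * pi * prob J m)) {-pi..pi}"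
proof -
  let ?f = "\<lambda>X t. (\<Sum>\<rho>\<in>X. of_real (weight J \<rho>) * cis (real (mdim \<rho>) * t)) * cis (- (of_int m * t))"
  let ?FS = "finite_subsets_at_top (msets J)"
  have "uniform_limit {-pi..pi} ?f (\<lambda>t. char J t * cis (- (of_int m * t))) ?FS"
  proof (rule uniform_lim_mult)
    show "uniform_limit {-pi..pi} (\<lambda>X t. \<Sum>\<rho>\<in>X. of_real (weight J \<rho>) * cis (real (mdim \<rho>) * t)) (char J) ?FS"
      using uniform_limit_char[OF assms] uniform_limit_on_subset by blast
    show "bounded (char J ` {-pi..pi})"
      by (intro compact_imp_bounded compact_continuous_image continuous_char assms) auto
    show "bounded ((\<lambda>t. cis (- (of_int m * t))) ` {-pi..pi})"
      by (rule boundedI[of _ 1]) auto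
  qed (auto intro: uniform_limit_const)
  then obtain I J' where I: "\<And>X. (?f X has_integral I X) {-pi..pi}"
     "((\<lambda>t. char J t * cis (- (of_int m * t))) has_integral J') {-pi..pi}" "(I \<longlongrightarrow> J') ?FS"
    by (rule uniform_limit_integral) (auto intro!: continuous_intros)
  have "I X = (\<Sum>\<rho>\<in>X. of_real (2 * pi * (if int (mdim \<rho>) = m then weight J \<rho> else 0)))" if "finite X" for X
  proof -
    have "((\<lambda>t. \<Sum>\<rho>\<in>X. of_real (weight J \<rho>) * cis (of_int (int (mdim \<rho>) - m) * t)) has_integral
        (\<Sum>\<rho>\<in>X. of_real (weight J \<rho>) * (if int (mdim \<rho>) - m = 0 then of_real (2 * pi) else 0))) {-pi..pi}"
      by (intro has_integral_sum that has_integral_mult_right integral_cis)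
    also have "(\<lambda>t. \<Sum>\<rho>\<in>X. of_real (weight J \<rho>) * cis (of_int (int (mdim \<rho>) - m) * t)) = ?f X"
      by (rule ext, simp only: sum_distrib_right mult.assoc cis_mult)
         (intro sum.cong refl, simp add: algebra_simps)
    also have "(\<Sum>\<rho>\<in>X. of_real (weight J \<rho>) * (if int (mdim \<rho>) - m = 0 then of_real (2 * pi) else 0))
      = (\<Sum>\<rho>\<in>X. complex_of_real (2 * pi * (if int (mdim \<rho>) = m then weight J \<rho> else 0)))"
      by (intro sum.cong) auto
    finally show ?thesis using I(1)[of X] has_integral_unique by blast
  qed
  hence "eventually (\<lambda>X. I X = (\<Sum>\<rho>\<in>X. of_real (2 * pi * (if int (mdim \<rho>) = m then weight J \<rho> else 0)))) ?FS"
    by (intro eventually_finite_subsets_at_top_weakI) auto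
  moreover have "((\<lambda>X. \<Sum>\<rho>\<in>X. complex_of_real (2 * pi * (if int (mdim \<rho>) = m then weight J \<rho> else 0))) \<longlongrightarrow> of_real (2 * pi * prob J m)) ?FS"
    using has_sum_of_real[OF has_sum_cmult_right[OF has_sum_infsum[OF summable_prob[OF assms, of m]], of "2 * pi"]]
    unfolding has_sum_def prob_def by simp
  ultimately have "(I \<longlongrightarrow> of_real (2 * pi * prob J m)) ?FS"
    by (simp add: tendsto_cong)
  hence "J' = of_real (2 * pi * prob J m)"
    using I(3) tendsto_unique finite_subsets_at_top_neq_bot by blast
  thus ?thesis using I(2) by simp
qed

text \<open>
  The factor of \<open>k\<close> in \<open>|char J t|\<^sup>2\<close> is \<open>1 / (1 + spread k t)\<close>.
\<close>
definition spread :: "'k \<Rightarrow> real \<Rightarrow> real" where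
  "spread k t = 4 * q ^ d k * (sin (real (d k) * t / 2))\<^sup>2 / (1 - q ^ d k)\<^sup>2"

lemma spread_nonneg: "spread k t \<ge> 0"
  using q by (simp add: spread_def)

lemma has_sum_ln_spread:
  assumes "J \<subseteq> U"
  shows "((\<lambda>k. ln (1 + spread k t)) has_sum (- ln ((norm (char J t))\<^sup>2))) J"
proof -
  let ?z = "of_real q * cis t"
  have "((\<lambda>k. - 2 * Re (- Ln (1 - ?z ^ d k) - (- Ln (1 - of_real q ^ d k)))) has_sum
          (- 2 * Re (log_Z J ?z - log_Z J (of_real q)))) J"
  proof -
    have *: "((\<lambda>k. - Ln (1 - w ^ d k)) has_sum log_Z J w) J" if "norm w \<le> q" for w
      unfolding log_Z_def by (intro has_sum_infsum summable_Ln assms that)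
    show ?thesis
      using has_sum_cmult_right[OF has_sum_Re[OF has_sum_add[OF *[OF norm_q_cis(1)] has_sum_uminusI[OF *[OF norm_q_cis(2)]]]], of "-2"]
      by simp
  qed
  moreover have "- 2 * Re (- Ln (1 - ?z ^ d k) - (- Ln (1 - of_real q ^ d k))) = ln (1 + spread k t)"
    if "k \<in> J" for k
  proof -
    have k: "k \<in> U" using that assms by auto
    define p where "p = q ^ d k"
    define u where "u = real (d k) * t"
    have p: "0 < p" "p < 1" using power_bounds[OF k] by (auto simp: p_def)
    have zk: "?z ^ d k = of_real p * cis u"
      by (simp add: power_mult_distrib Complex.DeMoivre p_def u_def)
    have nz: "1 - of_real p * cis u \<noteq> 0"
      using norm_power_le(3)[OF norm_q_cis(1) k, of t] zk by auto
    have "(norm (1 - of_real p * cis u))\<^sup>2 = (1 - p * cos u)\<^sup>2 + (p * sin u)\<^sup>2"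
      by (simp add: cmod_power2)
    also have "\<dots> = 1 - 2 * p * cos u + p\<^sup>2 * ((sin u)\<^sup>2 + (cos u)\<^sup>2)"
    proof -
      have "(1 - p * y)\<^sup>2 + (p * x)\<^sup>2 = 1 - 2 * p * y + p\<^sup>2 * (x\<^sup>2 + y\<^sup>2)" for x y :: real
        by (simp add: power2_eq_square algebra_simps)
      thus ?thesis .
    qed
    also have "\<dots> = (1 - p)\<^sup>2 + 2 * p * (1 - cos u)"
      unfolding sin_cos_squared_add by (simp add: power2_eq_square algebra_simps)
    also have "1 - cos u = 2 * (sin (u / 2))\<^sup>2"
      using cos_double_sin[of "u / 2"] by simp
    also have "(1 - p)\<^sup>2 + 2 * p * (2 * (sin (u / 2))\<^sup>2) = (1 - p)\<^sup>2 * (1 + spread k t)"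
    proof -
      have "spread k t = 4 * p * (sin (u / 2))\<^sup>2 / (1 - p)\<^sup>2"
        by (simp add: spread_def p_def u_def)
      thus ?thesis using p by (simp add: field_simps)
    qed
    finally have eq: "(norm (1 - of_real p * cis u))\<^sup>2 = (1 - p)\<^sup>2 * (1 + spread k t)" .
    have "2 * ln (norm (1 - of_real p * cis u)) = ln ((norm (1 - of_real p * cis u))\<^sup>2)"
      using nz by (simp add: ln_realpow)
    also have "\<dots> = ln ((1 - p)\<^sup>2) + ln (1 + spread k t)"
      unfolding eq using p spread_nonneg[of k t] by (subst ln_mult_pos) auto
    also have "ln ((1 - p)\<^sup>2) = 2 * ln (1 - p)" using p by (simp add: ln_realpow)
    finally have "2 * ln (norm (1 - of_real p * cis u)) = 2 * ln (1 - p) + ln (1 + spread k t)" .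
    moreover have "Re (Ln (1 - of_real p * cis u)) = ln (norm (1 - of_real p * cis u))"
      using nz by (rule Re_Ln)
    moreover have "Re (- Ln (1 - of_real q ^ d k)) = - ln (1 - p)"
      unfolding log_summand_real[OF k] by (simp add: p_def)
    ultimately show ?thesis unfolding zk by simp
  qed
  ultimately have "((\<lambda>k. ln (1 + spread k t)) has_sum (- 2 * Re (log_Z J ?z - log_Z J (of_real q)))) J"
    by (metis (no_types, lifting) has_sum_cong)
  moreover have "ln ((norm (char J t))\<^sup>2) = 2 * Re (log_Z J ?z - log_Z J (of_real q))"
    by (simp add: char_def ln_realpow)
  ultimately show ?thesis by simp
qed

lemma norm_char_le:
  assumes "J \<subseteq> U" "finite F" "F \<subseteq> J"
  shows "(norm (char J t))\<^sup>2 \<le> exp (- (\<Sum>k\<in>F. ln (1 + spread k t)))"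
proof -
  have "(\<Sum>k\<in>F. ln (1 + spread k t)) \<le> - ln ((norm (char J t))\<^sup>2)"
    by (rule finite_sum_le_has_sum[OF has_sum_ln_spread[OF assms(1)] assms(2,3)])
       (simp add: spread_nonneg)
  moreover have "(norm (char J t))\<^sup>2 > 0" by (simp add: char_def)
  ultimately show ?thesis by (subst ln_le_cancel_iff[symmetric]) auto
qed

lemma norm_char_le_1: "J \<subseteq> U \<Longrightarrow> norm (char J t) \<le> 1"
  using norm_char_le[of J "{}" t] by (simp add: power_le_one_iff)

text \<open>
  \<open>V\<close> bounds the variance of the dimension. The estimate is uniform in \<open>t\<close>, as \<open>sin\<^sup>2 x \<le> x\<^sup>2\<close>
  holds for all \<open>x\<close>.
\<close>
lemma one_minus_norm_char_le:
  assumes "J \<subseteq> U" and V: "\<And>F. finite F \<Longrightarrow> F \<subseteq> J \<Longrightarrow> (\<Sum>k\<in>F. (real (d k))\<^sup>2 * q ^ d k / (1 - q ^ d k)\<^sup>2) \<le> V"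
  shows "1 - (norm (char J t))\<^sup>2 \<le> t\<^sup>2 * V"
proof -
  have "(\<Sum>k\<in>F. ln (1 + spread k t)) \<le> t\<^sup>2 * V" if F: "finite F" "F \<subseteq> J" for F
  proof -
    have "ln (1 + spread k t) \<le> t\<^sup>2 * ((real (d k))\<^sup>2 * q ^ d k / (1 - q ^ d k)\<^sup>2)" for k
    proof -
      have "ln (1 + spread k t) \<le> spread k t" by (rule ln_add_one_self_le_self[OF spread_nonneg])
      also have "\<dots> \<le> 4 * q ^ d k * (real (d k) * t / 2)\<^sup>2 / (1 - q ^ d k)\<^sup>2"
        unfolding spread_def using q abs_sin_x_le_abs_x[of "real (d k) * t / 2"]
        by (intro divide_right_mono mult_left_mono) (auto simp: abs_le_square_iff[symmetric])
      also have "\<dots> = t\<^sup>2 * ((real (d k))\<^sup>2 * q ^ d k / (1 - q ^ d k)\<^sup>2)"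
        by (simp add: power2_eq_square)
      finally show ?thesis .
    qed
    hence "(\<Sum>k\<in>F. ln (1 + spread k t)) \<le> (\<Sum>k\<in>F. t\<^sup>2 * ((real (d k))\<^sup>2 * q ^ d k / (1 - q ^ d k)\<^sup>2))"
      by (intro sum_mono)
    also have "\<dots> = t\<^sup>2 * (\<Sum>k\<in>F. (real (d k))\<^sup>2 * q ^ d k / (1 - q ^ d k)\<^sup>2)" by (simp add: sum_distrib_left)
    also have "\<dots> \<le> t\<^sup>2 * V" using V[OF F] by (intro mult_left_mono) auto
    finally show ?thesis .
  qed
  hence 1: "- ln ((norm (char J t))\<^sup>2) \<le> t\<^sup>2 * V"
    using has_sum_le_finite_sums[OF has_sum_ln_spread[OF assms(1), of t]] by blast
  have pos: "(norm (char J t))\<^sup>2 > 0" by (simp add: char_def)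
  have "1 - (norm (char J t))\<^sup>2 \<le> - ln ((norm (char J t))\<^sup>2)"
    using ln_le_minus_one[OF pos] by linarith
  with 1 show ?thesis by linarith
qed

lemma log_Z_disjoint:
  assumes "I \<subseteq> U" "norm z \<le> q"
  shows "log_Z U z = log_Z I z + log_Z (U - I) z"
proof -
  have "I \<union> (U - I) = U" using assms by auto
  thus ?thesis unfolding log_Z_def
    using infsum_Un_disjoint[OF summable_Ln[OF assms] summable_Ln[OF _ assms(2), of "U - I"]] by auto
qed

lemma char_disjoint: "I \<subseteq> U \<Longrightarrow> char U t = char I t * char (U - I) t"
  unfolding char_def log_Z_disjoint[OF _ norm_q_cis(1)] log_Z_disjoint[OF _ norm_q_cis(2)] exp_add[symmetric]
  by (rule arg_cong[where f=exp]) simp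

lemma Z_disjoint: "I \<subseteq> U \<Longrightarrow> Z U = Z I * Z (U - I)"
proof -
  assume I: "I \<subseteq> U"
  have "complex_of_real (Z U) = of_real (Z I * Z (U - I))"
    using I exp_log_Z_q[of U] exp_log_Z_q[of I] exp_log_Z_q[of "U - I"]
    by (simp add: log_Z_disjoint[OF _ norm_q_cis(2)] exp_add)
  thus ?thesis by (simp only: of_real_eq_iff)
qed

text \<open>
  The multisets whose part in \<open>I\<close> belongs to \<open>B\<close>.
\<close>
definition event :: "'k set \<Rightarrow> 'k multiset set \<Rightarrow> 'k multiset set" where
  "event I B = {\<rho> \<in> msets U. filter_mset (\<lambda>k. k \<in> I) \<rho> \<in> B}"

definition slice_weight :: "int \<Rightarrow> 'k multiset set \<Rightarrow> real" where
  "slice_weight m E = (\<Sum>\<^sub>\<infinity>\<rho>\<in>E. if int (mdim \<rho>) = m then weight U \<rho> else 0)"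

text \<open>
  The error made for the event \<open>E\<close> if the distribution conditioned on dimension \<open>m\<close> is replaced by the unconditioned one.
\<close>
definition conditioning_error :: "int \<Rightarrow> 'k multiset set \<Rightarrow> real" where
  "conditioning_error m E = \<bar>infsum (weight U) E - slice_weight m E / prob U m\<bar>"

lemma bij_betw_msets_split:
  assumes "I \<subseteq> U" "B \<subseteq> msets I"
  shows "bij_betw (\<lambda>(x, y). x + y) (B \<times> msets (U - I)) (event I B)"
  unfolding event_def
proof (rule bij_betw_byWitness[where f' = "\<lambda>\<rho>. (filter_mset (\<lambda>k. k \<in> I) \<rho>, filter_mset (\<lambda>k. k \<notin> I) \<rho>)"])
  have *: "filter_mset (\<lambda>k. k \<in> I) (x + y) = x" "filter_mset (\<lambda>k. k \<notin> I) (x + y) = y"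
    if "x \<in> msets I" "y \<in> msets (U - I)" for x y
  proof -
    have "filter_mset (\<lambda>k. k \<in> I) x = x" "filter_mset (\<lambda>k. k \<notin> I) y = y"
      using that by (auto simp: msets_def filter_mset_eq_conv)
    moreover have "filter_mset (\<lambda>k. k \<notin> I) x = {#}" "filter_mset (\<lambda>k. k \<in> I) y = {#}"
      using that by (auto simp: msets_def filter_mset_eq_conv)
    ultimately show "filter_mset (\<lambda>k. k \<in> I) (x + y) = x" "filter_mset (\<lambda>k. k \<notin> I) (x + y) = y" by simp_all
  qed
  show "\<forall>a\<in>B \<times> msets (U - I). (filter_mset (\<lambda>k. k \<in> I) (case a of (x, y) \<Rightarrow> x + y),
        filter_mset (\<lambda>k. k \<notin> I) (case a of (x, y) \<Rightarrow> x + y)) = a"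
    using * assms(2) by (auto simp del: filter_union_mset)
  show "\<forall>a'\<in>{\<rho> \<in> msets U. filter_mset (\<lambda>k. k \<in> I) \<rho> \<in> B}.
       (case (filter_mset (\<lambda>k. k \<in> I) a', filter_mset (\<lambda>k. k \<notin> I) a') of (x, y) \<Rightarrow> x + y) = a'"
    by (auto simp flip: multiset_partition)
  show "(\<lambda>(x, y). x + y) ` (B \<times> msets (U - I)) \<subseteq> {\<rho> \<in> msets U. filter_mset (\<lambda>k. k \<in> I) \<rho> \<in> B}"
  proof safe
    fix x y assume xy: "x \<in> B" "y \<in> msets (U - I)"
    thus "filter_mset (\<lambda>k. k \<in> I) (x + y) \<in> B" using * assms(2) by (auto simp del: filter_union_mset)
    show "x + y \<in> msets U" using xy assms by (auto simp: msets_def)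
  qed
  show "(\<lambda>\<rho>. (filter_mset (\<lambda>k. k \<in> I) \<rho>, filter_mset (\<lambda>k. k \<notin> I) \<rho>)) ` {\<rho> \<in> msets U. filter_mset (\<lambda>k. k \<in> I) \<rho> \<in> B}
    \<subseteq> B \<times> msets (U - I)"
    by (auto simp: msets_def)
qed

lemma weight_plus: "I \<subseteq> U \<Longrightarrow> weight U (x + y) = weight I x * weight (U - I) y"
  by (simp add: weight_def Z_disjoint power_add)

text \<open>
  The parts in \<open>I\<close> and in its complement are independent.
\<close>
lemma has_sum_weight_event:
  assumes I: "I \<subseteq> U" and B: "B \<subseteq> msets I"
  defines "E \<equiv> event I B"
  shows "(weight U has_sum infsum (weight I) B) E"
    and "((\<lambda>\<rho>. if int (mdim \<rho>) = m then weight U \<rho> else 0) has_sum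
           (\<Sum>\<^sub>\<infinity>x\<in>B. weight I x * prob (U - I) (m - int (mdim x)))) E"
    and "(\<lambda>x. weight I x * prob (U - I) (m - int (mdim x))) summable_on B"
proof -
  note bij = bij_betw_msets_split[OF I B, folded E_def]
  have summB: "weight I summable_on B"
    using summable_weight[OF I] B summable_on_subset_banach by blast
  have J: "U - I \<subseteq> U" by auto
  have inner: "((\<lambda>y. weight U (x + y)) has_sum weight I x * 1) (msets (U - I))" for x
    unfolding weight_plus[OF I] by (intro has_sum_cmult_right has_sum_weight J)
  have summ: "(\<lambda>p. weight U (case p of (x, y) \<Rightarrow> x + y)) summable_on B \<times> msets (U - I)"
    by (rule summable_on_SigmaI[where g="\<lambda>x. weight I x * 1"])
       (use inner summB in \<open>auto simp: weight_nonneg\<close>)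
  have "((\<lambda>p. weight U (case p of (x, y) \<Rightarrow> x + y)) has_sum infsum (weight I) B) (B \<times> msets (U - I))"
    by (rule has_sum_SigmaI[where g="\<lambda>x. weight I x * 1", OF _ _ summ])
       (use inner summB in auto)
  thus "(weight U has_sum infsum (weight I) B) E"
    using has_sum_reindex_bij_betw[OF bij, of "weight U"] by simp
  let ?g = "\<lambda>\<rho>. if int (mdim \<rho>) = m then weight U \<rho> else 0"
  have inner': "((\<lambda>y. ?g (x + y)) has_sum weight I x * prob (U - I) (m - int (mdim x))) (msets (U - I))" for x
  proof -
    have "((\<lambda>y. weight I x * (if int (mdim y) = m - int (mdim x) then weight (U - I) y else 0)) has_sum
       weight I x * prob (U - I) (m - int (mdim x))) (msets (U - I))"
      unfolding prob_def by (intro has_sum_cmult_right has_sum_infsum summable_prob J)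
    also have "(\<lambda>y. weight I x * (if int (mdim y) = m - int (mdim x) then weight (U - I) y else 0)) = (\<lambda>y. ?g (x + y))"
      by (auto simp: weight_plus[OF I])
    finally show ?thesis .
  qed
  have summ': "(\<lambda>p. ?g (case p of (x, y) \<Rightarrow> x + y)) summable_on B \<times> msets (U - I)"
    by (rule summable_on_comparison_test[OF summ]) (auto simp: weight_nonneg)
  show summB': "(\<lambda>x. weight I x * prob (U - I) (m - int (mdim x))) summable_on B"
  proof -
    have "(\<lambda>x. \<Sum>\<^sub>\<infinity>y\<in>msets (U - I). ?g (x + y)) summable_on B"
      using summ' by (intro summable_on_Sigma_banach) (simp only: case_prod_unfold)
    thus ?thesis using infsumI[OF inner'] by simp
  qed
  have "((\<lambda>p. ?g (case p of (x, y) \<Rightarrow> x + y)) has_sum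
      (\<Sum>\<^sub>\<infinity>x\<in>B. weight I x * prob (U - I) (m - int (mdim x)))) (B \<times> msets (U - I))"
    by (rule has_sum_SigmaI[OF _ has_sum_infsum[OF summB'] summ']) (use inner' in \<open>simp only: case_prod_conv\<close>)
  thus "(?g has_sum (\<Sum>\<^sub>\<infinity>x\<in>B. weight I x * prob (U - I) (m - int (mdim x)))) E"
    using has_sum_reindex_bij_betw[OF bij, of ?g] by simp
qed

text \<open>
  The values \<open>cis (mdim x * t)\<close> have absolute value \<open>1\<close> and mean \<open>char I t\<close>, so their variance is
  \<open>1 - |char I t|\<^sup>2\<close>.
\<close>
lemma sum_weight_deviation_le:
  assumes I: "I \<subseteq> U" and X: "finite X" "X \<subseteq> msets I"
  shows "(\<Sum>x\<in>X. weight I x * norm (char I t - cis (real (mdim x) * t))) \<le> sqrt (1 - (norm (char I t))\<^sup>2)"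
proof -
  let ?c = "char I t" and ?e = "\<lambda>x. cis (real (mdim x) * t)"
  have sq: "(norm (?c - ?e x))\<^sup>2 = ((norm ?c)\<^sup>2 + 1) + - 2 * Re (cnj ?c * ?e x)" for x
  proof -
    define a b C S where "a = Re ?c" and "b = Im ?c" and "C = cos (real (mdim x) * t)" and "S = sin (real (mdim x) * t)"
    have "(a - C)\<^sup>2 + (b - S)\<^sup>2 = (a\<^sup>2 + b\<^sup>2 + (C\<^sup>2 + S\<^sup>2)) + - 2 * (a * C + b * S)"
      by (simp add: power2_eq_square algebra_simps)
    also have "C\<^sup>2 + S\<^sup>2 = 1" by (simp add: C_def S_def)
    finally have "(a - C)\<^sup>2 + (b - S)\<^sup>2 = (a\<^sup>2 + b\<^sup>2 + 1) + - 2 * (a * C + b * S)" .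
    thus ?thesis by (simp add: cmod_power2 a_def b_def C_def S_def)
  qed
  have "((\<lambda>x. weight I x * ((norm ?c)\<^sup>2 + 1) + - 2 * Re (cnj ?c * (of_real (weight I x) * ?e x))) has_sum
      1 * ((norm ?c)\<^sup>2 + 1) + - 2 * Re (cnj ?c * ?c)) (msets I)"
    by (intro has_sum_add has_sum_cmult_left has_sum_cmult_right has_sum_Re has_sum_weight has_sum_char I)
  also have "1 * ((norm ?c)\<^sup>2 + 1) + - 2 * Re (cnj ?c * ?c) = 1 - (norm ?c)\<^sup>2"
    using cmod_power2[of ?c] by (simp add: power2_eq_square)
  also have "(\<lambda>x. weight I x * ((norm ?c)\<^sup>2 + 1) + - 2 * Re (cnj ?c * (of_real (weight I x) * ?e x)))
     = (\<lambda>x. weight I x * (norm (?c - ?e x))\<^sup>2)"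
    unfolding sq by (simp add: algebra_simps)
  finally have var: "((\<lambda>x. weight I x * (norm (?c - ?e x))\<^sup>2) has_sum 1 - (norm ?c)\<^sup>2) (msets I)" .
  have 1: "(\<Sum>x\<in>X. weight I x * (norm (?c - ?e x))\<^sup>2) \<le> 1 - (norm ?c)\<^sup>2"
    by (rule finite_sum_le_has_sum[OF var X]) (simp add: weight_nonneg)
  have 2: "(\<Sum>x\<in>X. weight I x) \<le> 1"
    by (rule finite_sum_le_has_sum[OF has_sum_weight[OF I] X]) (simp add: weight_nonneg)
  have nonneg: "0 \<le> 1 - (norm ?c)\<^sup>2" using norm_char_le_1[OF I, of t] by (simp add: power_le_one)
  have "(\<Sum>x\<in>X. weight I x * norm (?c - ?e x))\<^sup>2
      = (\<Sum>x\<in>X. sqrt (weight I x) * (sqrt (weight I x) * norm (?c - ?e x)))\<^sup>2"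
    by (simp add: weight_nonneg flip: mult.assoc)
  also have "\<dots> \<le> (\<Sum>x\<in>X. (sqrt (weight I x))\<^sup>2) * (\<Sum>x\<in>X. (sqrt (weight I x) * norm (?c - ?e x))\<^sup>2)"
    by (rule Cauchy_Schwarz_ineq_sum)
  also have "\<dots> = (\<Sum>x\<in>X. weight I x) * (\<Sum>x\<in>X. weight I x * (norm (?c - ?e x))\<^sup>2)"
    by (simp add: weight_nonneg power_mult_distrib)
  also have "\<dots> \<le> 1 * (1 - (norm ?c)\<^sup>2)"
    using nonneg by (intro mult_mono 1 2 sum_nonneg) (auto simp: weight_nonneg)
  finally show ?thesis by (intro real_le_rsqrt) simp
qed

lemma sum_prob_deviation_le:
  assumes I: "I \<subseteq> U" and X: "finite X" "X \<subseteq> msets I"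
    and V: "\<And>F. finite F \<Longrightarrow> F \<subseteq> I \<Longrightarrow> (\<Sum>k\<in>F. (real (d k))\<^sup>2 * q ^ d k / (1 - q ^ d k)\<^sup>2) \<le> V"
  shows "(\<Sum>x\<in>X. weight I x * (2 * pi * \<bar>prob U m - prob (U - I) (m - int (mdim x))\<bar>))
      \<le> sqrt V * integral {-pi..pi} (\<lambda>t. norm (char (U - I) t) * \<bar>t\<bar>)"
proof -
  let ?J = "U - I"
  have J: "?J \<subseteq> U" by auto
  have cont: "continuous_on A (char ?J)" "continuous_on A (char I)" for A
    by (intro continuous_char I J)+
  have V0: "V \<ge> 0" using V[of "{}"] by simp
  have bound: "2 * pi * \<bar>prob U m - prob ?J (m - int (mdim x))\<bar>
     \<le> integral {-pi..pi} (\<lambda>t. norm (char ?J t) * norm (char I t - cis (real (mdim x) * t)))" for x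
  proof -
    let ?g = "\<lambda>t. char ?J t * (char I t - cis (real (mdim x) * t)) * cis (- (of_int m * t))"
    have "((\<lambda>t. char U t * cis (- (of_int m * t)) - char ?J t * cis (- (of_int (m - int (mdim x)) * t))) has_integral
       of_real (2 * pi * prob U m) - of_real (2 * pi * prob ?J (m - int (mdim x)))) {-pi..pi}"
      by (intro has_integral_diff integral_char J order_refl)
    also have "(\<lambda>t. char U t * cis (- (of_int m * t)) - char ?J t * cis (- (of_int (m - int (mdim x)) * t))) = ?g"
    proof
      fix t :: real
      have "cis (- (of_int (m - int (mdim x)) * t)) = cis (real (mdim x) * t) * cis (- (of_int m * t))"
        unfolding cis_mult by (rule arg_cong[where f=cis]) (simp add: algebra_simps)
      thus "char U t * cis (- (of_int m * t)) - char ?J t * cis (- (of_int (m - int (mdim x)) * t)) = ?g t"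
        by (simp add: char_disjoint[OF I] algebra_simps)
    qed
    finally have int: "(?g has_integral of_real (2 * pi * prob U m) - of_real (2 * pi * prob ?J (m - int (mdim x)))) {-pi..pi}" .
    have "norm (complex_of_real (2 * pi * prob U m) - of_real (2 * pi * prob ?J (m - int (mdim x))))
       = norm (integral {-pi..pi} ?g)"
      using int by (simp add: integral_unique)
    also have "\<dots> \<le> integral {-pi..pi} (\<lambda>t. norm (char ?J t) * norm (char I t - cis (real (mdim x) * t)))"
      by (rule integral_norm_bound_integral)
         (use int in \<open>auto simp: norm_mult intro!: integrable_continuous_real continuous_intros cont\<close>)
    finally have "\<bar>2 * pi * prob U m - 2 * pi * prob ?J (m - int (mdim x))\<bar>
      \<le> integral {-pi..pi} (\<lambda>t. norm (char ?J t) * norm (char I t - cis (real (mdim x) * t)))"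
      unfolding of_real_diff[symmetric] norm_of_real .
    thus ?thesis by (simp add: abs_mult flip: right_diff_distrib)
  qed
  have "(\<Sum>x\<in>X. weight I x * (2 * pi * \<bar>prob U m - prob ?J (m - int (mdim x))\<bar>))
     \<le> (\<Sum>x\<in>X. weight I x * integral {-pi..pi} (\<lambda>t. norm (char ?J t) * norm (char I t - cis (real (mdim x) * t))))"
    by (intro sum_mono mult_left_mono bound weight_nonneg)
  also have "\<dots> = integral {-pi..pi} (\<lambda>t. \<Sum>x\<in>X. weight I x * (norm (char ?J t) * norm (char I t - cis (real (mdim x) * t))))"
    by (subst integral_sum)
       (auto intro!: integrable_continuous_real continuous_intros cont X(1))
  also have "\<dots> \<le> integral {-pi..pi} (\<lambda>t. sqrt V * (norm (char ?J t) * \<bar>t\<bar>))"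
  proof (rule integral_le)
    fix t
    have "(\<Sum>x\<in>X. weight I x * (norm (char ?J t) * norm (char I t - cis (real (mdim x) * t))))
       = norm (char ?J t) * (\<Sum>x\<in>X. weight I x * norm (char I t - cis (real (mdim x) * t)))"
      by (simp add: sum_distrib_left mult_ac)
    also have "\<dots> \<le> norm (char ?J t) * sqrt (1 - (norm (char I t))\<^sup>2)"
      by (intro mult_left_mono sum_weight_deviation_le I X) auto
    also have "\<dots> \<le> norm (char ?J t) * sqrt (t\<^sup>2 * V)"
      by (intro mult_left_mono real_sqrt_le_mono one_minus_norm_char_le I V) auto
    also have "\<dots> = sqrt V * (norm (char ?J t) * \<bar>t\<bar>)" by (simp add: real_sqrt_mult)
    finally show "(\<Sum>x\<in>X. weight I x * (norm (char ?J t) * norm (char I t - cis (real (mdim x) * t))))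
       \<le> sqrt V * (norm (char ?J t) * \<bar>t\<bar>)" .
  qed (auto intro!: integrable_continuous_real continuous_intros cont X(1))
  finally show ?thesis by simp
qed

text \<open>
  Given the part \<open>x\<close> in \<open>I\<close>, the total dimension is \<open>m\<close> with probability \<open>prob (U - I) (m - mdim x)\<close>. The error is
  the average over \<open>x\<close> of its relative deviation from \<open>prob U m\<close>.
\<close>
lemma event_deviation_le:
  assumes I: "I \<subseteq> U" and B: "B \<subseteq> msets I" and pos: "prob U m > 0"
    and V: "\<And>F. finite F \<Longrightarrow> F \<subseteq> I \<Longrightarrow> (\<Sum>k\<in>F. (real (d k))\<^sup>2 * q ^ d k / (1 - q ^ d k)\<^sup>2) \<le> V"
  shows "conditioning_error m (event I B)
     \<le> sqrt V * integral {-pi..pi} (\<lambda>t. norm (char (U - I) t) * \<bar>t\<bar>) / (2 * pi * prob U m)"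
proof -
  define E where "E = event I B"
  note hs = has_sum_weight_event[OF I B, folded E_def]
  have summB: "weight I summable_on B"
    using summable_weight[OF I] B summable_on_subset_banach by blast
  let ?p = "\<lambda>x. prob (U - I) (m - int (mdim x))"
  have "((\<lambda>x. weight I x + - (weight I x * ?p x * (1 / prob U m))) has_sum
      infsum (weight I) B + - ((\<Sum>\<^sub>\<infinity>x\<in>B. weight I x * ?p x) * (1 / prob U m))) B"
    by (intro has_sum_add has_sum_uminusI has_sum_cmult_left has_sum_infsum summB hs(3))
  also have "infsum (weight I) B = infsum (weight U) E" using infsumI[OF hs(1)] by simp
  also have "(\<Sum>\<^sub>\<infinity>x\<in>B. weight I x * ?p x) = slice_weight m E"
    using infsumI[OF hs(2)[of m]] by (simp add: slice_weight_def)
  finally have "\<bar>infsum (weight U) E + - (slice_weight m E * (1 / prob U m))\<bar>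
     \<le> sqrt V * integral {-pi..pi} (\<lambda>t. norm (char (U - I) t) * \<bar>t\<bar>) / (2 * pi * prob U m)"
  proof (rule norm_le_of_finite_sums)
    fix X assume X: "finite X" "X \<subseteq> B"
    have "(\<Sum>x\<in>X. \<bar>weight I x + - (weight I x * ?p x * (1 / prob U m))\<bar>)
      = (\<Sum>x\<in>X. weight I x * (2 * pi * \<bar>prob U m - ?p x\<bar>)) / (2 * pi * prob U m)"
      unfolding sum_divide_distrib
    proof (intro sum.cong refl)
      fix x
      have "weight I x + - (weight I x * ?p x * (1 / prob U m)) = weight I x * ((prob U m - ?p x) / prob U m)"
        using pos by (simp add: field_simps)
      thus "\<bar>weight I x + - (weight I x * ?p x * (1 / prob U m))\<bar> =
         weight I x * (2 * pi * \<bar>prob U m - ?p x\<bar>) / (2 * pi * prob U m)"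
        using pos by (simp add: abs_mult weight_nonneg)
    qed
    also have "\<dots> \<le> sqrt V * integral {-pi..pi} (\<lambda>t. norm (char (U - I) t) * \<bar>t\<bar>) / (2 * pi * prob U m)"
      using X B pos by (intro divide_right_mono sum_prob_deviation_le I V) auto
    finally show "(\<Sum>x\<in>X. \<bar>weight I x + - (weight I x * ?p x * (1 / prob U m))\<bar>)
      \<le> sqrt V * integral {-pi..pi} (\<lambda>t. norm (char (U - I) t) * \<bar>t\<bar>) / (2 * pi * prob U m)" .
  qed
  thus ?thesis by (simp add: conditioning_error_def E_def)
qed

end

section \<open>A local limit estimate\<close>

text \<open>
  The left-hand side is the remainder of order three of the logarithm of the characteristic function of
  a geometric variable; the third derivative has absolute value at most \<open>2 p / (1 - p) ^ 3\<close>.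
\<close>
lemma Ln_geometric_taylor:
  fixes p u :: real
  assumes p: "0 < p" "p < 1"
  shows "norm (Ln (1 - of_real p) - Ln (1 - of_real p * cis u)
            - (\<i> * of_real (p / (1 - p) * u) - of_real (p / (1 - p)\<^sup>2 * u\<^sup>2 / 2)))
         \<le> p / (1 - p) ^ 3 * \<bar>u\<bar> ^ 3"
proof -
  define E where "E w = exp (\<i> * w)" for w :: complex
  define D where "D w = 1 - of_real p * E w" for w :: complex
  define f where "f i w = (if i = 0 then - Ln (D w) else if i = 1 then \<i> * of_real p * E w / D w
      else if i = 2 then - of_real p * E w / (D w)\<^sup>2
      else - \<i> * of_real p * E w * (1 + of_real p * E w) / (D w) ^ 3)" for i :: nat and w :: complex
  have E1: "norm (E w) = 1" if "w \<in> \<real>" for w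
    using that by (auto simp: E_def elim!: Reals_cases)
  have normD: "1 - p \<le> norm (D w)" if "w \<in> \<real>" for w
    using norm_triangle_ineq2[of 1 "of_real p * E w"] E1[OF that] p by (simp add: D_def norm_mult)
  have ReD: "Re (D w) > 0" if "w \<in> \<real>" for w
  proof -
    have "Re (of_real p * E w) \<le> norm (of_real p * E w)" by (rule complex_Re_le_cmod)
    also have "\<dots> = p" using E1[OF that] p by (simp add: norm_mult)
    finally have "Re (of_real p * E w) \<le> p" .
    moreover have "Re (D w) = 1 - Re (of_real p * E w)" by (simp add: D_def)
    ultimately show ?thesis using p by linarith
  qed
  have D0: "D w \<noteq> 0" if "w \<in> \<real>" for w using ReD[OF that] by auto
  have dE: "(E has_field_derivative \<i> * E w) (at w within A)" for w A
    unfolding E_def by (auto intro!: derivative_eq_intros)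
  have dD: "(D has_field_derivative - of_real p * (\<i> * E w)) (at w within A)" for w A
    unfolding D_def by (auto intro!: derivative_eq_intros dE)
  have "norm (f 0 (of_real u) - (\<Sum>i\<le>2. f i 0 * (of_real u - 0) ^ i / fact i))
      \<le> (2 * p / (1 - p) ^ 3) * norm (of_real u - (0 :: complex)) ^ Suc 2 / fact 2"
  proof (rule complex_Taylor[of "\<real>"])
    fix i and w :: complex assume w: "w \<in> \<real>" and i: "i \<le> (2 :: nat)"
    have nz: "D w \<noteq> 0" "D w \<notin> \<real>\<^sub>\<le>\<^sub>0" using D0[OF w] ReD[OF w] by (auto simp: complex_nonpos_Reals_iff)
    consider "i = 0" | "i = 1" | "i = 2" using i by linarith
    thus "(f i has_field_derivative f (Suc i) w) (at w within \<real>)"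
    proof cases
      case 1
      have "((\<lambda>w. - Ln (D w)) has_field_derivative \<i> * of_real p * E w / D w) (at w within \<real>)"
        using nz by (auto intro!: derivative_eq_intros dD simp: field_simps)
      thus ?thesis using 1 by (simp add: f_def[abs_def])
    next
      case 2
      have "((\<lambda>w. \<i> * of_real p * E w / D w) has_field_derivative
              (\<i> * of_real p * (\<i> * E w) * D w - \<i> * of_real p * E w * (- of_real p * (\<i> * E w))) / (D w * D w)) (at w within \<real>)"
        using nz by (intro DERIV_divide DERIV_cmult dD dE) auto
      also have "(\<i> * of_real p * (\<i> * E w) * D w - \<i> * of_real p * E w * (- of_real p * (\<i> * E w))) / (D w * D w)
         = - of_real p * E w / (D w)\<^sup>2"
      proof -
        have "\<i> * of_real p * (\<i> * E w) * D w - \<i> * of_real p * E w * (- of_real p * (\<i> * E w)) = - of_real p * E w"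
          by (simp add: D_def algebra_simps)
        thus ?thesis by (simp add: power2_eq_square)
      qed
      finally show ?thesis using 2 by (simp add: f_def[abs_def] numeral_2_eq_2)
    next
      case 3
      have "((\<lambda>w. - of_real p * E w / (D w)\<^sup>2) has_field_derivative
              (- of_real p * (\<i> * E w) * (D w)\<^sup>2 - - of_real p * E w * (of_nat 2 * ((- of_real p * (\<i> * E w)) * D w ^ (2 - Suc 0)))) / ((D w)\<^sup>2 * (D w)\<^sup>2)) (at w within \<real>)"
        using nz by (intro DERIV_divide DERIV_cmult DERIV_power dD dE) auto
      also have "(- of_real p * (\<i> * E w) * (D w)\<^sup>2 - - of_real p * E w * (of_nat 2 * ((- of_real p * (\<i> * E w)) * D w ^ (2 - Suc 0)))) / ((D w)\<^sup>2 * (D w)\<^sup>2)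
          = (- \<i> * of_real p * E w * (D w + 2 * of_real p * E w)) * D w / ((D w)\<^sup>2 * (D w)\<^sup>2)"
        by (rule arg_cong2[where f="(/)"]) (simp_all add: power2_eq_square algebra_simps)
      also have "\<dots> = - \<i> * of_real p * E w * (D w + 2 * of_real p * E w) / (D w) ^ 3"
        using nz by (simp add: power2_eq_square power3_eq_cube mult.assoc)
      also have "D w + 2 * of_real p * E w = 1 + of_real p * E w" by (simp add: D_def)
      finally show ?thesis using 3 by (simp add: f_def[abs_def])
    qed
  next
    fix w :: complex assume w: "w \<in> \<real>"
    have "norm (1 + of_real p * E w) \<le> 2"
      using norm_triangle_ineq[of 1 "of_real p * E w"] E1[OF w] p by (simp add: norm_mult)
    hence "p * norm (1 + of_real p * E w) / norm (D w) ^ 3 \<le> p * 2 / (1 - p) ^ 3"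
      using normD[OF w] p by (intro frac_le mult_left_mono power_mono) auto
    thus "norm (f (Suc 2) w) \<le> 2 * p / (1 - p) ^ 3"
      using E1[OF w] p by (simp add: f_def norm_mult norm_divide norm_power mult_ac)
  qed (auto simp: convex_Reals)
  also have "(\<Sum>i\<le>2. f i 0 * (of_real u - 0) ^ i / fact i)
      = - Ln (1 - of_real p) + (\<i> * of_real (p / (1 - p) * u) - of_real (p / (1 - p)\<^sup>2 * u\<^sup>2 / 2))"
    by (simp add: numeral_2_eq_2 f_def D_def E_def)
  also have "f 0 (of_real u) = - Ln (1 - of_real p * cis u)"
    by (simp add: f_def D_def E_def cis_conv_exp)
  finally show ?thesis by (simp add: algebra_simps)
qed

lemma integral_cauchy_density_le:
  fixes b M :: real
  assumes "b > 0" "M \<ge> 0"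
  shows "integral {-M..M} (\<lambda>t. 1 / (1 + (b * t)\<^sup>2)) \<le> pi / b"
proof -
  have "((\<lambda>t. 1 / (1 + (b * t)\<^sup>2)) has_integral (arctan (b * M) / b - arctan (b * (-M)) / b)) {-M..M}"
  proof (rule fundamental_theorem_of_calculus)
    fix t :: real
    have "((\<lambda>t. arctan (b * t) / b) has_field_derivative 1 / (1 + (b * t)\<^sup>2)) (at t within {-M..M})"
      using assms by (auto intro!: derivative_eq_intros simp: divide_inverse)
    thus "((\<lambda>t. arctan (b * t) / b) has_vector_derivative 1 / (1 + (b * t)\<^sup>2)) (at t within {-M..M})"
      by (simp add: has_real_derivative_iff_has_vector_derivative)
  qed (use assms in auto)
  hence "integral {-M..M} (\<lambda>t. 1 / (1 + (b * t)\<^sup>2)) = 2 * arctan (b * M) / b"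
    by (simp add: integral_unique arctan_minus)
  also have "\<dots> \<le> 2 * (pi / 2) / b"
    using arctan_ubound[of "b * M"] assms by (intro divide_right_mono mult_left_mono) auto
  finally show ?thesis by simp
qed

lemma exp_ge_quadratic:
  fixes x :: real
  assumes "x \<ge> 0"
  shows "1 + x + x\<^sup>2 / 2 \<le> exp x"
  using exp_lower_Taylor_quadratic[OF assms] .

lemma abs_mult_exp_le:
  fixes x :: real
  shows "\<bar>x\<bar> * exp (- (x\<^sup>2)) \<le> 1 / (1 + x\<^sup>2)"
proof -
  have "1 + x\<^sup>2 + (x\<^sup>2)\<^sup>2 / 2 \<le> exp (x\<^sup>2)" by (rule exp_ge_quadratic) simp
  moreover have "2 * \<bar>x\<bar> \<le> 1 + x\<^sup>2"
    using zero_le_power2[of "1 - \<bar>x\<bar>"] by (simp add: power2_eq_square algebra_simps)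
  hence "2 * \<bar>x\<bar> * (1 + x\<^sup>2) \<le> (1 + x\<^sup>2) * (1 + x\<^sup>2)" by (intro mult_right_mono) auto
  hence "\<bar>x\<bar> * (1 + x\<^sup>2) \<le> 1 + x\<^sup>2 + (x\<^sup>2)\<^sup>2 / 2" by (simp add: power2_eq_square algebra_simps)
  ultimately have "\<bar>x\<bar> * (1 + x\<^sup>2) \<le> exp (x\<^sup>2)" by linarith
  thus ?thesis by (simp add: exp_minus field_simps add_pos_nonneg)
qed

lemma exp_minus_square_le:
  fixes a x T :: real
  assumes "a > 0" "T \<ge> 1" "T < \<bar>x\<bar>"
  shows "exp (- (a * x\<^sup>2)) \<le> 4 / (a\<^sup>2 * T\<^sup>2) * (1 / (1 + x\<^sup>2))"
proof -
  have xT: "T\<^sup>2 \<le> x\<^sup>2" using assms by (simp add: abs_le_square_iff[symmetric])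
  have "1 \<le> T\<^sup>2" using assms(2) by simp
  with xT have x1: "1 \<le> x\<^sup>2" by linarith
  have "(a * x\<^sup>2)\<^sup>2 / 2 \<le> exp (a * x\<^sup>2)" using exp_ge_quadratic[of "a * x\<^sup>2"] assms(1) x1 by (smt (verit) mult_nonneg_nonneg)
  moreover have "a\<^sup>2 * T\<^sup>2 * (1 + x\<^sup>2) \<le> a\<^sup>2 * x\<^sup>2 * (2 * x\<^sup>2)"
    using xT x1 by (intro mult_mono mult_left_mono) auto
  hence "a\<^sup>2 * T\<^sup>2 * (1 + x\<^sup>2) / 4 \<le> (a * x\<^sup>2)\<^sup>2 / 2" by (simp add: power2_eq_square algebra_simps)
  ultimately have "a\<^sup>2 * T\<^sup>2 * (1 + x\<^sup>2) / 4 \<le> exp (a * x\<^sup>2)" by linarith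
  moreover have "0 < a\<^sup>2 * T\<^sup>2 * (1 + x\<^sup>2)" using assms by (intro mult_pos_pos) (auto intro: add_pos_nonneg)
  ultimately have "inverse (exp (a * x\<^sup>2)) \<le> inverse (a\<^sup>2 * T\<^sup>2 * (1 + x\<^sup>2) / 4)"
    by (intro le_imp_inverse_le) auto
  thus ?thesis by (simp add: exp_minus field_simps)
qed

lemma cos_ge_quadratic: "cos x \<ge> 1 - x\<^sup>2 / 2" for x :: real
proof -
  have "(sin (x / 2))\<^sup>2 \<le> (x / 2)\<^sup>2"
    using abs_sin_x_le_abs_x[of "x / 2"] by (simp only: abs_le_square_iff)
  thus ?thesis using cos_double_sin[of "x / 2"] by (simp add: power_divide)
qed

context boltzmann_gas
begin

lemma char_expansion:
  assumes mean: "((\<lambda>k. real (d k) * q ^ d k / (1 - q ^ d k)) has_sum \<mu>) U"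
    and var: "((\<lambda>k. (real (d k))\<^sup>2 * q ^ d k / (1 - q ^ d k)\<^sup>2) has_sum S) U"
    and third: "((\<lambda>k. (real (d k)) ^ 3 * q ^ d k / (1 - q ^ d k) ^ 3) has_sum K) U"
  obtains e where "char U t = exp (\<i> * of_real (\<mu> * t) - of_real (S * t\<^sup>2 / 2) + e)" "norm e \<le> K * \<bar>t\<bar> ^ 3"
proof -
  let ?z = "of_real q * cis t"
  define L where "L = log_Z U ?z - log_Z U (of_real q)"
  define e where "e = L - (\<i> * of_real (\<mu> * t) - of_real (S * t\<^sup>2 / 2))"
  let ?m = "\<lambda>k. real (d k) * q ^ d k / (1 - q ^ d k)"
  let ?v = "\<lambda>k. (real (d k))\<^sup>2 * q ^ d k / (1 - q ^ d k)\<^sup>2"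
  let ?h = "\<lambda>k. (- Ln (1 - ?z ^ d k) + - (- Ln (1 - of_real q ^ d k))) +
     - (\<i> * of_real (?m k * t) + - of_real (?v k * (t\<^sup>2 / 2)))"
  have log: "((\<lambda>k. - Ln (1 - w ^ d k)) has_sum log_Z U w) U" if "norm w \<le> q" for w
    unfolding log_Z_def by (intro has_sum_infsum summable_Ln order_refl that)
  have "(?h has_sum (log_Z U ?z + - log_Z U (of_real q)) + - (\<i> * of_real (\<mu> * t) + - of_real (S * (t\<^sup>2 / 2)))) U"
    by (intro has_sum_add has_sum_uminusI has_sum_cmult_right has_sum_of_real has_sum_cmult_left
        log norm_q_cis mean var)
  moreover have "(log_Z U ?z + - log_Z U (of_real q)) + - (\<i> * of_real (\<mu> * t) + - of_real (S * (t\<^sup>2 / 2))) = e"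
    by (simp add: e_def L_def)
  ultimately have h: "(?h has_sum e) U" by (simp only:)
  have "norm e \<le> K * \<bar>t\<bar> ^ 3"
  proof (rule norm_infsum_le[OF h])
    show "((\<lambda>k. (real (d k)) ^ 3 * q ^ d k / (1 - q ^ d k) ^ 3 * \<bar>t\<bar> ^ 3) has_sum K * \<bar>t\<bar> ^ 3) U"
      by (intro has_sum_cmult_left third)
    fix k assume k: "k \<in> U"
    define p where "p = q ^ d k"
    define u where "u = real (d k) * t"
    have p: "0 < p" "p < 1" using power_bounds[OF k] by (auto simp: p_def)
    have "?h k = Ln (1 - of_real p) - Ln (1 - of_real p * cis u)
            - (\<i> * of_real (p / (1 - p) * u) - of_real (p / (1 - p)\<^sup>2 * u\<^sup>2 / 2))"
      by (simp add: p_def u_def power_mult_distrib Complex.DeMoivre mult_ac)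
    moreover have "norm (Ln (1 - of_real p) - Ln (1 - of_real p * cis u)
            - (\<i> * of_real (p / (1 - p) * u) - of_real (p / (1 - p)\<^sup>2 * u\<^sup>2 / 2))) \<le> p / (1 - p) ^ 3 * \<bar>u\<bar> ^ 3"
      by (rule Ln_geometric_taylor[OF p])
    moreover have "p / (1 - p) ^ 3 * \<bar>u\<bar> ^ 3 = (real (d k)) ^ 3 * q ^ d k / (1 - q ^ d k) ^ 3 * \<bar>t\<bar> ^ 3"
      by (simp add: p_def u_def abs_mult power_mult_distrib)
    ultimately show "norm (?h k) \<le> (real (d k)) ^ 3 * q ^ d k / (1 - q ^ d k) ^ 3 * \<bar>t\<bar> ^ 3" by simp
  qed
  moreover have "char U t = exp (\<i> * of_real (\<mu> * t) - of_real (S * t\<^sup>2 / 2) + e)"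
    by (simp add: char_def e_def L_def)
  ultimately show ?thesis using that by blast
qed

text \<open>
  On the scale \<open>\<tau> = \<sigma> t\<close>, the real part of the integrand of the Fourier inversion at the mean is at least
  half of \<open>exp (- \<tau>\<^sup>2 / 2)\<close> for \<open>|\<tau>| \<le> T\<close>. For larger \<open>|\<tau>|\<close>, it is small by the assumption on the characteristic function,
  and \<open>T = 12 / a\<close> is large enough for the central part to prevail.
\<close>
lemma prob_lower_bound:
  assumes mean: "((\<lambda>k. real (d k) * q ^ d k / (1 - q ^ d k)) has_sum of_int n) U"
    and var: "((\<lambda>k. (real (d k))\<^sup>2 * q ^ d k / (1 - q ^ d k)\<^sup>2) has_sum \<sigma>\<^sup>2) U"
    and third: "((\<lambda>k. (real (d k)) ^ 3 * q ^ d k / (1 - q ^ d k) ^ 3) has_sum K) U"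
    and \<sigma>: "\<sigma> \<ge> 1" and a: "0 < a" "a \<le> 1 / 2"
    and char: "\<And>t. \<bar>t\<bar> \<le> pi \<Longrightarrow> norm (char U t) \<le> exp (- (a * (\<sigma> * t)\<^sup>2)) + \<epsilon>"
    and K: "K * (12 / a / \<sigma>) ^ 3 \<le> 1 / 4" and \<epsilon>: "0 \<le> \<epsilon>" "2 * pi * \<epsilon> \<le> 1 / (8 * \<sigma>)"
  shows "1 / (8 * \<sigma>) \<le> 2 * pi * prob U n"
proof -
  define T where "T = 12 / a"
  have T: "T \<ge> 1" using a by (simp add: T_def le_divide_eq)
  have K0: "K \<ge> 0" by (rule has_sum_nonneg[OF third]) (use power_bounds in \<open>auto intro!: divide_nonneg_nonneg mult_nonneg_nonneg zero_le_power simp: less_imp_le\<close>)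
  define f where "f t = Re (char U t * cis (- (of_int n * t)))" for t
  define C where "C = 8 / (a\<^sup>2 * T\<^sup>2)"
  \<comment> \<open>one lower bound for all \<open>t\<close>; a multiple of the Cauchy density stands for the Gaussian tails since its integral is elementary\<close>
  define g where "g t = exp (- ((\<sigma> * t)\<^sup>2 / 2)) / 2 - C * (1 / (1 + (\<sigma> * t)\<^sup>2)) - \<epsilon>" for t
  have int_f: "(f has_integral 2 * pi * prob U n) {-pi..pi}"
    using has_integral_linear[OF integral_char[OF order_refl, of n] bounded_linear_Re]
    by (simp add: f_def[abs_def] o_def)
  have gf: "g t \<le> f t" if t: "t \<in> {-pi..pi}" for t
  proof (cases "\<bar>\<sigma> * t\<bar> \<le> T")
    case True
    obtain e where e: "char U t = exp (\<i> * of_real (of_int n * t) - of_real (\<sigma>\<^sup>2 * t\<^sup>2 / 2) + e)" "norm e \<le> K * \<bar>t\<bar> ^ 3"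
      using char_expansion[OF mean var third] by blast
    have "\<bar>t\<bar> \<le> T / \<sigma>" using True \<sigma> by (simp add: abs_mult field_simps)
    hence "K * \<bar>t\<bar> ^ 3 \<le> K * (12 / a / \<sigma>) ^ 3" using K0 by (intro mult_left_mono power_mono) (auto simp: T_def)
    hence e4: "norm e \<le> 1 / 4" using e(2) K by linarith
    have "char U t * cis (- (of_int n * t)) = exp (of_real (- ((\<sigma> * t)\<^sup>2 / 2)) + e)"
      unfolding e(1) cis_conv_exp exp_add[symmetric]
      by (rule arg_cong[where f=exp]) (simp add: power_mult_distrib)
    hence "f t = exp (Re (of_real (- ((\<sigma> * t)\<^sup>2 / 2)) + e)) * cos (Im (of_real (- ((\<sigma> * t)\<^sup>2 / 2)) + e))"
      unfolding f_def by (simp only: Re_exp)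
    hence "f t = exp (- ((\<sigma> * t)\<^sup>2 / 2)) * (exp (Re e) * cos (Im e))"
      by (simp only: plus_complex.sel Re_complex_of_real Im_complex_of_real exp_add mult.assoc add_0)
    moreover have "exp (Re e) * cos (Im e) \<ge> 1 / 2"
    proof -
      have "3 / 4 \<le> 1 + Re e" using abs_Re_le_cmod[of e] e4 by linarith
      also have "\<dots> \<le> exp (Re e)" by (rule exp_ge_add_one_self)
      finally have 1: "3 / 4 \<le> exp (Re e)" .
      have "(Im e)\<^sup>2 \<le> (1 / 4)\<^sup>2" using abs_Im_le_cmod[of e] e4 by (simp add: abs_le_square_iff[symmetric])
      hence 2: "2 / 3 \<le> cos (Im e)" using cos_ge_quadratic[of "Im e"] by (simp add: power2_eq_square)
      have "3 / 4 * (2 / 3) \<le> exp (Re e) * cos (Im e)" using 1 2 by (intro mult_mono) auto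
      thus ?thesis by simp
    qed
    hence "exp (- ((\<sigma> * t)\<^sup>2 / 2)) * (1 / 2) \<le> exp (- ((\<sigma> * t)\<^sup>2 / 2)) * (exp (Re e) * cos (Im e))"
      by (intro mult_left_mono) auto
    moreover have "0 \<le> C * (1 / (1 + (\<sigma> * t)\<^sup>2))" using a T by (auto simp: C_def intro!: mult_nonneg_nonneg)
    ultimately show ?thesis using \<epsilon>(1) unfolding g_def by linarith
  next
    case False
    let ?D = "4 / (a\<^sup>2 * T\<^sup>2) * (1 / (1 + (\<sigma> * t)\<^sup>2))"
    have "exp (- ((\<sigma> * t)\<^sup>2 / 2)) \<le> exp (- (a * (\<sigma> * t)\<^sup>2))"
      unfolding exp_le_cancel_iff neg_le_iff_le using mult_right_mono[OF a(2), of "(\<sigma> * t)\<^sup>2"] by simp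
    moreover have "exp (- (a * (\<sigma> * t)\<^sup>2)) \<le> ?D"
      using exp_minus_square_le[OF a(1) T, of "\<sigma> * t"] False by simp
    moreover have "- norm (char U t) \<le> f t"
      using abs_Re_le_cmod[of "char U t * cis (- (of_int n * t))"] by (simp add: f_def norm_mult)
    moreover have "norm (char U t) \<le> exp (- (a * (\<sigma> * t)\<^sup>2)) + \<epsilon>" using t by (intro char) auto
    moreover have "C * (1 / (1 + (\<sigma> * t)\<^sup>2)) = 2 * ?D" by (simp add: C_def)
    moreover have "exp (- ((\<sigma> * t)\<^sup>2 / 2)) \<ge> 0" by simp
    ultimately show ?thesis unfolding g_def by linarith
  qed
  have pos1: "1 + (\<sigma> * t)\<^sup>2 > 0" for t by (intro add_pos_nonneg) auto
  have cont: "continuous_on A (\<lambda>t. exp (- ((\<sigma> * t)\<^sup>2 / 2)) / 2)" "continuous_on A (\<lambda>t. 1 / (1 + (\<sigma> * t)\<^sup>2))" for A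
    using pos1 by (auto intro!: continuous_intros simp: less_imp_neq[symmetric])
  have int1: "(\<lambda>t. exp (- ((\<sigma> * t)\<^sup>2 / 2)) / 2) integrable_on {-M..M}"
            "(\<lambda>t. 1 / (1 + (\<sigma> * t)\<^sup>2)) integrable_on {-M..M}" for M
    by (rule integrable_continuous_real, rule cont)+
  have "integral {-pi..pi} g = integral {-pi..pi} (\<lambda>t. exp (- ((\<sigma> * t)\<^sup>2 / 2)) / 2)
     - C * integral {-pi..pi} (\<lambda>t. 1 / (1 + (\<sigma> * t)\<^sup>2)) - 2 * pi * \<epsilon>"
  proof (rule integral_unique)
    have "((\<lambda>t. \<epsilon>) has_integral 2 * pi * \<epsilon>) {-pi..pi}"
      using has_integral_const_real[of "\<epsilon>" "-pi" pi] by simp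
    thus "(g has_integral integral {-pi..pi} (\<lambda>t. exp (- ((\<sigma> * t)\<^sup>2 / 2)) / 2)
        - C * integral {-pi..pi} (\<lambda>t. 1 / (1 + (\<sigma> * t)\<^sup>2)) - 2 * pi * \<epsilon>) {-pi..pi}"
      unfolding g_def[abs_def] by (intro has_integral_diff has_integral_mult_right integrable_integral int1)
  qed
  moreover have "1 / (2 * \<sigma>) \<le> integral {-pi..pi} (\<lambda>t. exp (- ((\<sigma> * t)\<^sup>2 / 2)) / 2)"
  proof -
    have "1 / (2 * \<sigma>) = integral {-(1/\<sigma>)..1/\<sigma>} (\<lambda>t. 1 / 4 :: real)" using \<sigma> by simp
    also have "\<dots> \<le> integral {-(1/\<sigma>)..1/\<sigma>} (\<lambda>t. exp (- ((\<sigma> * t)\<^sup>2 / 2)) / 2)"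
    proof (rule integral_le)
      fix t assume "t \<in> {-(1/\<sigma>)..1/\<sigma>}"
      hence "\<bar>\<sigma> * t\<bar> \<le> 1" using \<sigma> by (auto simp: abs_mult field_simps abs_le_iff)
      hence "(\<sigma> * t)\<^sup>2 \<le> 1" by (simp add: abs_square_le_1)
      thus "1 / 4 \<le> exp (- ((\<sigma> * t)\<^sup>2 / 2)) / 2" using exp_ge_add_one_self[of "- ((\<sigma> * t)\<^sup>2 / 2)"] by linarith
    qed (rule integrable_const_ivl int1(1))+
    also have "\<dots> \<le> integral {-pi..pi} (\<lambda>t. exp (- ((\<sigma> * t)\<^sup>2 / 2)) / 2)"
    proof (rule integral_subset_le)
      have "1 / \<sigma> \<le> 1" using \<sigma> by simp
      thus "{-(1/\<sigma>)..1/\<sigma>} \<subseteq> {-pi..pi}" using pi_gt3 by auto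
    qed ((rule int1(1))+, simp)
    finally show ?thesis .
  qed
  moreover have "C * integral {-pi..pi} (\<lambda>t. 1 / (1 + (\<sigma> * t)\<^sup>2)) \<le> 1 / (4 * \<sigma>)"
  proof -
    have "C * integral {-pi..pi} (\<lambda>t. 1 / (1 + (\<sigma> * t)\<^sup>2)) \<le> C * (pi / \<sigma>)"
      using a T \<sigma> by (intro mult_left_mono integral_cauchy_density_le) (auto simp: C_def)
    also have "\<dots> = 1 / 18 * (pi / \<sigma>)" using a by (simp add: C_def T_def power_divide)
    also have "\<dots> \<le> 1 / 18 * (4.5 / \<sigma>)"
      using pi_less_4 \<sigma> by (intro mult_left_mono divide_right_mono) auto
    finally show ?thesis by simp
  qed
  moreover have "integral {-pi..pi} g \<le> 2 * pi * prob U n"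
  proof -
    have "g integrable_on {-pi..pi}" unfolding g_def
      by (intro integrable_diff int1 integrable_on_mult_right integrable_const_ivl)
    thus ?thesis using has_integral_le[OF integrable_integral int_f] gf by blast
  qed
  moreover have "1 / (2 * \<sigma>) = 4 * (1 / (8 * \<sigma>))" "1 / (4 * \<sigma>) = 2 * (1 / (8 * \<sigma>))" by simp_all
  ultimately show ?thesis using \<epsilon>(2) by linarith
qed

lemma integral_char_abs_le:
  assumes J: "J \<subseteq> U" and b: "b > 0"
    and char: "\<And>t. \<bar>t\<bar> \<le> pi \<Longrightarrow> norm (char J t) \<le> exp (- ((b * t)\<^sup>2)) + \<epsilon>"
    and \<epsilon>: "\<epsilon> \<ge> 0"
  shows "integral {-pi..pi} (\<lambda>t. norm (char J t) * \<bar>t\<bar>) \<le> pi / b\<^sup>2 + 2 * pi\<^sup>2 * \<epsilon>"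
proof -
  have pos1: "1 + (b * t)\<^sup>2 > 0" for t by (intro add_pos_nonneg) auto
  have int1: "(\<lambda>t. 1 / (1 + (b * t)\<^sup>2)) integrable_on {-pi..pi}"
    using pos1 by (auto intro!: integrable_continuous_real continuous_intros simp: less_imp_neq[symmetric])
  have "integral {-pi..pi} (\<lambda>t. norm (char J t) * \<bar>t\<bar>)
     \<le> integral {-pi..pi} (\<lambda>t. 1 / b * (1 / (1 + (b * t)\<^sup>2)) + pi * \<epsilon>)"
  proof (rule integral_le)
    fix t assume t: "t \<in> {-pi..pi}"
    have "norm (char J t) * \<bar>t\<bar> \<le> (exp (- ((b * t)\<^sup>2)) + \<epsilon>) * \<bar>t\<bar>"
      using t by (intro mult_right_mono char) auto
    also have "\<dots> = 1 / b * (\<bar>b * t\<bar> * exp (- ((b * t)\<^sup>2))) + \<bar>t\<bar> * \<epsilon>"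
      using b by (simp add: abs_mult field_simps)
    also have "\<dots> \<le> 1 / b * (1 / (1 + (b * t)\<^sup>2)) + pi * \<epsilon>"
      using b t \<epsilon> by (intro add_mono mult_left_mono mult_mono abs_mult_exp_le) auto
    finally show "norm (char J t) * \<bar>t\<bar> \<le> 1 / b * (1 / (1 + (b * t)\<^sup>2)) + pi * \<epsilon>" .
  next
    show "(\<lambda>t. 1 / b * (1 / (1 + (b * t)\<^sup>2)) + pi * \<epsilon>) integrable_on {-pi..pi}"
      by (intro integrable_add integrable_on_mult_right int1 integrable_const_ivl)
  qed (auto intro!: integrable_continuous_real continuous_intros continuous_char J)
  also have "\<dots> = 1 / b * integral {-pi..pi} (\<lambda>t. 1 / (1 + (b * t)\<^sup>2)) + 2 * pi * (pi * \<epsilon>)"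
  proof (rule integral_unique)
    have "((\<lambda>t. pi * \<epsilon>) has_integral 2 * pi * (pi * \<epsilon>)) {-pi..pi}"
      using has_integral_const_real[of "pi * \<epsilon>" "-pi" pi] by simp
    thus "((\<lambda>t. 1 / b * (1 / (1 + (b * t)\<^sup>2)) + pi * \<epsilon>) has_integral
        1 / b * integral {-pi..pi} (\<lambda>t. 1 / (1 + (b * t)\<^sup>2)) + 2 * pi * (pi * \<epsilon>)) {-pi..pi}"
      by (intro has_integral_add has_integral_mult_right integrable_integral int1)
  qed
  also have "\<dots> \<le> 1 / b * (pi / b) + 2 * pi * (pi * \<epsilon>)"
    using b by (intro add_mono mult_left_mono integral_cauchy_density_le) auto
  finally show ?thesis by (simp add: power2_eq_square)
qed

end

section \<open>The Boltzmann parameter\<close>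

lemma boltzmann_power:
  "exp (- (s ^ num_roots r)) ^ nat_dim r k = exp (- (s ^ num_roots r * irrep_dim r k))"
  by (simp add: irrep_dim_nat mult.commute flip: exp_of_nat_mult)

lemma scaled_dim_pos:
  assumes "s > 0" "k \<in> irreps r"
  shows "s ^ num_roots r * irrep_dim r k > 0"
  using assms nat_dim_ge_1[of k r] by (simp add: irrep_dim_nat)

text \<open>
  For \<open>j = 1\<close> and \<open>j = 2\<close> these are the mean and the variance of the contribution of \<open>k\<close> to the dimension;
  for \<open>j = 3\<close> it is the bound for the error in the expansion of the characteristic function.
\<close>
lemma moment_summand_le:
  assumes s: "s > 0" and k: "k \<in> irreps r" and j: "j \<in> {1, 2, 3}"
  defines "p \<equiv> exp (- (s ^ num_roots r)) ^ nat_dim r k"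
  shows "real (nat_dim r k) ^ j * p / (1 - p) ^ j
          \<le> 720 * exp 1 * (1 / s) ^ (j * num_roots r) * cutoff (s ^ num_roots r * irrep_dim r k)"
    and "0 \<le> real (nat_dim r k) ^ j * p / (1 - p) ^ j"
proof -
  define x where "x = s ^ num_roots r * irrep_dim r k"
  have x: "x > 0" using scaled_dim_pos[OF s k] by (simp add: x_def)
  have p: "p = exp (- x)" by (simp add: p_def x_def boltzmann_power)
  have d: "real (nat_dim r k) = (1 / s) ^ num_roots r * x"
    using s by (simp add: x_def irrep_dim_nat power_one_over)
  have "x ^ j * exp (- x) / (1 - exp (- x)) ^ j \<le> 720 * exp 1 * cutoff x"
    using j cumulant_le_cutoff[OF x] by (elim insertE emptyE) simp_all
  hence "(1 / s) ^ (j * num_roots r) * (x ^ j * exp (- x) / (1 - exp (- x)) ^ j)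
      \<le> (1 / s) ^ (j * num_roots r) * (720 * exp 1 * cutoff x)"
    using s by (intro mult_left_mono) auto
  moreover have "real (nat_dim r k) ^ j * p / (1 - p) ^ j
      = (1 / s) ^ (j * num_roots r) * (x ^ j * exp (- x) / (1 - exp (- x)) ^ j)"
    unfolding d p power_mult_distrib power_mult[symmetric] by (simp add: mult.commute)
  ultimately show "real (nat_dim r k) ^ j * p / (1 - p) ^ j
          \<le> 720 * exp 1 * (1 / s) ^ (j * num_roots r) * cutoff (s ^ num_roots r * irrep_dim r k)"
    by (simp add: x_def mult_ac)
  show "0 \<le> real (nat_dim r k) ^ j * p / (1 - p) ^ j"
    unfolding p using x by (intro divide_nonneg_nonneg mult_nonneg_nonneg) auto
qed

lemma moment_sum_le:
  assumes s: "s > 0" and F: "finite F" "F \<subseteq> irreps r" and j: "j \<in> {1, 2, 3}"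
  defines "p \<equiv> \<lambda>k. exp (- (s ^ num_roots r)) ^ nat_dim r k"
  shows "(\<Sum>k\<in>F. real (nat_dim r k) ^ j * p k / (1 - p k) ^ j)
          \<le> 720 * exp 1 * (1 / s) ^ (j * num_roots r + r) * lattice_sum r s F"
proof -
  have "(\<Sum>k\<in>F. real (nat_dim r k) ^ j * p k / (1 - p k) ^ j)
     \<le> (\<Sum>k\<in>F. 720 * exp 1 * (1 / s) ^ (j * num_roots r) * cutoff (s ^ num_roots r * irrep_dim r k))"
    unfolding p_def using F by (intro sum_mono moment_summand_le s j) auto
  also have "\<dots> = 720 * exp 1 * (1 / s) ^ (j * num_roots r) * (\<Sum>k\<in>F. cutoff (s ^ num_roots r * irrep_dim r k))"
    by (simp add: sum_distrib_left)
  also have "(\<Sum>k\<in>F. cutoff (s ^ num_roots r * irrep_dim r k)) = (1 / s) ^ r * lattice_sum r s F"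
    using s by (simp add: lattice_sum_def power_one_over flip: sum_distrib_left)
  finally show ?thesis by (simp add: power_add mult_ac)
qed

lemma summable_moment:
  assumes r: "r \<ge> 2" and s: "s > 0" and j: "j \<in> {1, 2, 3}"
  defines "p \<equiv> \<lambda>k. exp (- (s ^ num_roots r)) ^ nat_dim r k"
  shows "(\<lambda>k. real (nat_dim r k) ^ j * p k / (1 - p k) ^ j) summable_on irreps r"
    and "(\<Sum>\<^sub>\<infinity>k\<in>irreps r. real (nat_dim r k) ^ j * p k / (1 - p k) ^ j)
          \<le> 720 * exp 1 * lattice_const r * (1 / s) ^ (j * num_roots r + r)"
proof -
  have le: "(\<Sum>k\<in>F. real (nat_dim r k) ^ j * p k / (1 - p k) ^ j)
          \<le> 720 * exp 1 * lattice_const r * (1 / s) ^ (j * num_roots r + r)"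
    if F: "finite F" "F \<subseteq> irreps r" for F
  proof -
    have "(\<Sum>k\<in>F. real (nat_dim r k) ^ j * p k / (1 - p k) ^ j)
          \<le> 720 * exp 1 * (1 / s) ^ (j * num_roots r + r) * lattice_sum r s F"
      unfolding p_def by (rule moment_sum_le[OF s F j])
    also have "\<dots> \<le> 720 * exp 1 * (1 / s) ^ (j * num_roots r + r) * lattice_const r"
      using s by (intro mult_left_mono lattice_sum_bounded r F) auto
    finally show ?thesis by (simp add: mult_ac)
  qed
  show "(\<lambda>k. real (nat_dim r k) ^ j * p k / (1 - p k) ^ j) summable_on irreps r"
  proof (rule nonneg_bdd_above_summable_on)
    show "bdd_above (sum (\<lambda>k. real (nat_dim r k) ^ j * p k / (1 - p k) ^ j) ` {F. F \<subseteq> irreps r \<and> finite F})"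
      unfolding bdd_above_def using le by blast
  qed (use moment_summand_le(2)[OF s _ j] in \<open>simp add: p_def\<close>)
  thus "(\<Sum>\<^sub>\<infinity>k\<in>irreps r. real (nat_dim r k) ^ j * p k / (1 - p k) ^ j)
          \<le> 720 * exp 1 * lattice_const r * (1 / s) ^ (j * num_roots r + r)"
    using le by (rule infsum_le_finite_sums)
qed

lemma num_roots_pos: "r \<ge> 2 \<Longrightarrow> num_roots r > 0"
  using num_roots_ge[of r] by simp

lemma scale_of_parameter:
  fixes q :: real
  assumes "r \<ge> 2" "0 < q" "q < 1"
  obtains s where "s > 0" "q = exp (- (s ^ num_roots r))"
proof
  show "root (num_roots r) (- ln q) > 0" using assms num_roots_pos[of r] by (intro real_root_gt_zero) auto
  show "q = exp (- (root (num_roots r) (- ln q) ^ num_roots r))"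
    using assms num_roots_pos[of r] by (subst real_root_pow_pos2) (auto simp: ln_le_zero_iff less_imp_le)
qed

lemma boltzmann_gas_irreps:
  assumes r: "r \<ge> 2" and q: "0 < q" "q < 1"
  shows "boltzmann_gas (irreps r) (nat_dim r) q"
proof
  obtain s where s: "s > 0" "q = exp (- (s ^ num_roots r))"
    using scale_of_parameter[OF assms] .
  have "(\<lambda>k. real (nat_dim r k) ^ 1 * q ^ nat_dim r k / (1 - q ^ nat_dim r k) ^ 1) summable_on irreps r"
    unfolding s(2) by (rule summable_moment[OF r s(1)]) simp
  thus "(\<lambda>k. q ^ nat_dim r k) summable_on irreps r"
  proof (rule summable_on_comparison_test)
    fix k assume k: "k \<in> irreps r"
    define p where "p = q ^ nat_dim r k"
    have p: "0 < p" "p < 1"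
      using q nat_dim_ge_1[OF k] by (auto simp: p_def power_less_one_iff)
    have "p = 1 * p / 1" by simp
    also have "\<dots> \<le> real (nat_dim r k) ^ 1 * p / (1 - p) ^ 1"
      using p nat_dim_ge_1[OF k] by (intro frac_le mult_right_mono) auto
    finally show "q ^ nat_dim r k \<le> real (nat_dim r k) ^ 1 * q ^ nat_dim r k / (1 - q ^ nat_dim r k) ^ 1"
      by (simp add: p_def)
  qed (use q in auto)
qed (use q nat_dim_ge_1 in auto)

definition mean_summand :: "nat \<Rightarrow> real \<Rightarrow> (nat \<Rightarrow> nat) \<Rightarrow> real" where
  "mean_summand r q k = real (nat_dim r k) * q ^ nat_dim r k / (1 - q ^ nat_dim r k)"

definition mean_dim :: "nat \<Rightarrow> real \<Rightarrow> real" where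
  "mean_dim r q = infsum (mean_summand r q) (irreps r)"

lemma summable_mean:
  assumes "r \<ge> 2" "0 < q" "q < 1"
  shows "mean_summand r q summable_on irreps r"
proof -
  obtain s where s: "s > 0" "q = exp (- (s ^ num_roots r))"
    using scale_of_parameter[OF assms] .
  show ?thesis
    using summable_moment(1)[OF assms(1) s(1), of 1]
    by (simp add: mean_summand_def[abs_def] flip: s(2))
qed

lemma power_dim_bounds:
  assumes "k \<in> irreps r" "0 < q" "q < (1::real)"
  shows "0 < q ^ nat_dim r k" "q ^ nat_dim r k < 1"
  using assms nat_dim_ge_1[of k r] by (auto simp: power_less_one_iff)

lemma mean_summand_strict_mono:
  assumes k: "k \<in> irreps r" and q: "0 < q" "q < q'" "q' < 1"
  shows "mean_summand r q k < mean_summand r q' k"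
proof -
  have d: "nat_dim r k \<ge> 1" by (rule nat_dim_ge_1[OF k])
  have "q ^ nat_dim r k < q' ^ nat_dim r k" using q d by (intro power_strict_mono) auto
  moreover have "q' ^ nat_dim r k < 1" using power_dim_bounds[OF k, of q'] q by auto
  ultimately show ?thesis
    using d q unfolding mean_summand_def by (intro frac_less mult_strict_left_mono) auto
qed

lemma mean_summand_nonneg:
  assumes k: "k \<in> irreps r" and q: "0 < q" "q < 1"
  shows "0 \<le> mean_summand r q k"
  using power_dim_bounds[OF assms] by (simp add: mean_summand_def)

lemma unit_in_irreps: "restrict (\<lambda>_. 1) {1..r} \<in> irreps r"
  by (simp add: irreps_def)

lemma nat_dim_unit: "nat_dim r (restrict (\<lambda>_. 1) {1..r}) = 1"
proof -
  have "irrep_dim r (restrict (\<lambda>_. 1) {1..r}) = irrep_dim r (\<lambda>_. 1)"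
    by (rule irrep_dim_cong) auto
  also have "\<dots> = 1"
    using root_prod_const[of r 1] superfact_pos[of r] by (simp add: irrep_dim_root_prod)
  finally show ?thesis by (simp add: irrep_dim_nat)
qed

lemma mean_dim_strict_mono:
  assumes r: "r \<ge> 2" and q: "0 < q" "q < q'" "q' < 1"
  shows "mean_dim r q < mean_dim r q'"
  unfolding mean_dim_def
proof (rule has_sum_strict_mono[OF has_sum_infsum has_sum_infsum])
  show "mean_summand r q summable_on irreps r" "mean_summand r q' summable_on irreps r"
    using summable_mean[OF r] q by auto
  show "mean_summand r q k \<le> mean_summand r q' k" if "k \<in> irreps r" for k
    using mean_summand_strict_mono[OF that q] by simp
  show "mean_summand r q (restrict (\<lambda>_. 1) {1..r}) < mean_summand r q' (restrict (\<lambda>_. 1) {1..r})"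
    by (rule mean_summand_strict_mono[OF unit_in_irreps q])
qed (rule unit_in_irreps)

lemma continuous_mean_dim:
  assumes r: "r \<ge> 2" and b: "0 < a" "b < 1"
  shows "continuous_on {a..b} (mean_dim r)"
proof (cases "a \<le> b")
  case True
  have "uniform_limit {a..b} (\<lambda>X q. \<Sum>k\<in>X. mean_summand r q k) (\<lambda>q. \<Sum>\<^sub>\<infinity>k\<in>irreps r. mean_summand r q k)
          (finite_subsets_at_top (irreps r))"
  proof (rule Weierstrass_m_test_general)
    show "mean_summand r b summable_on irreps r" using summable_mean[OF r] b True by auto
    fix k q assume k: "k \<in> irreps r" and q: "q \<in> {a..b}"
    have "mean_summand r q k \<le> mean_summand r b k"
      using mean_summand_strict_mono[OF k, of q b] q b by (cases "q = b") auto
    thus "norm (mean_summand r q k) \<le> mean_summand r b k"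
      using mean_summand_nonneg[OF k, of q] q b by auto
  qed
  moreover have "continuous_on {a..b} (\<lambda>q. \<Sum>k\<in>X. mean_summand r q k)" if "X \<subseteq> irreps r" for X
    unfolding mean_summand_def
  proof (intro continuous_intros ballI)
    fix k q assume "k \<in> X" "q \<in> {a..b}"
    thus "1 - q ^ nat_dim r k \<noteq> 0" using power_dim_bounds(2)[of k r q] that b by force
  qed
  ultimately show ?thesis
    unfolding mean_dim_def[abs_def]
    by (intro uniform_limit_theorem) (auto intro!: eventually_finite_subsets_at_top_weakI)
qed auto

text \<open>
  The mean tends to \<open>0\<close> for \<open>q \<longlonglongrightarrow> 0\<close>, because every dimension is at least \<open>1\<close>, and the trivial representation
  alone makes it at least \<open>q / (1 - q)\<close>.
\<close>
lemma mean_dim_attains: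
  assumes r: "r \<ge> 2" and n: "n \<ge> 1"
  obtains q where "0 < q" "q < 1" "mean_dim r q = real n"
proof -
  define u where "u = restrict (\<lambda>_. 1 :: nat) {1..r}"
  \<comment> \<open>at \<open>b\<close> the trivial representation alone contributes \<open>n\<close>; at \<open>a\<close> the mean is at most \<open>2 * a * A \<le> 1\<close>\<close>
  define b where "b = real n / (real n + 1)"
  define A where "A = mean_dim r (1 / 2)"
  define a where "a = min (1 / 2) (1 / (2 * A + 1))"
  have b: "1 / 2 \<le> b" "b < 1" using n by (auto simp: b_def field_simps)
  have A0: "A \<ge> 0" unfolding A_def mean_dim_def by (intro infsum_nonneg mean_summand_nonneg) auto
  have a: "0 < a" "a \<le> 1 / 2" using A0 by (auto simp: a_def)
  have "mean_dim r a \<le> 2 * a * A"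
  proof -
    have "mean_summand r a k \<le> 2 * a * mean_summand r (1 / 2) k" if k: "k \<in> irreps r" for k
    proof -
      obtain m where m: "nat_dim r k = Suc m" using nat_dim_ge_1[OF k] by (cases "nat_dim r k") auto
      have "a ^ nat_dim r k \<le> 2 * a * (1 / 2) ^ nat_dim r k"
        using power_mono[of a "1 / 2" m] a by (simp add: m mult_left_mono)
      moreover have "a ^ nat_dim r k \<le> (1 / 2) ^ nat_dim r k" using a by (intro power_mono) auto
      moreover have "(1 / 2 :: real) ^ nat_dim r k < 1" using power_dim_bounds[OF k, of "1 / 2"] by simp
      ultimately have "real (nat_dim r k) * a ^ nat_dim r k / (1 - a ^ nat_dim r k)
         \<le> real (nat_dim r k) * (2 * a * (1 / 2) ^ nat_dim r k) / (1 - (1 / 2) ^ nat_dim r k)"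
        using a by (intro frac_le mult_left_mono) auto
      thus ?thesis by (simp add: mean_summand_def mult_ac)
    qed
    hence "mean_dim r a \<le> (\<Sum>\<^sub>\<infinity>k\<in>irreps r. 2 * a * mean_summand r (1 / 2) k)"
      unfolding mean_dim_def using a
      by (intro infsum_mono summable_mean r summable_on_cmult_right) auto
    also have "\<dots> = 2 * a * A" unfolding A_def mean_dim_def by (rule infsum_cmult_right')
    finally show ?thesis .
  qed
  also have "2 * a * A \<le> 1"
  proof -
    have "a * (2 * A) \<le> 1 / (2 * A + 1) * (2 * A)" using A0 by (intro mult_right_mono) (auto simp: a_def)
    also have "\<dots> \<le> 1" using A0 by (simp add: divide_le_eq)
    finally show ?thesis by simp
  qed
  finally have lower: "mean_dim r a \<le> real n" using n by linarith
  have u1: "nat_dim r u = 1" unfolding u_def by (rule nat_dim_unit)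
  have "real n = mean_summand r b u"
    using n by (simp add: mean_summand_def u1 b_def field_simps)
  also have "\<dots> = (\<Sum>k\<in>{u}. mean_summand r b k)" by simp
  also have "\<dots> \<le> mean_dim r b"
    unfolding mean_dim_def using b unit_in_irreps[of r]
    by (intro finite_sum_le_infsum summable_mean r mean_summand_nonneg) (auto simp: u_def)
  finally have upper: "real n \<le> mean_dim r b" .
  obtain q where q: "a \<le> q" "q \<le> b" "mean_dim r q = real n"
    using IVT'[OF lower upper _ continuous_mean_dim[OF r a(1) b(2)]] a b by auto
  show ?thesis
  proof (rule that)
    show "0 < q" "q < 1" using q(1,2) a b by linarith+
  qed (rule q(3))
qed

lemma irrep_dim_powr:
  "0 < q \<Longrightarrow> irrep_dim r k * q powr irrep_dim r k / (1 - q powr irrep_dim r k) = mean_summand r q k"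
  by (simp add: irrep_dim_nat mean_summand_def powr_realpow)

lemma q_param_works:
  assumes r: "r \<ge> 2" and n: "n \<ge> 1"
  shows "0 < q_param r n" "q_param r n < 1" "(mean_summand r (q_param r n) has_sum real n) (irreps r)"
proof -
  let ?P = "\<lambda>q. 0 < q \<and> q < 1 \<and>
     ((\<lambda>k. irrep_dim r k * q powr irrep_dim r k / (1 - q powr irrep_dim r k))
        has_sum real n) (irreps r)"
  have P: "?P q \<longleftrightarrow> 0 < q \<and> q < 1 \<and> mean_dim r q = real n" for q
  proof (cases "0 < q \<and> q < 1")
    case True
    hence "(mean_summand r q has_sum mean_dim r q) (irreps r)"
      unfolding mean_dim_def by (intro has_sum_infsum summable_mean r) auto
    thus ?thesis using True by (auto simp: irrep_dim_powr dest: has_sum_unique)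
  qed auto
  have "\<exists>!q. ?P q"
  proof (rule ex_ex1I)
    show "\<exists>q. ?P q" unfolding P using mean_dim_attains[OF r n] by metis
    show "q = q'" if "?P q" "?P q'" for q q'
      using that mean_dim_strict_mono[OF r, of q q'] mean_dim_strict_mono[OF r, of q' q]
      unfolding P by (cases q q' rule: linorder_cases) auto
  qed
  from theI'[OF this] have "?P (q_param r n)" unfolding q_param_def .
  thus "0 < q_param r n" "q_param r n < 1" "(mean_summand r (q_param r n) has_sum real n) (irreps r)"
    using irrep_dim_powr[of "q_param r n" r] by auto
qed

lemma s_param_works:
  assumes r: "r \<ge> 2" and n: "n \<ge> 1"
  shows "s_param r n > 0" "q_param r n = exp (- (s_param r n ^ num_roots r))"
proof -
  let ?P = "\<lambda>s. 0 < s \<and> q_param r n = exp (- (s ^ num_roots r))"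
  have "\<exists>!s. ?P s"
  proof (rule ex_ex1I)
    show "\<exists>s. ?P s"
      using scale_of_parameter[OF r q_param_works(1,2)[OF assms]] by metis
    show "s = s'" if "?P s" "?P s'" for s s'
    proof -
      have "s ^ num_roots r = s' ^ num_roots r" using that by simp
      thus ?thesis using that num_roots_pos[OF r] by (metis less_imp_le power_eq_imp_eq_base)
    qed
  qed
  from theI'[OF this] show "s_param r n > 0" "q_param r n = exp (- (s_param r n ^ num_roots r))"
    unfolding s_param_def num_roots_def by auto
qed

text \<open>
  The mean dimension is bounded as long as \<open>s\<close> stays away from \<open>0\<close>.
\<close>
lemma s_param_tendsto_0:
  assumes r: "r \<ge> 2"
  shows "s_param r \<longlonglongrightarrow> 0"
proof (rule tendstoI)
  fix e :: real assume e: "e > 0"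
  define q0 where "q0 = exp (- (e ^ num_roots r))"
  have q0: "0 < q0" "q0 < 1" using e by (auto simp: q0_def)
  have "dist (s_param r n) 0 < e" if n: "n \<ge> max 1 (nat (floor (mean_dim r q0) + 1))" for n
  proof (rule ccontr)
    have n1: "n \<ge> 1" using n by simp
    note s = s_param_works[OF r n1] and q = q_param_works[OF r n1]
    assume "\<not> dist (s_param r n) 0 < e"
    hence "e \<le> s_param r n" using s by simp
    hence "q_param r n \<le> q0"
      unfolding s(2) q0_def using e by (simp add: power_mono)
    hence "mean_dim r (q_param r n) \<le> mean_dim r q0"
      using mean_dim_strict_mono[OF r q(1) _ q0(2)] by (cases "q_param r n = q0") auto
    moreover have "mean_dim r (q_param r n) = real n"
      unfolding mean_dim_def using q(3) by (rule infsumI)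
    ultimately show False using n by linarith
  qed
  thus "eventually (\<lambda>n. dist (s_param r n) 0 < e) sequentially"
    unfolding eventually_sequentially by blast
qed

section \<open>Bounds for the characteristic function\<close>

abbreviation gas_param :: "nat \<Rightarrow> real \<Rightarrow> real" where
  "gas_param r s \<equiv> exp (- (s ^ num_roots r))"

abbreviation gas_char :: "nat \<Rightarrow> real \<Rightarrow> (nat \<Rightarrow> nat) set \<Rightarrow> real \<Rightarrow> complex" where
  "gas_char r s \<equiv> boltzmann_gas.char (nat_dim r) (gas_param r s)"

lemma gas_interpretation:
  "r \<ge> 2 \<Longrightarrow> s > 0 \<Longrightarrow> boltzmann_gas (irreps r) (nat_dim r) (gas_param r s)"
  by (rule boltzmann_gas_irreps) auto

lemma sin_square_ge:
  fixes y :: real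
  assumes "\<bar>y\<bar> \<le> pi / 2"
  shows "y\<^sup>2 / 4 \<le> (sin y)\<^sup>2"
proof -
  have "\<bar>sin y - (\<Sum>m<3. sin_coeff m * y ^ m)\<bar> \<le> inverse (fact 3) * \<bar>y\<bar> ^ 3"
    by (rule Maclaurin_sin_bound)
  hence 1: "\<bar>sin y - y\<bar> \<le> \<bar>y\<bar> * (y\<^sup>2 / 6)"
    by (simp add: sin_coeff_def eval_nat_numeral fact_numeral power2_eq_square abs_mult)
  have "y\<^sup>2 \<le> 1.6\<^sup>2"
    using assms pi_approx by (intro abs_le_square_iff[THEN iffD1]) auto
  hence "\<bar>y\<bar> * (y\<^sup>2 / 6) \<le> \<bar>y\<bar> * (1 / 2)" by (intro mult_left_mono) (auto simp: power2_eq_square)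
  hence "\<bar>y / 2\<bar> \<le> \<bar>sin y\<bar>" using 1 by linarith
  hence "(y / 2)\<^sup>2 \<le> (sin y)\<^sup>2" by (simp only: abs_le_square_iff)
  thus ?thesis by (simp add: power_divide)
qed

lemma sin_square_ge_of_not_near:
  assumes far: "\<not> near \<eta> x" and \<eta>: "0 < \<eta>" "\<eta> \<le> 1 / 2"
  shows "(sin (pi * x))\<^sup>2 \<ge> \<eta>\<^sup>2"
proof -
  define z where "z = round x"
  define y where "y = x - of_int z"
  have y: "\<bar>y\<bar> \<le> 1 / 2" using of_int_round_abs_le[of x] by (simp add: y_def z_def abs_minus_commute)
  have "\<eta> < \<bar>y\<bar>" using far by (auto simp: near_def y_def not_le)
  have "sin (pi * x) = sin (pi * y + of_int z * pi)" by (simp add: y_def algebra_simps)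
  hence "(sin (pi * x))\<^sup>2 = (sin (pi * y))\<^sup>2 * (cos (of_int z * pi))\<^sup>2"
    using sin_zero_iff_int2[of "of_int z * pi"] by (simp add: sin_add power_mult_distrib)
  also have "(cos (of_int z * pi))\<^sup>2 = 1"
    unfolding cos_squared_eq using sin_zero_iff_int2[of "of_int z * pi"] by simp
  finally have eq: "(sin (pi * x))\<^sup>2 = (sin (pi * y))\<^sup>2" by simp
  have "\<bar>pi * y\<bar> \<le> pi / 2" using y by (simp add: abs_mult)
  from sin_square_ge[OF this] have 1: "(pi * y)\<^sup>2 / 4 \<le> (sin (pi * y))\<^sup>2" .
  have "\<eta>\<^sup>2 \<le> y\<^sup>2" using \<open>\<eta> < \<bar>y\<bar>\<close> \<eta> by (simp add: abs_le_square_iff[symmetric])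
  also have "\<dots> = 2\<^sup>2 * y\<^sup>2 / 4" by simp
  also have "\<dots> \<le> pi\<^sup>2 * y\<^sup>2 / 4" using pi_gt3 by (intro divide_right_mono mult_right_mono power_mono) auto
  finally show ?thesis using 1 unfolding eq by (simp add: power_mult_distrib)
qed

text \<open>
  On the box with entries between this number and its double, \<open>s ^ num_roots r * irrep_dim r k\<close> is bounded and bounded away from \<open>0\<close>.
\<close>
definition box_size :: "real \<Rightarrow> nat" where
  "box_size s = nat \<lfloor>1 / s\<rfloor>"

definition box_weight_min :: "nat \<Rightarrow> real" where
  "box_weight_min r = exp (- (2 ^ num_roots r))"

lemma box_size_bounds:
  assumes "0 < s" "s \<le> 1 / 2"
  shows "s * real (box_size s) \<le> 1" "1 / 2 \<le> s * real (box_size s)" "1 \<le> box_size s"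
proof -
  have "1 / s \<ge> 2" using assms by (simp add: le_divide_eq)
  hence M: "real (box_size s) \<le> 1 / s" "1 / s < real (box_size s) + 1"
    unfolding box_size_def by linarith+
  thus "s * real (box_size s) \<le> 1" using assms by (simp add: field_simps)
  have "1 < s * real (box_size s) + s" using M(2) assms by (simp add: field_simps)
  thus "1 / 2 \<le> s * real (box_size s)" using assms by linarith
  show "1 \<le> box_size s" using M \<open>1 / s \<ge> 2\<close> by linarith
qed

lemma index_box_dims:
  assumes s: "0 < s" "s \<le> 1 / 2" and k: "k \<in> index_box r (box_size s)"
  defines "p \<equiv> gas_param r s ^ nat_dim r k"
  shows "real (box_size s) ^ num_roots r \<le> real (nat_dim r k)"
    and "real (nat_dim r k) \<le> (2 * real (box_size s)) ^ num_roots r"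
    and "box_weight_min r \<le> p / (1 - p)\<^sup>2"
proof -
  let ?M = "box_size s"
  have kM: "?M \<le> k i" "k i \<le> 2 * ?M" if "i \<in> {1..r}" for i
  proof -
    have "k i \<in> {?M..<2 * ?M}" using k that unfolding index_box_def by (rule PiE_mem)
    thus "?M \<le> k i" "k i \<le> 2 * ?M" by auto
  qed
  show 1: "real ?M ^ num_roots r \<le> real (nat_dim r k)"
    using irrep_dim_ge[of r ?M k] kM by (simp add: irrep_dim_nat)
  show 2: "real (nat_dim r k) \<le> (2 * real ?M) ^ num_roots r"
    using irrep_dim_le[of r k "2 * ?M"] kM by (simp add: irrep_dim_nat)
  have "s ^ num_roots r * real (nat_dim r k) \<le> s ^ num_roots r * (2 * real ?M) ^ num_roots r"
    using 2 s by (intro mult_left_mono) auto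
  also have "\<dots> = (2 * (s * real ?M)) ^ num_roots r" by (simp add: power_mult_distrib mult_ac)
  also have "\<dots> \<le> 2 ^ num_roots r" using box_size_bounds[OF s] s by (intro power_mono) auto
  finally have p1: "box_weight_min r \<le> p"
    by (simp add: p_def boltzmann_power irrep_dim_nat box_weight_min_def)
  have "0 < real ?M ^ num_roots r" using box_size_bounds(3)[OF s] by simp
  hence "0 < real (nat_dim r k)" using 1 by linarith
  hence "s ^ num_roots r * real (nat_dim r k) > 0" using s by (intro mult_pos_pos) auto
  hence p2: "p < 1" "0 < p" by (auto simp: p_def boltzmann_power irrep_dim_nat)
  have "(1 - p)\<^sup>2 \<le> 1" using p2 by (simp add: power_le_one)
  hence "p / 1 \<le> p / (1 - p)\<^sup>2" using p2 by (intro divide_left_mono) auto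
  thus "box_weight_min r \<le> p / (1 - p)\<^sup>2" using p1 by simp
qed

lemma box_weight_min_pos: "0 < box_weight_min r" "box_weight_min r \<le> 1"
  by (auto simp: box_weight_min_def)

text \<open>
  This serves in two ways: it bounds the whole variance from below, and it shows that a set of small variance
  covers only a small part of the box.
\<close>
lemma card_box_le_variance:
  assumes s: "0 < s" "s \<le> 1 / 2" and F: "F \<subseteq> index_box r (box_size s)"
  defines "p \<equiv> \<lambda>k. gas_param r s ^ nat_dim r k"
  shows "real (card F) * (real (box_size s) ^ (2 * num_roots r) * box_weight_min r)
       \<le> (\<Sum>k\<in>F. (real (nat_dim r k))\<^sup>2 * p k / (1 - p k)\<^sup>2)"
proof -
  have "(\<Sum>k\<in>F. real (box_size s) ^ (2 * num_roots r) * box_weight_min r)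
     \<le> (\<Sum>k\<in>F. (real (nat_dim r k))\<^sup>2 * (p k / (1 - p k)\<^sup>2))"
  proof (intro sum_mono mult_mono)
    fix k assume "k \<in> F"
    hence k: "k \<in> index_box r (box_size s)" using F by auto
    show "real (box_size s) ^ (2 * num_roots r) \<le> (real (nat_dim r k))\<^sup>2"
      using index_box_dims(1)[OF s k] by (simp add: power_mult mult.commute[of 2] power_mono)
    show "box_weight_min r \<le> p k / (1 - p k)\<^sup>2"
      unfolding p_def by (rule index_box_dims(3)[OF s k])
  qed (use box_weight_min_pos in \<open>auto simp: less_imp_le\<close>)
  thus ?thesis by simp
qed

lemma ln_one_plus_ge:
  fixes v :: real
  assumes "0 \<le> v" "v \<le> 3"
  shows "v / 4 \<le> ln (1 + v)"
proof -
  have "ln (1 / (1 + v)) \<le> 1 / (1 + v) - 1" using assms by (intro ln_le_minus_one) auto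
  hence "v / (1 + v) \<le> ln (1 + v)" using assms by (simp add: ln_div field_simps)
  moreover have "v / 4 \<le> v / (1 + v)" using assms by (intro divide_left_mono) auto
  ultimately show ?thesis by linarith
qed

lemma char_le_of_spread:
  assumes r: "r \<ge> 2" and s: "s > 0" and J: "J \<subseteq> irreps r" and F: "finite F" "F \<subseteq> J"
    and v: "0 \<le> v" "v \<le> 3" "\<And>k. k \<in> F \<Longrightarrow> v \<le> boltzmann_gas.spread (nat_dim r) (gas_param r s) k t"
    and card: "c \<le> real (card F)" "c \<ge> 0"
  shows "norm (gas_char r s J t) \<le> exp (- (c * v / 8))"
proof -
  interpret boltzmann_gas "irreps r" "nat_dim r" "gas_param r s"
    by (rule gas_interpretation[OF r s])
  have "c * (v / 4) \<le> real (card F) * (v / 4)" using card v by (intro mult_right_mono) auto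
  also have "\<dots> = (\<Sum>k\<in>F. v / 4)" by simp
  also have "\<dots> \<le> (\<Sum>k\<in>F. ln (1 + spread k t))"
  proof (rule sum_mono)
    fix k assume "k \<in> F"
    have "v / 4 \<le> ln (1 + v)" using v by (intro ln_one_plus_ge)
    also have "\<dots> \<le> ln (1 + spread k t)"
      using v(1) v(3)[OF \<open>k \<in> F\<close>] by simp
    finally show "v / 4 \<le> ln (1 + spread k t)" .
  qed
  finally have "(norm (char J t))\<^sup>2 \<le> exp (- (c * v / 4))"
    using norm_char_le[OF J F, of t] by (smt (verit) exp_le_cancel_iff times_divide_eq_right)
  also have "\<dots> = (exp (- (c * v / 8)))\<^sup>2" by (simp flip: exp_double)
  finally show ?thesis by (rule power2_le_imp_le) simp
qed

text \<open>
  If a positive proportion of the box is bad for \<open>t / (2 \<pi>)\<close>, then many factors of the characteristic function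
  are bounded away from \<open>1\<close>, which gives the second term. Otherwise the arguments of the sines lie in
  \<open>[- \<pi> / 2, \<pi> / 2]\<close> on the whole box, and each factor is at most Gaussian, which gives the first term. In both cases
  the set \<open>J\<close> misses so little of the box that enough factors remain.
\<close>
lemma char_bound:
  assumes r: "r \<ge> 2"
  obtains c1 c2 \<kappa> s0 :: real where "0 < c1" "0 < c2" "0 < \<kappa>" "0 < s0" "s0 \<le> 1 / 2"
    "\<And>s J t. 0 < s \<Longrightarrow> s \<le> s0 \<Longrightarrow> J \<subseteq> irreps r
      \<Longrightarrow> real (card (index_box r (box_size s) - J)) \<le> \<kappa> * real (box_size s) ^ r \<Longrightarrow> \<bar>t\<bar> \<le> pi
      \<Longrightarrow> norm (gas_char r s J t) \<le> exp (- (c1 * (1 / s) ^ (2 * num_roots r + r) * t\<^sup>2)) + exp (- (c2 * (1 / s) ^ r))"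
proof -
  define R where "R = num_roots r"
  obtain \<kappa>0 \<eta>0 M0 where far: "\<kappa>0 > 0" "\<eta>0 > 0"
    "\<And>M \<theta>. M \<ge> M0 \<Longrightarrow> \<bar>\<theta>\<bar> \<le> 1 / 2 \<Longrightarrow> real (card (bad_indices r M \<eta>0 \<theta>)) < \<kappa>0 * real M ^ r
        \<Longrightarrow> \<bar>\<theta>\<bar> * (2 * real M) ^ num_roots r \<le> 1 / 2"
    using far_from_integers[OF r] by metis
  define \<eta> where "\<eta> = min \<eta>0 (1 / 2)"
  define \<kappa> where "\<kappa> = min (\<kappa>0 / 2) (1 / 2)"
  define w where "w = box_weight_min r"
  have w: "0 < w" "w \<le> 1" using box_weight_min_pos by (auto simp: w_def)
  have \<eta>: "0 < \<eta>" "\<eta> \<le> 1 / 2" "\<eta> \<le> \<eta>0" using far by (auto simp: \<eta>_def)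
  have \<kappa>: "0 < \<kappa>" "\<kappa> \<le> \<kappa>0 / 2" "\<kappa> \<le> 1 / 2" using far by (auto simp: \<kappa>_def)
  define c1 where "c1 = w / 64 * (1 / 2) ^ (2 * R + r)"
  define c2 where "c2 = \<kappa>0 / 2 * (4 * w * \<eta>\<^sup>2) / 8 * (1 / 2) ^ r"
  define s0 where "s0 = 1 / (real M0 + 2)"
  have s0: "0 < s0" "s0 \<le> 1 / 2" by (auto simp: s0_def field_simps)
  show ?thesis
  proof (rule that[of c1 c2 \<kappa> s0])
    show "0 < c1" "0 < c2" "0 < \<kappa>" "0 < s0" "s0 \<le> 1 / 2"
      using w far \<eta> \<kappa> s0 by (auto simp: c1_def c2_def)
    fix s J t
    assume s: "0 < s" "s \<le> s0" and J: "J \<subseteq> irreps r"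
      and cov: "real (card (index_box r (box_size s) - J)) \<le> \<kappa> * real (box_size s) ^ r" and t: "\<bar>t\<bar> \<le> pi"
    interpret boltzmann_gas "irreps r" "nat_dim r" "gas_param r s"
      by (rule gas_interpretation[OF r s(1)])
    have s2: "s \<le> 1 / 2" using s s0 by linarith
    define M where "M = box_size s"
    note sM = box_size_bounds[OF s(1) s2, folded M_def]
    have M12: "(1 / 2 * (1 / s)) ^ m \<le> real M ^ m" for m
      using sM(2) s(1) by (intro power_mono) (auto simp: field_simps)
    have MM0: "M \<ge> M0"
    proof -
      have "real M0 + 2 \<le> 1 / s" using s s0 by (simp add: s0_def field_simps)
      thus ?thesis unfolding M_def box_size_def by linarith
    qed
    define \<theta> where "\<theta> = t / (2 * pi)"
    have \<theta>: "\<bar>\<theta>\<bar> \<le> 1 / 2" using t by (simp add: \<theta>_def field_simps)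
    have ang: "real (nat_dim r k) * t / 2 = pi * (irrep_dim r k * \<theta>)" for k
      by (simp add: \<theta>_def irrep_dim_nat)
    have spread: "4 * w * (sin (pi * (irrep_dim r k * \<theta>)))\<^sup>2 \<le> spread k t"
      if k: "k \<in> index_box r M" for k
    proof -
      have "w * (4 * (sin (pi * (irrep_dim r k * \<theta>)))\<^sup>2) \<le>
         gas_param r s ^ nat_dim r k / (1 - gas_param r s ^ nat_dim r k)\<^sup>2 * (4 * (sin (pi * (irrep_dim r k * \<theta>)))\<^sup>2)"
        unfolding w_def using k by (intro mult_right_mono index_box_dims(3)[OF s(1) s2]) (auto simp: M_def)
      thus ?thesis unfolding spread_def ang by (simp add: mult_ac)
    qed
    show "norm (char J t) \<le> exp (- (c1 * (1 / s) ^ (2 * num_roots r + r) * t\<^sup>2)) + exp (- (c2 * (1 / s) ^ r))"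
    proof (cases "real (card (bad_indices r M \<eta> \<theta>)) < \<kappa>0 * real M ^ r")
      case False
      define F where "F = bad_indices r M \<eta> \<theta> \<inter> J"
      have fin: "finite (bad_indices r M \<eta> \<theta>)" by (simp add: bad_indices_def)
      have "card (bad_indices r M \<eta> \<theta>) \<le> card (F \<union> (index_box r M - J))"
        using fin by (intro card_mono) (auto simp: F_def bad_indices_def)
      also have "\<dots> \<le> card F + card (index_box r M - J)" by (rule card_Un_le)
      finally have "real (card (bad_indices r M \<eta> \<theta>)) \<le> real (card F) + \<kappa> * real M ^ r"
        using cov by (simp add: M_def)
      moreover have "\<kappa> * real M ^ r \<le> \<kappa>0 / 2 * real M ^ r" using \<kappa> by (intro mult_right_mono) auto
      ultimately have cF: "\<kappa>0 / 2 * real M ^ r \<le> real (card F)" using False by (simp add: field_simps)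
      have "norm (char J t) \<le> exp (- (\<kappa>0 / 2 * real M ^ r * (4 * w * \<eta>\<^sup>2) / 8))"
      proof (rule char_le_of_spread[OF r s(1) J _ _ _ _ _ cF])
        show "finite F" "F \<subseteq> J" using fin by (auto simp: F_def)
        show "0 \<le> \<kappa>0 / 2 * real M ^ r" using far by simp
        show "0 \<le> 4 * w * \<eta>\<^sup>2" using w by simp
        have "\<eta>\<^sup>2 \<le> (1 / 2)\<^sup>2" using \<eta> by (intro power_mono) auto
        hence "4 * w * \<eta>\<^sup>2 \<le> 4 * 1 * (1 / 2)\<^sup>2" using w by (intro mult_mono) auto
        thus "4 * w * \<eta>\<^sup>2 \<le> 3" by (simp add: power2_eq_square)
        fix k assume "k \<in> F"
        hence k: "k \<in> index_box r M" "\<not> near \<eta> (irrep_dim r k * \<theta>)" by (auto simp: F_def bad_indices_def)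
        have "4 * w * \<eta>\<^sup>2 \<le> 4 * w * (sin (pi * (irrep_dim r k * \<theta>)))\<^sup>2"
          using w \<eta> by (intro mult_left_mono sin_square_ge_of_not_near k) auto
        thus "4 * w * \<eta>\<^sup>2 \<le> spread k t" using spread[OF k(1)] by linarith
      qed
      also have "\<dots> \<le> exp (- (c2 * (1 / s) ^ r))"
      proof -
        have "\<kappa>0 / 2 * (4 * w * \<eta>\<^sup>2) / 8 * (1 / 2 * (1 / s)) ^ r \<le> \<kappa>0 / 2 * (4 * w * \<eta>\<^sup>2) / 8 * real M ^ r"
          using far w by (intro mult_left_mono M12) auto
        thus ?thesis unfolding c2_def by (simp add: power_mult_distrib power_divide mult_ac)
      qed
      finally show ?thesis by (simp add: add_increasing)
    next
      case True
      have "bad_indices r M \<eta>0 \<theta> \<subseteq> bad_indices r M \<eta> \<theta>"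
        using \<eta>(3) unfolding bad_indices_def near_def by (blast intro: order_trans)
      hence "card (bad_indices r M \<eta>0 \<theta>) \<le> card (bad_indices r M \<eta> \<theta>)"
        by (intro card_mono) (auto simp: bad_indices_def)
      hence small: "\<bar>\<theta>\<bar> * (2 * real M) ^ num_roots r \<le> 1 / 2"
        using True by (intro far(3)[OF MM0 \<theta>]) linarith
      define F where "F = index_box r M \<inter> J"
      define v where "v = w * (real M ^ R * t)\<^sup>2 / 4"
      have "real M ^ r = real (card (index_box r M))" by (simp add: card_index_box)
      also have "card (index_box r M) \<le> card (F \<union> (index_box r M - J))"
        by (intro card_mono) (auto simp: F_def)
      also have "\<dots> \<le> card F + card (index_box r M - J)" by (rule card_Un_le)
      finally have "real M ^ r \<le> real (card F) + \<kappa> * real M ^ r"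
        using cov by (simp add: M_def)
      moreover have "\<kappa> * real M ^ r \<le> 1 / 2 * real M ^ r" using \<kappa> by (intro mult_right_mono) auto
      ultimately have cF: "1 / 2 * real M ^ r \<le> real (card F)" by linarith
      have angle: "\<bar>real (nat_dim r k) * t / 2\<bar> \<le> pi / 2" if k: "k \<in> index_box r M" for k
      proof -
        have "\<bar>irrep_dim r k * \<theta>\<bar> \<le> (2 * real M) ^ num_roots r * \<bar>\<theta>\<bar>"
          using index_box_dims(2)[OF s(1) s2, of k r] k
          unfolding M_def irrep_dim_nat abs_mult by (intro mult_right_mono) auto
        hence "\<bar>irrep_dim r k * \<theta>\<bar> \<le> 1 / 2" using small by (simp add: mult.commute)
        hence "pi * \<bar>irrep_dim r k * \<theta>\<bar> \<le> pi * (1 / 2)" by (intro mult_left_mono) auto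
        thus ?thesis unfolding ang by (simp add: abs_mult)
      qed
      have v_le: "v \<le> w * (real (nat_dim r k) * t)\<^sup>2 / 4" if k: "k \<in> index_box r M" for k
      proof -
        have "\<bar>real M ^ R * t\<bar> \<le> \<bar>real (nat_dim r k) * t\<bar>"
          using index_box_dims(1)[OF s(1) s2, of k r] k by (simp add: abs_mult R_def M_def mult_right_mono)
        hence "(real M ^ R * t)\<^sup>2 \<le> (real (nat_dim r k) * t)\<^sup>2" by (simp only: abs_le_square_iff)
        thus ?thesis unfolding v_def using w by (intro divide_right_mono mult_left_mono) auto
      qed
      have "norm (char J t) \<le> exp (- (1 / 2 * real M ^ r * v / 8))"
      proof (rule char_le_of_spread[OF r s(1) J _ _ _ _ _ cF])
        show "finite F" "F \<subseteq> J" by (auto simp: F_def)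
        show "0 \<le> v" using w by (simp add: v_def)
        show "0 \<le> 1 / 2 * real M ^ r" by simp
        have "index_box r M \<noteq> {}" using sM(3) card_index_box[of r M] by force
        then obtain k where k: "k \<in> index_box r M" by blast
        have "\<bar>real (nat_dim r k) * t\<bar> \<le> pi" using angle[OF k] by (simp add: abs_mult)
        also have "pi \<le> 3.2" using pi_approx by simp
        finally have "(real (nat_dim r k) * t)\<^sup>2 \<le> 3.2\<^sup>2" by (intro abs_le_square_iff[THEN iffD1]) simp
        hence "w * (real (nat_dim r k) * t)\<^sup>2 \<le> 1 * 12" using w
          by (intro mult_mono) (auto simp: power2_eq_square)
        thus "v \<le> 3" using v_le[OF k] by linarith
        fix k assume "k \<in> F"
        hence k: "k \<in> index_box r M" by (simp add: F_def)
        have "w * (real (nat_dim r k) * t)\<^sup>2 / 4 = 4 * w * ((real (nat_dim r k) * t / 2)\<^sup>2 / 4)"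
          by (simp add: power2_eq_square)
        also have "\<dots> \<le> 4 * w * (sin (real (nat_dim r k) * t / 2))\<^sup>2"
          using w by (intro mult_left_mono sin_square_ge angle k) auto
        also have "\<dots> \<le> spread k t" using spread[OF k] unfolding ang .
        finally show "v \<le> spread k t" using v_le[OF k] by linarith
      qed
      also have "\<dots> \<le> exp (- (c1 * (1 / s) ^ (2 * num_roots r + r) * t\<^sup>2))"
      proof -
        have "w / 64 * ((1 / 2 * (1 / s)) ^ (2 * R + r) * t\<^sup>2) \<le> w / 64 * (real M ^ (2 * R + r) * t\<^sup>2)"
          using w by (intro mult_left_mono mult_right_mono M12) auto
        also have "\<dots> = 1 / 2 * real M ^ r * v / 8"
          unfolding v_def power_add power_even_eq power_mult_distrib by simp
        finally show ?thesis unfolding c1_def R_def[symmetric]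
          by (simp add: power_mult_distrib power_divide mult_ac)
      qed
      finally show ?thesis by (simp add: add_increasing2)
    qed
  qed
qed

section \<open>The quantitative comparison\<close>

lemma power_mult_exp_le:
  fixes y c :: real
  assumes "y > 0" "c > 0"
  shows "y ^ m * exp (- (c * y)) \<le> fact (Suc m) / c ^ Suc m * (1 / y)"
proof -
  have "(c * y) ^ Suc m \<le> fact (Suc m) * exp (c * y)" using assms by (intro power_le_fact_exp) auto
  hence "c ^ Suc m * y * (y ^ m * exp (- (c * y))) \<le> fact (Suc m)"
    by (simp add: exp_minus power_mult_distrib field_simps)
  thus ?thesis using assms by (simp add: field_simps)
qed

lemma variance_bounds:
  assumes r: "r \<ge> 2" and s: "0 < s" "s \<le> 1 / 2"
  defines "p \<equiv> \<lambda>k. gas_param r s ^ nat_dim r k"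
  defines "S \<equiv> (\<Sum>\<^sub>\<infinity>k\<in>irreps r. (real (nat_dim r k))\<^sup>2 * p k / (1 - p k)\<^sup>2)"
  shows "box_weight_min r * (1 / 2) ^ (2 * num_roots r + r) * (1 / s) ^ (2 * num_roots r + r) \<le> S"
    and "S \<le> 720 * exp 1 * lattice_const r * (1 / s) ^ (2 * num_roots r + r)"
proof -
  let ?M = "real (box_size s)" and ?m = "2 * num_roots r + r"
  show "S \<le> 720 * exp 1 * lattice_const r * (1 / s) ^ ?m"
    unfolding S_def p_def by (rule summable_moment(2)[OF r s(1), of 2]) simp
  have "(1 / 2 * (1 / s)) ^ ?m \<le> ?M ^ ?m"
    using box_size_bounds(2)[OF s] s by (intro power_mono) (auto simp: field_simps)
  hence "box_weight_min r * ((1 / 2) ^ ?m * (1 / s) ^ ?m) \<le> box_weight_min r * ?M ^ ?m"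
    unfolding power_mult_distrib using box_weight_min_pos by (intro mult_left_mono) (auto simp: less_imp_le)
  also have "\<dots> = real (card (index_box r (box_size s))) * (?M ^ (2 * num_roots r) * box_weight_min r)"
    by (simp add: card_index_box power_add mult_ac)
  also have "\<dots> \<le> (\<Sum>k\<in>index_box r (box_size s). (real (nat_dim r k))\<^sup>2 * p k / (1 - p k)\<^sup>2)"
    unfolding p_def by (rule card_box_le_variance[OF s order_refl])
  also have "\<dots> \<le> S"
    unfolding S_def
  proof (rule finite_sum_le_infsum)
    show "(\<lambda>k. (real (nat_dim r k))\<^sup>2 * p k / (1 - p k)\<^sup>2) summable_on irreps r"
      unfolding p_def by (rule summable_moment(1)[OF r s(1), of 2]) simp
    show "index_box r (box_size s) \<subseteq> irreps r"
      by (rule index_box_subset_irreps[OF box_size_bounds(3)[OF s]])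
    show "0 \<le> (real (nat_dim r k))\<^sup>2 * p k / (1 - p k)\<^sup>2" for k by (simp add: p_def)
  qed simp
  finally show "box_weight_min r * (1 / 2) ^ ?m * (1 / s) ^ ?m \<le> S" by (simp add: mult.assoc)
qed

text \<open>
  The standard deviation \<open>\<sigma>\<close> has the order of \<open>sqrt \<Lambda>\<close>, where \<open>\<Lambda>\<close> is \<open>1 / s\<close> to the power \<open>2 R + r\<close>
  with \<open>R = num_roots r\<close>, and the variance of the part in \<open>I\<close> is at most of order \<open>\<theta> \<Lambda>\<close>. Since \<open>prob\<close> at the mean is at least of order \<open>1 / \<sigma>\<close>
  and the integral of \<open>|t char J t|\<close> at most of order \<open>1 / \<Lambda>\<close>, the factors \<open>\<Lambda>\<close> cancel and \<open>sqrt \<theta>\<close> remains.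
\<close>
lemma event_deviation_small:
  assumes r: "r \<ge> 2"
  obtains C \<theta>0 s1 :: real where "0 < \<theta>0" "0 < s1"
    "\<And>s n I \<theta> B. 0 < s \<Longrightarrow> s \<le> s1 \<Longrightarrow> (mean_summand r (gas_param r s) has_sum real n) (irreps r)
      \<Longrightarrow> I \<subseteq> irreps r \<Longrightarrow> \<theta> \<le> \<theta>0 \<Longrightarrow> (\<And>F. finite F \<Longrightarrow> F \<subseteq> I \<Longrightarrow> lattice_sum r s F \<le> \<theta>) \<Longrightarrow> B \<subseteq> msets I
      \<Longrightarrow> 0 < boltzmann_gas.prob (nat_dim r) (gas_param r s) (irreps r) (int n) \<and>
        boltzmann_gas.conditioning_error (irreps r) (nat_dim r) (gas_param r s) (int n)
          (boltzmann_gas.event (irreps r) I B) \<le> C * sqrt \<theta>"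
proof -
  define R where "R = num_roots r"
  define m where "m = 2 * R + r"
  obtain c1 c2 \<kappa> s0 where cb: "0 < c1" "0 < c2" "0 < \<kappa>" "0 < s0" "s0 \<le> 1 / 2"
    "\<And>s J t. 0 < s \<Longrightarrow> s \<le> s0 \<Longrightarrow> J \<subseteq> irreps r
      \<Longrightarrow> real (card (index_box r (box_size s) - J)) \<le> \<kappa> * real (box_size s) ^ r \<Longrightarrow> \<bar>t\<bar> \<le> pi
      \<Longrightarrow> norm (gas_char r s J t) \<le> exp (- (c1 * (1 / s) ^ (2 * num_roots r + r) * t\<^sup>2)) + exp (- (c2 * (1 / s) ^ r))"
    using char_bound[OF r] by metis
  define D where "D = 720 * exp (1::real)"
  define A where "A = D * lattice_const r"
  define w where "w = box_weight_min r * (1 / 2) ^ m"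
  have D: "D > 0" by (simp add: D_def)
  have A: "A > 0" using D lattice_const_pos by (simp add: A_def)
  have w: "w > 0" using box_weight_min_pos by (simp add: w_def)
  define a where "a = min (1 / 2) (c1 / A)"
  have a: "0 < a" "a \<le> 1 / 2" "a * A \<le> c1"
    using cb A by (auto simp: a_def min_def field_simps)
  define Q where "Q = A\<^sup>2 * (12 / a) ^ 6 / w ^ 3"
  have Q: "Q > 0" using A a w by (simp add: Q_def)
  define \<delta> where "\<delta> = 1 / (16 * pi * A)"
  have \<delta>: "\<delta> > 0" using A by (simp add: \<delta>_def)
  \<comment> \<open>\<open>s \<le> w\<close> makes \<open>\<sigma> \<ge> 1\<close>, the third bound controls the third moments and the last one yields \<open>\<Lambda> * \<epsilon> \<le> \<delta>\<close>\<close>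
  define s1 where "s1 = min (min s0 w) (min (1 / (16 * Q)) (\<delta> * c2 ^ Suc m / fact (Suc m)))"
  \<comment> \<open>this makes the part of the box inside \<open>I\<close> so small that the bound for the characteristic function applies to the complement\<close>
  define \<theta>0 where "\<theta>0 = \<kappa> * w / D"
  define C where "C = 8 * D * sqrt (lattice_const r) * (pi / c1 + 2 * pi\<^sup>2 * \<delta>)"
  show ?thesis
  proof (rule that[of \<theta>0 s1 C])
    show "0 < \<theta>0" using cb w D by (simp add: \<theta>0_def)
    show "0 < s1" using cb w Q \<delta> by (simp add: s1_def)
    fix s n I \<theta> B
    assume s: "0 < s" "s \<le> s1" and mean: "(mean_summand r (gas_param r s) has_sum real n) (irreps r)"
      and I: "I \<subseteq> irreps r" and \<theta>: "\<theta> \<le> \<theta>0"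
      and lat: "\<And>F. finite F \<Longrightarrow> F \<subseteq> I \<Longrightarrow> lattice_sum r s F \<le> \<theta>" and B: "B \<subseteq> msets I"
    interpret boltzmann_gas "irreps r" "nat_dim r" "gas_param r s"
      by (rule gas_interpretation[OF r s(1)])
    have s_le: "s \<le> s0" "s \<le> w" "s \<le> 1 / (16 * Q)" "s \<le> \<delta> * c2 ^ Suc m / fact (Suc m)"
      using s(2) by (auto simp: s1_def)
    have s2: "s \<le> 1 / 2" using s_le(1) cb(5) by linarith
    define y where "y = 1 / s"
    have y: "y \<ge> 1" "y > 0" using s s2 by (auto simp: y_def field_simps)
    have ym: "y \<le> y ^ j" if "j \<ge> 1" for j using power_increasing[OF that y(1)] by simp
    have m1: "m \<ge> 1" "r \<ge> 1" using r by (auto simp: m_def)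
    define \<Lambda> where "\<Lambda> = y ^ m"
    have \<Lambda>: "\<Lambda> > 0" using y by (simp add: \<Lambda>_def)
    let ?p = "\<lambda>k. gas_param r s ^ nat_dim r k"
    define S where "S = (\<Sum>\<^sub>\<infinity>k\<in>irreps r. (real (nat_dim r k))\<^sup>2 * ?p k / (1 - ?p k)\<^sup>2)"
    define K where "K = (\<Sum>\<^sub>\<infinity>k\<in>irreps r. (real (nat_dim r k)) ^ 3 * ?p k / (1 - ?p k) ^ 3)"
    have var: "((\<lambda>k. (real (nat_dim r k))\<^sup>2 * ?p k / (1 - ?p k)\<^sup>2) has_sum S) (irreps r)"
      unfolding S_def by (intro has_sum_infsum summable_moment(1)[OF r s(1)]) simp
    have third: "((\<lambda>k. (real (nat_dim r k)) ^ 3 * ?p k / (1 - ?p k) ^ 3) has_sum K) (irreps r)"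
      unfolding K_def by (intro has_sum_infsum summable_moment(1)[OF r s(1)]) simp
    have S: "w * \<Lambda> \<le> S" "S \<le> A * \<Lambda>"
      using variance_bounds[OF r s(1) s2]
      by (simp_all add: S_def w_def \<Lambda>_def y_def m_def R_def A_def D_def)
    have K: "K \<le> A * y ^ (3 * R + r)"
      using summable_moment(2)[OF r s(1), of 3] by (simp add: K_def A_def D_def y_def R_def)
    have K0: "0 \<le> K" unfolding K_def
      using moment_summand_le(2)[OF s(1)] by (intro infsum_nonneg) auto
    have "1 \<le> w * y" using s_le(2) s(1) by (simp add: y_def)
    also have "\<dots> \<le> w * \<Lambda>" using w ym[OF m1(1)] by (simp add: \<Lambda>_def)
    finally have S1: "1 \<le> S" using S(1) by linarith
    define \<sigma> where "\<sigma> = sqrt S"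
    have \<sigma>: "\<sigma> \<ge> 1" "\<sigma>\<^sup>2 = S" using S1 by (auto simp: \<sigma>_def)
    define \<epsilon> where "\<epsilon> = exp (- (c2 * (1 / s) ^ r))"
    have \<epsilon>: "0 \<le> \<epsilon>" "\<Lambda> * \<epsilon> \<le> \<delta>"
    proof -
      have "c2 * y \<le> c2 * y ^ r" using cb(2) ym[OF m1(2)] by (intro mult_left_mono) auto
      hence "\<Lambda> * \<epsilon> \<le> y ^ m * exp (- (c2 * y))"
        using y unfolding \<Lambda>_def \<epsilon>_def y_def[symmetric] by (intro mult_left_mono) auto
      also have "\<dots> \<le> fact (Suc m) / c2 ^ Suc m * (1 / y)" by (rule power_mult_exp_le[OF y(2) cb(2)])
      also have "\<dots> = fact (Suc m) / c2 ^ Suc m * s" by (simp add: y_def)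
      also have "\<dots> \<le> fact (Suc m) / c2 ^ Suc m * (\<delta> * c2 ^ Suc m / fact (Suc m))"
        using s_le(4) cb(2) by (intro mult_left_mono) auto
      also have "\<dots> = \<delta>" using cb(2) by simp
      finally show "\<Lambda> * \<epsilon> \<le> \<delta>" .
    qed (simp add: \<epsilon>_def)
    have char_gauss: "norm (char J t) \<le> exp (- (c1 * \<Lambda> * t\<^sup>2)) + \<epsilon>"
      if "J \<subseteq> irreps r" "real (card (index_box r (box_size s) - J)) \<le> \<kappa> * real (box_size s) ^ r" "\<bar>t\<bar> \<le> pi" for J t
      using cb(6)[OF s(1) s_le(1) that] by (simp add: \<Lambda>_def \<epsilon>_def y_def m_def R_def)
    have prob: "1 / (8 * \<sigma>) \<le> 2 * pi * prob (irreps r) (int n)"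
    proof (rule prob_lower_bound[OF _ _ third \<sigma>(1) a(1,2)])
      show "((\<lambda>k. real (nat_dim r k) * ?p k / (1 - ?p k)) has_sum real_of_int (int n)) (irreps r)"
        using mean by (simp add: mean_summand_def[abs_def])
      show "((\<lambda>k. (real (nat_dim r k))\<^sup>2 * ?p k / (1 - ?p k)\<^sup>2) has_sum \<sigma>\<^sup>2) (irreps r)"
        unfolding \<sigma>(2) by (rule var)
      show "0 \<le> \<epsilon>" by (rule \<epsilon>(1))
      show "2 * pi * \<epsilon> \<le> 1 / (8 * \<sigma>)"
      proof -
        have "\<sigma> \<le> \<sigma>\<^sup>2" using \<sigma>(1) by (simp add: power2_eq_square)
        also have "\<dots> \<le> A * \<Lambda>" using S(2) by (simp add: \<sigma>(2))
        finally have "\<sigma> * \<epsilon> \<le> A * \<Lambda> * \<epsilon>" using \<epsilon>(1) by (intro mult_right_mono)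
        also have "\<dots> \<le> A * \<delta>" using \<epsilon>(2) A by (simp add: mult.assoc)
        also have "\<dots> = 1 / (16 * pi)" using A by (simp add: \<delta>_def)
        finally have "16 * pi * (\<sigma> * \<epsilon>) \<le> 16 * pi * (1 / (16 * pi))" by (intro mult_left_mono) auto
        hence "16 * pi * (\<sigma> * \<epsilon>) \<le> 1" by simp
        thus ?thesis using \<sigma>(1) by (simp add: field_simps)
      qed
      show "K * (12 / a / \<sigma>) ^ 3 \<le> 1 / 4"
      proof (rule power2_le_imp_le)
        have "(K * (12 / a / \<sigma>) ^ 3)\<^sup>2 = K\<^sup>2 * (12 / a) ^ 6 / (\<sigma>\<^sup>2) ^ 3"
          by (simp add: power_mult_distrib power_divide flip: power_mult)
        also have "\<dots> \<le> (A * y ^ (3 * R + r))\<^sup>2 * (12 / a) ^ 6 / (w * \<Lambda>) ^ 3"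
          using K K0 a w \<Lambda> S unfolding \<sigma>(2) by (intro frac_le mult_right_mono power_mono) auto
        also have "\<dots> = Q * (y ^ (6 * R + 2 * r) / y ^ (6 * R + 3 * r))"
        proof -
          have "(y ^ (3 * R + r))\<^sup>2 = y ^ (6 * R + 2 * r)" "(y ^ m) ^ 3 = y ^ (6 * R + 3 * r)"
            by (simp_all add: m_def algebra_simps flip: power_mult)
          thus ?thesis unfolding Q_def \<Lambda>_def power_mult_distrib by simp
        qed
        also have "y ^ (6 * R + 2 * r) / y ^ (6 * R + 3 * r) = 1 / y ^ r"
          using y by (simp add: field_simps flip: power_add)
        also have "Q * (1 / y ^ r) \<le> Q * (1 / y)"
          using Q y ym[OF m1(2)] by (intro mult_left_mono divide_left_mono) auto
        also have "\<dots> = Q * s" by (simp add: y_def)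
        also have "\<dots> \<le> Q * (1 / (16 * Q))" using Q s_le(3) by (intro mult_left_mono) auto
        also have "\<dots> = (1 / 4)\<^sup>2" using Q by (simp add: power2_eq_square)
        finally show "(K * (12 / a / \<sigma>) ^ 3)\<^sup>2 \<le> (1 / 4)\<^sup>2" .
      qed simp
      fix t :: real assume t: "\<bar>t\<bar> \<le> pi"
      have "a * (\<sigma> * t)\<^sup>2 = a * S * t\<^sup>2" by (simp add: power_mult_distrib \<sigma>(2))
      also have "\<dots> \<le> a * (A * \<Lambda>) * t\<^sup>2" using a S(2) by (intro mult_right_mono mult_left_mono) auto
      also have "\<dots> = a * A * (\<Lambda> * t\<^sup>2)" by simp
      also have "\<dots> \<le> c1 * (\<Lambda> * t\<^sup>2)" using a(3) \<Lambda> by (intro mult_right_mono) auto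
      finally have "exp (- (c1 * \<Lambda> * t\<^sup>2)) \<le> exp (- (a * (\<sigma> * t)\<^sup>2))" by simp
      moreover have no_gap: "index_box r (box_size s) - irreps r = {}"
        using index_box_subset_irreps[OF box_size_bounds(3)[OF s(1) s2]] by auto
      have "real (card (index_box r (box_size s) - irreps r)) \<le> \<kappa> * real (box_size s) ^ r"
        unfolding no_gap using cb(3) by simp
      ultimately show "norm (char (irreps r) t) \<le> exp (- (a * (\<sigma> * t)\<^sup>2)) + \<epsilon>"
        using char_gauss[OF order_refl _ t] by linarith
    qed
    have prob_pos: "prob (irreps r) (int n) > 0"
    proof -
      have "0 < 1 / (8 * \<sigma>)" using \<sigma>(1) by simp
      hence "0 < 2 * pi * prob (irreps r) (int n)" using prob by linarith
      thus ?thesis by (simp add: zero_less_mult_iff)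
    qed
    define V where "V = D * \<Lambda> * \<theta>"
    have V: "(\<Sum>k\<in>F. (real (nat_dim r k))\<^sup>2 * ?p k / (1 - ?p k)\<^sup>2) \<le> V" if F: "finite F" "F \<subseteq> I" for F
    proof -
      have "(\<Sum>k\<in>F. (real (nat_dim r k))\<^sup>2 * ?p k / (1 - ?p k)\<^sup>2) \<le> 720 * exp 1 * (1 / s) ^ (2 * num_roots r + r) * lattice_sum r s F"
        by (rule moment_sum_le[OF s(1)]) (use F I in auto)
      also have "\<dots> = D * \<Lambda> * lattice_sum r s F" by (simp add: D_def \<Lambda>_def y_def m_def R_def)
      also have "\<dots> \<le> V" unfolding V_def using D \<Lambda> by (intro mult_left_mono lat F) auto
      finally show ?thesis .
    qed
    have \<theta>0': "\<theta> \<ge> 0" using lat[of "{}"] by (simp add: lattice_sum_def)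
    let ?J = "irreps r - I"
    have cov: "real (card (index_box r (box_size s) - ?J)) \<le> \<kappa> * real (box_size s) ^ r"
    proof -
      let ?M = "real (box_size s)" and ?F = "index_box r (box_size s) - ?J"
      have sub: "?F \<subseteq> I"
        using index_box_subset_irreps[OF box_size_bounds(3)[OF s(1) s2], of r] by auto
      have M0: "?M > 0" using box_size_bounds(3)[OF s(1) s2] by simp
      have "real (card ?F) * (?M ^ (2 * num_roots r) * box_weight_min r)
          \<le> (\<Sum>k\<in>?F. (real (nat_dim r k))\<^sup>2 * ?p k / (1 - ?p k)\<^sup>2)"
        by (rule card_box_le_variance[OF s(1) s2]) auto
      also have "\<dots> \<le> V" using sub by (intro V) auto
      also have "\<dots> \<le> D * \<Lambda> * \<theta>0" unfolding V_def using D \<Lambda> \<theta> by (intro mult_left_mono) auto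
      also have "\<dots> = \<kappa> * box_weight_min r * (1 / 2 * y) ^ m"
        unfolding power_mult_distrib using D by (simp add: \<theta>0_def w_def \<Lambda>_def)
      also have "\<dots> \<le> \<kappa> * box_weight_min r * ?M ^ m"
        using cb(3) box_weight_min_pos[of r] y box_size_bounds(2)[OF s(1) s2] s(1)
        by (intro mult_left_mono power_mono) (auto simp: y_def field_simps)
      also have "\<dots> = \<kappa> * ?M ^ r * (?M ^ (2 * num_roots r) * box_weight_min r)"
        by (simp add: m_def R_def power_add mult_ac)
      finally show ?thesis
        using M0 box_weight_min_pos[of r] by (simp add: mult_le_cancel_right)
    qed
    have int: "integral {-pi..pi} (\<lambda>t. norm (char ?J t) * \<bar>t\<bar>) \<le> pi / (sqrt (c1 * \<Lambda>))\<^sup>2 + 2 * pi\<^sup>2 * \<epsilon>"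
    proof (rule integral_char_abs_le)
      fix t :: real assume "\<bar>t\<bar> \<le> pi"
      thus "norm (char ?J t) \<le> exp (- ((sqrt (c1 * \<Lambda>) * t)\<^sup>2)) + \<epsilon>"
        using char_gauss[OF _ cov, of t] cb(1) \<Lambda> by (simp add: power_mult_distrib)
    qed (use cb(1) \<Lambda> \<epsilon> in auto)
    have "conditioning_error (int n) (event I B)
      \<le> sqrt V * integral {-pi..pi} (\<lambda>t. norm (char ?J t) * \<bar>t\<bar>) / (2 * pi * prob (irreps r) (int n))"
      by (rule event_deviation_le[OF I B prob_pos V])
    also have "\<dots> \<le> sqrt V * (pi / (c1 * \<Lambda>) + 2 * pi\<^sup>2 * \<epsilon>) / (1 / (8 * \<sigma>))"
    proof (rule frac_le)
      show "sqrt V * integral {-pi..pi} (\<lambda>t. norm (char ?J t) * \<bar>t\<bar>) \<le> sqrt V * (pi / (c1 * \<Lambda>) + 2 * pi\<^sup>2 * \<epsilon>)"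
        using int D \<Lambda> \<theta>0' cb(1) by (intro mult_left_mono) (auto simp: V_def)
      show "0 \<le> sqrt V * (pi / (c1 * \<Lambda>) + 2 * pi\<^sup>2 * \<epsilon>)"
        using D \<Lambda> \<theta>0' cb(1) \<epsilon>(1) by (auto simp: V_def intro!: mult_nonneg_nonneg add_nonneg_nonneg)
    qed (use prob \<sigma> in auto)
    also have "\<dots> = 8 * (sqrt V * \<sigma>) * (pi / (c1 * \<Lambda>) + 2 * pi\<^sup>2 * \<epsilon>)" by simp
    also have "\<dots> \<le> 8 * (D * sqrt (lattice_const r) * sqrt \<theta> * \<Lambda>) * (pi / (c1 * \<Lambda>) + 2 * pi\<^sup>2 * \<epsilon>)"
    proof (intro mult_right_mono mult_left_mono)
      have "sqrt V * \<sigma> = sqrt (V * S)" by (simp add: \<sigma>_def real_sqrt_mult)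
      also have "\<dots> \<le> sqrt (D * \<Lambda> * \<theta> * (A * \<Lambda>))"
        unfolding V_def using S(2) D \<Lambda> \<theta>0' by (intro real_sqrt_le_mono mult_left_mono) auto
      also have "D * \<Lambda> * \<theta> * (A * \<Lambda>) = (D * \<Lambda>)\<^sup>2 * (lattice_const r * \<theta>)"
        by (simp add: A_def power2_eq_square)
      also have "sqrt ((D * \<Lambda>)\<^sup>2 * (lattice_const r * \<theta>)) = D * \<Lambda> * (sqrt (lattice_const r) * sqrt \<theta>)"
        using D \<Lambda> by (simp add: real_sqrt_mult)
      finally show "sqrt V * \<sigma> \<le> D * sqrt (lattice_const r) * sqrt \<theta> * \<Lambda>" by (simp add: mult_ac)
    qed (use cb(1) \<Lambda> \<epsilon>(1) in auto)
    also have "\<dots> = 8 * D * sqrt (lattice_const r) * sqrt \<theta> * (pi / c1 + 2 * pi\<^sup>2 * (\<Lambda> * \<epsilon>))"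
      using \<Lambda> cb(1) by (simp add: field_simps)
    also have "\<dots> \<le> 8 * D * sqrt (lattice_const r) * sqrt \<theta> * (pi / c1 + 2 * pi\<^sup>2 * \<delta>)"
      using D lattice_const_pos[of r] \<theta>0' \<epsilon>(2)
      by (intro mult_left_mono add_left_mono) (auto simp: less_imp_le intro!: mult_nonneg_nonneg)
    also have "\<dots> = C * sqrt \<theta>" by (simp add: C_def)
    finally show "0 < prob (irreps r) (int n) \<and> conditioning_error (int n) (event I B) \<le> C * sqrt \<theta>" using prob_pos by blast
  qed
qed

section \<open>Laws of the multiplicities\<close>

lemma measure_point_measure_infsum:
  fixes w :: "'a \<Rightarrow> real"
  assumes w: "\<And>x. x \<in> A \<Longrightarrow> 0 \<le> w x" "w summable_on A" and E: "E \<subseteq> A"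
  shows "measure (point_measure A (\<lambda>x. ennreal (w x))) E = infsum w E"
proof -
  have "w summable_on E" using w(2) E summable_on_subset_banach by blast
  hence "(\<lambda>x. norm (w x)) summable_on E" by (rule summable_on_iff_abs_summable_on_real[THEN iffD1])
  hence abs: "Infinite_Set_Sum.abs_summable_on w E" by (simp only: abs_summable_equivalent)
  have "emeasure (point_measure A (\<lambda>x. ennreal (w x))) E
      = (\<integral>\<^sup>+x. ennreal (w x) * indicator E x \<partial>count_space A)"
    unfolding point_measure_def using E by (subst emeasure_density) auto
  also have "\<dots> = (\<integral>\<^sup>+x. ennreal (w x) \<partial>count_space E)"
    using E by (subst (2) nn_integral_count_space_indicator)
       (auto simp: nn_integral_count_space_indicator indicator_def intro!: nn_integral_cong split: if_splits)
  also have "\<dots> = ennreal (infsetsum w E)"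
    using w(1) E by (intro nn_integral_conv_infsetsum abs) auto
  also have "infsetsum w E = infsum w E" by (rule infsetsum_infsum[OF abs])
  finally show ?thesis
    using w(1) E by (simp add: measure_def infsum_nonneg subset_iff)
qed

context boltzmann_gas
begin

text \<open>
  All multisets of dimension \<open>n\<close> have the same positive weight, and the weights are summable.
\<close>
lemma dim_slice_finite: "finite {\<rho> \<in> msets U. mdim \<rho> = n}"
proof (rule ccontr)
  let ?X = "{\<rho> \<in> msets U. mdim \<rho> = n}"
  define c where "c = q ^ n / Z U"
  have c: "c > 0" using q Z_pos[of U] by (simp add: c_def)
  assume "infinite ?X"
  then obtain X where X: "finite X" "card X = nat \<lceil>1 / c\<rceil> + 1" "X \<subseteq> ?X"
    using infinite_arbitrarily_large by blast
  have "(\<Sum>\<rho>\<in>X. weight U \<rho>) \<le> 1"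
    by (rule finite_sum_le_has_sum[OF has_sum_weight[OF order_refl]]) (use X weight_nonneg in auto)
  moreover have "(\<Sum>\<rho>\<in>X. weight U \<rho>) = (\<Sum>\<rho>\<in>X. c)"
    using X(3) by (intro sum.cong) (auto simp: weight_def c_def)
  ultimately have "real (card X) * c \<le> 1" by simp
  hence "real (card X) \<le> 1 / c" using c by (simp add: field_simps)
  moreover have "1 / c < real (card X)" unfolding X(2) by linarith
  ultimately show False by linarith
qed

lemma slice_weight_eq_card:
  assumes "E \<subseteq> msets U"
  shows "slice_weight (int n) E
     = real (card (E \<inter> {\<rho> \<in> msets U. mdim \<rho> = n})) * (q ^ n / Z U)"
proof -
  let ?X = "E \<inter> {\<rho> \<in> msets U. mdim \<rho> = n}"
  have "slice_weight (int n) E = (\<Sum>\<^sub>\<infinity>\<rho>\<in>?X. q ^ n / Z U)"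
    unfolding slice_weight_def using assms by (intro infsum_cong_neutral) (auto simp: weight_def)
  also have "\<dots> = (\<Sum>\<rho>\<in>?X. q ^ n / Z U)"
    using dim_slice_finite by (intro infsum_finite) auto
  finally show ?thesis by simp
qed

lemma uniform_eq_conditional:
  assumes E: "E \<subseteq> msets U" and pos: "0 < prob U (int n)"
  defines "X \<equiv> {\<rho> \<in> msets U. mdim \<rho> = n}"
  shows "X \<noteq> {}" and "measure (uniform_count_measure X) (E \<inter> X)
     = slice_weight (int n) E / prob U (int n)"
proof -
  have fin: "finite X" unfolding X_def by (rule dim_slice_finite)
  have prob: "prob U (int n) = real (card X) * (q ^ n / Z U)"
    using slice_weight_eq_card[of "msets U" n] by (simp add: prob_def slice_weight_def X_def Int_absorb1)
  show "X \<noteq> {}" using pos prob by auto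
  define c where "c = q ^ n / Z U"
  have "c > 0" using q Z_pos[of U] by (simp add: c_def)
  thus "measure (uniform_count_measure X) (E \<inter> X)
     = slice_weight (int n) E / prob U (int n)"
    unfolding slice_weight_eq_card[OF E] prob X_def[symmetric] c_def[symmetric]
    using fin by (simp add: measure_uniform_count_measure)
qed

lemma unordered_prod_eq: "unordered_prod (\<lambda>k. 1 - q ^ d k) U = 1 / Z U"
proof -
  have "(sum (\<lambda>k. - ln (1 - q ^ d k)) \<longlongrightarrow> (\<Sum>\<^sub>\<infinity>k\<in>U. - ln (1 - q ^ d k))) (finite_subsets_at_top U)"
    using has_sum_infsum[OF summable_log[OF order_refl]] by (simp add: has_sum_def)
  hence "((\<lambda>F. exp (- sum (\<lambda>k. - ln (1 - q ^ d k)) F)) \<longlongrightarrow> exp (- (\<Sum>\<^sub>\<infinity>k\<in>U. - ln (1 - q ^ d k)))) (finite_subsets_at_top U)"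
    by (intro tendsto_intros)
  also have "exp (- (\<Sum>\<^sub>\<infinity>k\<in>U. - ln (1 - q ^ d k))) = 1 / Z U"
    by (simp add: Z_def exp_minus inverse_eq_divide)
  finally have lim: "((\<lambda>F. exp (- sum (\<lambda>k. - ln (1 - q ^ d k)) F)) \<longlongrightarrow> 1 / Z U) (finite_subsets_at_top U)" .
  have "eventually (\<lambda>F. exp (- sum (\<lambda>k. - ln (1 - q ^ d k)) F) = prod (\<lambda>k. 1 - q ^ d k) F) (finite_subsets_at_top U)"
  proof (rule eventually_finite_subsets_at_top_weakI)
    fix F assume F: "finite F" "F \<subseteq> U"
    have "exp (- sum (\<lambda>k. - ln (1 - q ^ d k)) F) = exp (\<Sum>k\<in>F. ln (1 - q ^ d k))"
      by (simp add: sum_negf)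
    also have "\<dots> = (\<Prod>k\<in>F. exp (ln (1 - q ^ d k)))" by (rule exp_sum[OF F(1)])
    also have "\<dots> = (\<Prod>k\<in>F. 1 - q ^ d k)"
      using F power_bounds by (intro prod.cong) auto
    finally show "exp (- sum (\<lambda>k. - ln (1 - q ^ d k)) F) = prod (\<lambda>k. 1 - q ^ d k) F" .
  qed
  from Lim_transform_eventually[OF lim this] show ?thesis
    unfolding unordered_prod_def by (intro tendsto_Lim) auto
qed

lemma mdim_eq_sum: "mdim \<rho> = (\<Sum>k\<in>set_mset \<rho>. d k * count \<rho> k)"
  unfolding mdim_def
proof (induction \<rho>)
  case (add x \<rho>)
  have "(\<Sum>k\<in>set_mset (add_mset x \<rho>). d k * count (add_mset x \<rho>) k)
      = (\<Sum>k\<in>insert x (set_mset \<rho>). (if k = x then d x else 0) + d k * count \<rho> k)"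
    by (intro sum.cong) (auto simp: algebra_simps)
  also have "\<dots> = d x + (\<Sum>k\<in>insert x (set_mset \<rho>). d k * count \<rho> k)"
    by (simp add: sum.distrib)
  also have "(\<Sum>k\<in>insert x (set_mset \<rho>). d k * count \<rho> k) = (\<Sum>k\<in>set_mset \<rho>. d k * count \<rho> k)"
    by (intro sum.mono_neutral_right) (auto simp: not_in_iff)
  finally show ?case using add by simp
qed auto

end

lemma reps_eq_msets: "reps r = msets (irreps r)"
  by (simp add: reps_def msets_def)

lemma restrict_count_in_mult_vectors: "restrict (count \<rho>) I \<in> mult_vectors I"
proof -
  have "{k \<in> I. restrict (count \<rho>) I k \<noteq> 0} \<subseteq> set_mset \<rho>" by (auto simp: count_eq_zero_iff)
  hence "finite {k \<in> I. restrict (count \<rho>) I k \<noteq> 0}" by (rule finite_subset) simp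
  thus ?thesis by (simp add: mult_vectors_def)
qed

lemma measure_mult_law:
  assumes "sets M = Pow (space M)" "B \<subseteq> mult_vectors I"
  shows "measure (mult_law I M) B = measure M {\<rho> \<in> space M. restrict (count \<rho>) I \<in> B}"
proof -
  have "(\<lambda>\<rho>. restrict (count \<rho>) I) \<in> measurable M (count_space (mult_vectors I))"
    using assms(1) restrict_count_in_mult_vectors by (auto simp: measurable_def)
  hence "measure (mult_law I M) B = measure M ((\<lambda>\<rho>. restrict (count \<rho>) I) -` B \<inter> space M)"
    unfolding mult_law_def using assms(2) by (subst measure_distr) auto
  also have "(\<lambda>\<rho>. restrict (count \<rho>) I) -` B \<inter> space M = {\<rho> \<in> space M. restrict (count \<rho>) I \<in> B}" by auto
  finally show ?thesis .
qed

lemma tv_dist_bounds: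
  assumes "\<And>B. B \<in> sets M \<Longrightarrow> \<bar>measure M B - measure N B\<bar> \<le> K"
  shows "0 \<le> tv_dist M N" "tv_dist M N \<le> K"
proof -
  have "bdd_above ((\<lambda>B. \<bar>measure M B - measure N B\<bar>) ` sets M)"
    using assms by (auto simp: bdd_above_def)
  hence "\<bar>measure M {} - measure N {}\<bar> \<le> tv_dist M N"
    unfolding tv_dist_def by (intro cSUP_upper) auto
  thus "0 \<le> tv_dist M N" by simp
  show "tv_dist M N \<le> K"
    unfolding tv_dist_def by (rule cSUP_least) (use assms in auto)
qed

lemma tv_dist_mult_law_le:
  assumes r: "r \<ge> 2"
  obtains C \<theta>0 s1 :: real where "0 < \<theta>0" "0 < s1"
    "\<And>n I \<theta>. n \<ge> 1 \<Longrightarrow> s_param r n \<le> s1 \<Longrightarrow> I \<subseteq> irreps r \<Longrightarrow> \<theta> \<le> \<theta>0 \<Longrightarrow>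
      (\<And>F. finite F \<Longrightarrow> F \<subseteq> I \<Longrightarrow> lattice_sum r (s_param r n) F \<le> \<theta>) \<Longrightarrow>
      0 \<le> tv_dist (mult_law I (boltzmann_rep r (q_param r n))) (mult_law I (uniform_rep r n)) \<and>
      tv_dist (mult_law I (boltzmann_rep r (q_param r n))) (mult_law I (uniform_rep r n)) \<le> C * sqrt \<theta>"
proof -
  obtain C \<theta>0 s1 :: real where ev: "0 < \<theta>0" "0 < s1"
    "\<And>s n I \<theta> B. 0 < s \<Longrightarrow> s \<le> s1 \<Longrightarrow> (mean_summand r (gas_param r s) has_sum real n) (irreps r)
      \<Longrightarrow> I \<subseteq> irreps r \<Longrightarrow> \<theta> \<le> \<theta>0 \<Longrightarrow> (\<And>F. finite F \<Longrightarrow> F \<subseteq> I \<Longrightarrow> lattice_sum r s F \<le> \<theta>) \<Longrightarrow> B \<subseteq> msets I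
      \<Longrightarrow> 0 < boltzmann_gas.prob (nat_dim r) (gas_param r s) (irreps r) (int n) \<and>
        boltzmann_gas.conditioning_error (irreps r) (nat_dim r) (gas_param r s) (int n)
          (boltzmann_gas.event (irreps r) I B) \<le> C * sqrt \<theta>"
  proof (rule event_deviation_small[OF r], goal_cases)
    case (1 C \<theta>0 s1)
    show ?case by (rule 1(1)[OF 1(2-4)])
  qed
  show ?thesis
  proof (rule that[OF ev(1,2)])
    fix n I \<theta>
    assume n: "n \<ge> 1" and s1: "s_param r n \<le> s1" and I: "I \<subseteq> irreps r" and \<theta>: "\<theta> \<le> \<theta>0"
      and lat: "\<And>F. finite F \<Longrightarrow> F \<subseteq> I \<Longrightarrow> lattice_sum r (s_param r n) F \<le> \<theta>"
    define s where "s = s_param r n"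
    have s: "s > 0" "q_param r n = gas_param r s" using s_param_works[OF r n] by (simp_all add: s_def)
    have mean: "(mean_summand r (gas_param r s) has_sum real n) (irreps r)"
      using q_param_works(3)[OF r n] by (simp only: s(2))
    interpret boltzmann_gas "irreps r" "nat_dim r" "gas_param r s"
      by (rule gas_interpretation[OF r s(1)])
    define U where "U = irreps r"
    have dim: "rep_dim r \<rho> = real (mdim \<rho>)" for \<rho>
      by (simp add: rep_dim_def mdim_eq_sum irrep_dim_nat)
    have bw: "boltzmann_weight r (gas_param r s) \<rho> = weight U \<rho>" for \<rho>
    proof -
      have "(\<lambda>k. 1 - gas_param r s powr irrep_dim r k) = (\<lambda>k. 1 - gas_param r s ^ nat_dim r k)"
        by (simp only: irrep_dim_nat powr_realpow exp_gt_zero)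
      hence "boltzmann_weight r (gas_param r s) \<rho> = gas_param r s powr real (mdim \<rho>) * (1 / Z U)"
        unfolding boltzmann_weight_def dim U_def by (simp only: unordered_prod_eq)
      also have "gas_param r s powr real (mdim \<rho>) = gas_param r s ^ mdim \<rho>"
        by (simp only: powr_realpow exp_gt_zero)
      finally show ?thesis by (simp add: weight_def)
    qed
    have boltz: "boltzmann_rep r (q_param r n) = point_measure (msets U) (\<lambda>\<rho>. ennreal (weight U \<rho>))"
      unfolding boltzmann_rep_def s(2) by (simp add: bw reps_eq_msets U_def)
    define X where "X = {\<rho> \<in> msets U. mdim \<rho> = n}"
    have unif: "uniform_rep r n = uniform_count_measure X"
      unfolding uniform_rep_def by (simp add: dim reps_eq_msets X_def U_def)
    have dev: "\<bar>measure (mult_law I (boltzmann_rep r (q_param r n))) B - measure (mult_law I (uniform_rep r n)) B\<bar> \<le> C * sqrt \<theta>"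
      if B: "B \<in> sets (mult_law I (boltzmann_rep r (q_param r n)))" for B
    proof -
      have B: "B \<subseteq> mult_vectors I" using B by (simp add: mult_law_def)
      define B' where "B' = {x \<in> msets I. restrict (count x) I \<in> B}"
      define E where "E = event I B'"
      have E_eq: "E = {\<rho> \<in> msets U. restrict (count \<rho>) I \<in> B}"
      proof -
        have "restrict (count (filter_mset (\<lambda>k. k \<in> I) \<rho>)) I = restrict (count \<rho>) I" for \<rho> by (auto simp: restrict_def)
        thus ?thesis by (auto simp: E_def event_def U_def B'_def msets_def)
      qed
      have EU: "E \<subseteq> msets U" by (auto simp: E_def event_def U_def)
      have lat': "lattice_sum r s F \<le> \<theta>" if "finite F" "F \<subseteq> I" for F
        unfolding s_def by (rule lat[OF that])
      have "0 < prob U (int n) \<and> conditioning_error (int n) E \<le> C * sqrt \<theta>"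
        unfolding E_def U_def
        by (rule ev(3)[OF s(1) _ mean I \<theta> lat']) (use s1 in \<open>auto simp: s_def B'_def\<close>)
      hence pos: "0 < prob U (int n)"
        and le: "\<bar>infsum (weight U) E - slice_weight (int n) E / prob U (int n)\<bar> \<le> C * sqrt \<theta>"
        unfolding conditioning_error_def U_def by blast+
      have "measure (mult_law I (boltzmann_rep r (q_param r n))) B = measure (point_measure (msets U) (\<lambda>\<rho>. ennreal (weight U \<rho>))) E"
        unfolding boltz E_eq by (subst measure_mult_law) (use B in \<open>auto simp: sets_point_measure space_point_measure\<close>)
      also have "\<dots> = infsum (weight U) E"
        by (rule measure_point_measure_infsum) (use weight_nonneg summable_weight EU in \<open>auto simp: U_def\<close>)
      finally have 1: "measure (mult_law I (boltzmann_rep r (q_param r n))) B = infsum (weight U) E" .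
      have "measure (mult_law I (uniform_rep r n)) B = measure (uniform_count_measure X) {\<rho> \<in> X. restrict (count \<rho>) I \<in> B}"
        unfolding unif by (subst measure_mult_law)
          (use B in \<open>auto simp: sets_uniform_count_measure space_uniform_count_measure\<close>)
      also have "{\<rho> \<in> X. restrict (count \<rho>) I \<in> B} = E \<inter> X" by (auto simp: E_eq X_def)
      also have "measure (uniform_count_measure X) (E \<inter> X)
          = slice_weight (int n) E / prob U (int n)"
        unfolding X_def U_def by (rule uniform_eq_conditional(2)) (use EU pos in \<open>auto simp: U_def\<close>)
      finally show ?thesis using 1 le by simp
    qed
    show "0 \<le> tv_dist (mult_law I (boltzmann_rep r (q_param r n))) (mult_law I (uniform_rep r n)) \<and>
      tv_dist (mult_law I (boltzmann_rep r (q_param r n))) (mult_law I (uniform_rep r n)) \<le> C * sqrt \<theta>"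
      using tv_dist_bounds[OF dev] by blast
  qed
qed

lemma scaled_dim_eq: "scaled_dim r n k = ennreal (s_param r n ^ num_roots r * irrep_dim r k)"
  by (simp add: scaled_dim_def dim_poly_scale irrep_dim_def)

text \<open>
  The variance of the dimension of the part in \<open>I n\<close> is of smaller order than that of the whole.
\<close>
definition negligible :: "nat \<Rightarrow> (nat \<Rightarrow> (nat \<Rightarrow> nat) set) \<Rightarrow> bool" where
  "negligible r I \<longleftrightarrow> (\<forall>\<epsilon>>0. \<forall>\<^sub>F n in sequentially. \<forall>F. finite F \<longrightarrow> F \<subseteq> I n \<longrightarrow> lattice_sum r (s_param r n) F \<le> \<epsilon>)"

context
  fixes r :: nat and I :: "nat \<Rightarrow> (nat \<Rightarrow> nat) set"
  assumes r: "r \<ge> 2" and I: "\<forall>n\<ge>1. I n \<subseteq> irreps r"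
begin

lemma negligibleI:
  assumes "\<And>\<epsilon>. \<epsilon> > 0 \<Longrightarrow> \<forall>\<^sub>F n in sequentially. n \<ge> 1 \<longrightarrow> s_param r n \<le> 1 \<longrightarrow>
     (\<forall>F. finite F \<longrightarrow> F \<subseteq> I n \<longrightarrow> lattice_sum r (s_param r n) F \<le> \<epsilon>)"
  shows "negligible r I"
  unfolding negligible_def
proof safe
  fix \<epsilon> :: real assume "\<epsilon> > 0"
  have "\<forall>\<^sub>F n in sequentially. s_param r n < 1"
    using order_tendstoD(2)[OF s_param_tendsto_0[OF r]] by simp
  with assms[OF \<open>\<epsilon> > 0\<close>] eventually_ge_at_top[of 1]
  show "\<forall>\<^sub>F n in sequentially. \<forall>F. finite F \<longrightarrow> F \<subseteq> I n \<longrightarrow> lattice_sum r (s_param r n) F \<le> \<epsilon>"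
    by eventually_elim auto
qed

lemma s_pos: "n \<ge> 1 \<Longrightarrow> s_param r n > 0"
  by (rule s_param_works(1)[OF r])

lemma negligible_small_side:
  assumes box: "\<forall>n\<ge>1. I n = int_box r (lo n) (hi n)" and j: "j \<in> {1..r}"
    and lim: "(\<lambda>n. s_param r n * hi n j) \<longlonglongrightarrow> 0"
  shows "negligible r I"
proof (rule negligibleI)
  fix \<epsilon> :: real assume \<epsilon>: "\<epsilon> > 0"
  \<comment> \<open>the solution of \<open>lattice_const r * \<eta> powr tail_exp r = \<epsilon>\<close>\<close>
  define \<eta> where "\<eta> = (\<epsilon> / lattice_const r) powr (1 / tail_exp r)"
  have \<eta>: "\<eta> > 0" "lattice_const r * \<eta> powr tail_exp r = \<epsilon>"
    using \<epsilon> lattice_const_pos[of r] tail_exp[of r] by (auto simp: \<eta>_def powr_powr)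
  show "\<forall>\<^sub>F n in sequentially. n \<ge> 1 \<longrightarrow> s_param r n \<le> 1 \<longrightarrow>
     (\<forall>F. finite F \<longrightarrow> F \<subseteq> I n \<longrightarrow> lattice_sum r (s_param r n) F \<le> \<epsilon>)"
    using order_tendstoD(2)[OF lim \<eta>(1)]
  proof eventually_elim
    case (elim n)
    show ?case
    proof safe
      fix F assume n: "1 \<le> n" and F: "finite F" "F \<subseteq> I n"
      have "lattice_sum r (s_param r n) F \<le> lattice_const r * \<eta> powr tail_exp r"
      proof (rule lattice_sum_small_coord[OF r s_pos[OF n] F(1) _ j])
        show "F \<subseteq> irreps r" using F I n by auto
        fix k assume "k \<in> F"
        hence "real (k j) \<le> hi n j" using F box n j by (auto simp: int_box_def)
        hence "s_param r n * real (k j) \<le> s_param r n * hi n j"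
          using s_pos[OF n] by (intro mult_left_mono) auto
        thus "s_param r n * real (k j) \<le> \<eta>" using elim by linarith
      qed (use \<eta> in auto)
      thus "lattice_sum r (s_param r n) F \<le> \<epsilon>" by (simp add: \<eta>(2))
    qed
  qed
qed

lemma negligible_large_side:
  assumes box: "\<forall>n\<ge>1. I n = int_box r (lo n) (hi n)" and j: "j \<in> {1..r}"
    and lim: "filterlim (\<lambda>n. s_param r n * lo n j) at_top sequentially"
  shows "negligible r I"
proof (rule negligibleI)
  fix \<epsilon> :: real assume \<epsilon>: "\<epsilon> > 0"
  define T where "T = 1 + (lattice_const r / \<epsilon>) powr (1 / tail_exp r)"
  have T: "T \<ge> 1" "(T - 1) powr tail_exp r = lattice_const r / \<epsilon>"
    using \<epsilon> lattice_const_pos[of r] tail_exp[of r] by (auto simp: T_def powr_powr)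
  have "\<forall>\<^sub>F n in sequentially. T \<le> s_param r n * lo n j"
    using lim by (simp add: filterlim_at_top)
  thus "\<forall>\<^sub>F n in sequentially. n \<ge> 1 \<longrightarrow> s_param r n \<le> 1 \<longrightarrow>
     (\<forall>F. finite F \<longrightarrow> F \<subseteq> I n \<longrightarrow> lattice_sum r (s_param r n) F \<le> \<epsilon>)"
  proof eventually_elim
    case (elim n)
    show ?case
    proof safe
      fix F assume n: "1 \<le> n" and s1: "s_param r n \<le> 1" and F: "finite F" "F \<subseteq> I n"
      let ?t = "(T - s_param r n) powr tail_exp r"
      have "lattice_sum r (s_param r n) F \<le> lattice_const r * (1 / (1 + ?t))"
      proof (rule lattice_sum_large_coord[OF r s_pos[OF n] F(1) _ j])
        show "F \<subseteq> irreps r" using F I n by auto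
        show "s_param r n \<le> T" using s1 T by linarith
        fix k assume "k \<in> F"
        hence "lo n j \<le> real (k j)" using F box n j by (auto simp: int_box_def)
        hence "s_param r n * lo n j \<le> s_param r n * real (k j)"
          using s_pos[OF n] by (intro mult_left_mono) auto
        thus "T \<le> s_param r n * real (k j)" using elim by linarith
      qed
      also have "\<dots> \<le> \<epsilon>"
      proof -
        have "lattice_const r / \<epsilon> \<le> ?t"
          unfolding T(2)[symmetric] using s1 T tail_exp[of r] by (intro powr_mono2) auto
        hence "lattice_const r \<le> \<epsilon> * (1 + ?t)" using \<epsilon> by (simp add: field_simps)
        moreover have "1 + ?t > 0" by (intro add_pos_nonneg) auto
        ultimately show ?thesis by (simp add: divide_le_eq)
      qed
      finally show "lattice_sum r (s_param r n) F \<le> \<epsilon>" .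
    qed
  qed
qed

lemma negligible_small_dim:
  assumes lim: "(\<lambda>n. SUP k\<in>I n. scaled_dim r n k) \<longlonglongrightarrow> 0"
  shows "negligible r I"
proof (rule negligibleI)
  fix \<epsilon> :: real assume \<epsilon>: "\<epsilon> > 0"
  let ?c = "real (superfact r)"
  have c: "?c > 0" using superfact_pos[of r] by simp
  define \<eta> where "\<eta> = min 1 ((\<epsilon> / lattice_const r) powr (real r + 1)) / ?c"
  have \<eta>: "\<eta> > 0" "?c * \<eta> \<le> 1" using c \<epsilon> lattice_const_pos[of r] by (auto simp: \<eta>_def)
  have "lattice_const r * (?c * \<eta>) powr (1 / (real r + 1)) \<le> lattice_const r * ((\<epsilon> / lattice_const r) powr (real r + 1)) powr (1 / (real r + 1))"
    using c lattice_const_pos[of r] \<epsilon> by (intro mult_left_mono powr_mono2) (auto simp: \<eta>_def)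
  also have "\<dots> = \<epsilon>" using \<epsilon> lattice_const_pos[of r] by (simp add: powr_powr)
  finally have \<eta>\<epsilon>: "lattice_const r * (?c * \<eta>) powr (1 / (real r + 1)) \<le> \<epsilon>" .
  have "\<forall>\<^sub>F n in sequentially. (SUP k\<in>I n. scaled_dim r n k) < ennreal \<eta>"
    by (rule order_tendstoD(2)[OF lim]) (use \<eta> in auto)
  thus "\<forall>\<^sub>F n in sequentially. n \<ge> 1 \<longrightarrow> s_param r n \<le> 1 \<longrightarrow>
     (\<forall>F. finite F \<longrightarrow> F \<subseteq> I n \<longrightarrow> lattice_sum r (s_param r n) F \<le> \<epsilon>)"
  proof eventually_elim
    case (elim n)
    show ?case
    proof safe
      fix F assume n: "1 \<le> n" and F: "finite F" "F \<subseteq> I n"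
      have "lattice_sum r (s_param r n) F \<le> lattice_const r * (?c * \<eta>) powr (1 / (real r + 1))"
      proof (rule lattice_sum_small_dim[OF r s_pos[OF n] F(1) _ \<eta>(2)])
        show "F \<subseteq> irreps r" using F I n by auto
        fix k assume "k \<in> F"
        hence "scaled_dim r n k \<le> (SUP k\<in>I n. scaled_dim r n k)" using F by (intro SUP_upper) auto
        hence "scaled_dim r n k \<le> ennreal \<eta>" using elim by (meson le_less_trans less_imp_le)
        thus "s_param r n ^ num_roots r * irrep_dim r k \<le> \<eta>"
          using \<eta>(1) by (simp add: scaled_dim_eq ennreal_le_iff)
      qed
      thus "lattice_sum r (s_param r n) F \<le> \<epsilon>" using \<eta>\<epsilon> by linarith
    qed
  qed
qed

lemma negligible_large_dim:
  assumes lim: "(\<lambda>n. INF k\<in>I n. scaled_dim r n k) \<longlonglongrightarrow> \<infinity>"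
  shows "negligible r I"
proof (rule negligibleI)
  fix \<epsilon> :: real assume \<epsilon>: "\<epsilon> > 0"
  define T where "T = max 1 (lattice_const r / \<epsilon>)"
  have T: "T \<ge> 1" "lattice_const r * (1 / T) \<le> \<epsilon>"
  proof -
    show T1: "T \<ge> 1" by (simp add: T_def)
    have "lattice_const r / \<epsilon> \<le> T" by (simp add: T_def)
    thus "lattice_const r * (1 / T) \<le> \<epsilon>" using \<epsilon> T1 by (simp add: field_simps)
  qed
  have "\<forall>\<^sub>F n in sequentially. ennreal T < (INF k\<in>I n. scaled_dim r n k)"
    by (rule order_tendstoD(1)[OF lim]) simp
  thus "\<forall>\<^sub>F n in sequentially. n \<ge> 1 \<longrightarrow> s_param r n \<le> 1 \<longrightarrow>
     (\<forall>F. finite F \<longrightarrow> F \<subseteq> I n \<longrightarrow> lattice_sum r (s_param r n) F \<le> \<epsilon>)"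
  proof eventually_elim
    case (elim n)
    show ?case
    proof safe
      fix F assume n: "1 \<le> n" and F: "finite F" "F \<subseteq> I n"
      have "lattice_sum r (s_param r n) F \<le> lattice_const r * (1 / T)"
      proof (rule lattice_sum_large_dim[OF r s_pos[OF n] F(1) _ T(1)])
        show "F \<subseteq> irreps r" using F I n by auto
        fix k assume "k \<in> F"
        hence "(INF k\<in>I n. scaled_dim r n k) \<le> scaled_dim r n k" using F by (intro INF_lower) auto
        hence "ennreal T \<le> scaled_dim r n k" using elim by (meson less_le_trans less_imp_le)
        moreover have "0 \<le> s_param r n ^ num_roots r * irrep_dim r k"
          using s_pos[OF n] by (simp add: irrep_dim_nat)
        ultimately show "T \<le> s_param r n ^ num_roots r * irrep_dim r k"
          using T(1) by (simp add: scaled_dim_eq ennreal_le_iff)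
      qed
      thus "lattice_sum r (s_param r n) F \<le> \<epsilon>" using T(2) by linarith
    qed
  qed
qed

lemma tv_dist_tendsto_0_of_negligible:
  assumes neg: "negligible r I"
  shows "(\<lambda>n. tv_dist (mult_law (I n) (boltzmann_rep r (q_param r n)))
                      (mult_law (I n) (uniform_rep r n))) \<longlonglongrightarrow> 0"
proof -
  obtain C \<theta>0 s1 :: real where tv: "0 < \<theta>0" "0 < s1"
    "\<And>n I \<theta>. n \<ge> 1 \<Longrightarrow> s_param r n \<le> s1 \<Longrightarrow> I \<subseteq> irreps r \<Longrightarrow> \<theta> \<le> \<theta>0 \<Longrightarrow>
      (\<And>F. finite F \<Longrightarrow> F \<subseteq> I \<Longrightarrow> lattice_sum r (s_param r n) F \<le> \<theta>) \<Longrightarrow>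
      0 \<le> tv_dist (mult_law I (boltzmann_rep r (q_param r n))) (mult_law I (uniform_rep r n)) \<and>
      tv_dist (mult_law I (boltzmann_rep r (q_param r n))) (mult_law I (uniform_rep r n)) \<le> C * sqrt \<theta>"
  proof (rule tv_dist_mult_law_le[OF r], goal_cases)
    case (1 C \<theta>0 s1)
    show ?case by (rule 1(1)[OF 1(2-4)])
  qed
  let ?tv = "\<lambda>n. tv_dist (mult_law (I n) (boltzmann_rep r (q_param r n))) (mult_law (I n) (uniform_rep r n))"
  have "\<forall>\<^sub>F n in sequentially. dist (?tv n) 0 < e" if e: "e > 0" for e
  proof -
    define \<theta> where "\<theta> = min \<theta>0 ((e / (\<bar>C\<bar> + 1))\<^sup>2)"
    have \<theta>: "\<theta> > 0" "\<theta> \<le> \<theta>0" using tv e by (auto simp: \<theta>_def)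
    have "sqrt \<theta> \<le> e / (\<bar>C\<bar> + 1)" using e by (intro real_le_lsqrt) (auto simp: \<theta>_def tv(1) less_imp_le)
    hence "(\<bar>C\<bar> + 1) * sqrt \<theta> \<le> e" by (simp add: field_simps add_pos_nonneg)
    hence "\<bar>C\<bar> * sqrt \<theta> + sqrt \<theta> \<le> e" by (simp add: distrib_right)
    moreover have "C * sqrt \<theta> \<le> \<bar>C\<bar> * sqrt \<theta>" using \<theta> by (intro mult_right_mono) auto
    moreover have "0 < sqrt \<theta>" using \<theta> by simp
    ultimately have C: "C * sqrt \<theta> < e" by linarith
    have "\<forall>\<^sub>F n in sequentially. s_param r n < s1"
      using order_tendstoD(2)[OF s_param_tendsto_0[OF r] tv(2)] .
    moreover have "\<forall>\<^sub>F n in sequentially. \<forall>F. finite F \<longrightarrow> F \<subseteq> I n \<longrightarrow> lattice_sum r (s_param r n) F \<le> \<theta>"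
      using neg \<theta>(1) by (simp add: negligible_def)
    ultimately show ?thesis using eventually_ge_at_top[of 1]
    proof eventually_elim
      case (elim n)
      have "0 \<le> ?tv n \<and> ?tv n \<le> C * sqrt \<theta>"
        using elim I \<theta>(2) by (intro tv(3)) auto
      thus ?case using C by simp
    qed
  qed
  thus ?thesis by (rule tendstoI)
qed

end

theorem corollary4p5:
  fixes r :: nat and I :: "nat \<Rightarrow> (nat \<Rightarrow> nat) set"
  assumes "r \<ge> 2"
    and "\<forall>n\<ge>1. I n \<subseteq> irreps r"
    and "(\<exists>lo hi :: nat \<Rightarrow> nat \<Rightarrow> real. (\<forall>n\<ge>1. I n = int_box r (lo n) (hi n)) \<and>
            (\<exists>j\<in>{1..r}. (\<lambda>n. s_param r n * hi n j) \<longlonglongrightarrow> 0))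
       \<or> (\<exists>lo hi :: nat \<Rightarrow> nat \<Rightarrow> real. (\<forall>n\<ge>1. I n = int_box r (lo n) (hi n)) \<and>
            (\<exists>j\<in>{1..r}. filterlim (\<lambda>n. s_param r n * lo n j) at_top sequentially))
       \<or> (\<lambda>n. SUP k\<in>I n. scaled_dim r n k) \<longlonglongrightarrow> 0
       \<or> (\<lambda>n. INF k\<in>I n. scaled_dim r n k) \<longlonglongrightarrow> \<infinity>"
  shows "(\<lambda>n. tv_dist (mult_law (I n) (boltzmann_rep r (q_param r n)))
                      (mult_law (I n) (uniform_rep r n))) \<longlonglongrightarrow> 0"
proof (rule tv_dist_tendsto_0_of_negligible[OF assms(1,2)])
  note neg = negligible_small_side[OF assms(1,2)] negligible_large_side[OF assms(1,2)]
    negligible_small_dim[OF assms(1,2)] negligible_large_dim[OF assms(1,2)]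
  from assms(3) show "negligible r I"
    by (elim disjE exE conjE bexE) (erule (2) neg | erule neg)+
qed

end
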